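(* Let $(\mathcal{M}_1,\mathfrak{g}_1)$ and $(\mathcal{M}_2,\mathfrak{g}_2)$ be smooth, oriented $d$-dimensional Riemannian manifolds. Then every $f\in C^2(\mathcal{M}_1;\mathcal{M}_2)$ satisfies the Riemannian Piola identity $$\delta_{\nabla^{f^*T\mathcal{M}_2}}\,\operatorname{Cof} df = 0 .$$ Equivalently, for every compactly-supported section $\xi\in\Gamma(f^*T\mathcal{M}_2)$, $$\int_{\mathcal{M}_1}\left\langle \operatorname{Cof} df,\nabla^{f^*T\mathcal{M}_2}\xi\right\rangle_{\mathfrak{g}_1,\mathfrak{g}_2}\,d\mathrm{Vol}_1=0 .$$
   Context: For an oriented $d$-dimensional inner-product space $V$, let $\Lambda_k(V)$ be its $k$-th exterior power and $\star_V^k:\Lambda_k(V)\to\Lambda_{d-k}(V)$ the Hodge-dual operator ($\alpha\wedge\star_V^k\beta=\langle\alpha,\beta\rangle\, e_1\wedge\dots\wedge e_d$ for a positively-oriented orthonormal basis $(e_i)$). For a linear map $A:V\to W$ between oriented $d$-dimensional inner-product spaces, the cofactor is $\operatorname{Cof}A:=(-1)^{d-1}\star_W^{d-1}\circ\bigwedge^{d-1}A\circ\star_V^1:V\to W$. (In positively-oriented orthonormal bases it is represented by the matrix-cofactor, i.e. the transpose of the adjugate, of the matrix of $A$.) For $f:\mathcal{M}_1\to\mathcal{M}_2$, the differential is viewed as a linear bundle map $df:T\mathcal{M}_1\to f^*T\mathcal{M}_2$, and $\operatorname{Cof}df$ is defined fiberwise, so that $\operatorname{Cof}df\in\Gamma(T^*\mathcal{M}_1\otimes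 f^*T\mathcal{M}_2)=\Omega^1(\mathcal{M}_1;f^*T\mathcal{M}_2)$. The bundle $f^*T\mathcal{M}_2$ carries the pullback of $\mathfrak{g}_2$ and the pullback $\nabla^{f^*T\mathcal{M}_2}$ of the Levi-Civita connection of $\mathfrak{g}_2$; $\langle\cdot,\cdot\rangle_{\mathfrak{g}_1,\mathfrak{g}_2}$ is the induced inner product on $T^*\mathcal{M}_1\otimes f^*T\mathcal{M}_2$; $d\mathrm{Vol}_1$ is the Riemannian volume form of $\mathfrak{g}_1$. Coderivative: for a vector bundle $E\to\mathcal{M}$ over an oriented Riemannian manifold, with a metric and a metric-compatible connection $\nabla^E$, $\delta_{\nabla^E}:\Omega^1(\mathcal{M};E)\to\Gamma(E)$ is the adjoint of $\nabla^E:\Gamma(E)\to\Omega^1(\mathcal{M};E)$: $\int_{\mathcal M}\langle\sigma,\delta_{\nabla^E}\rho\rangle\,d\mathrm{Vol}=\int_{\mathcal M}\langle\nabla^E\sigma,\rho\rangle\,d\mathrm{Vol}$ for all $\rho\in\Omega^1(\mathcal M;E)$ and compactly-supported $\sigma\in\Gamma(E)$. Explicitly, $\delta_{\nabla^E}\omega=-\sum_{i=1}^d(\nabla_{E_i}\omega)(E_i)$ for any local orthonormal frame $(E_i)$ of $T\mathcal{M}$, where $\nabla$ is the connection on $T^*\mathcal{M}\otimes E$ induced by the Levi-Civita connection and $\nabla^E$. *)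

theory Defs
  imports "HOL-Analysis.Analysis" "HOL-Library.Function_Algebras"
begin

section \<open>Functions as a real vector space\<close>

instantiation "fun" :: (type, real_vector) real_vector
begin

definition scaleR_fun :: "real \<Rightarrow> ('a \<Rightarrow> 'b) \<Rightarrow> 'a \<Rightarrow> 'b"
  where "scaleR_fun r f = (\<lambda>x. r *\<^sub>R f x)"

instance
  by standard (simp_all add: scaleR_fun_def fun_eq_iff algebra_simps)

end


section \<open>Oriented inner-product spaces, exterior powers, Hodge dual, cofactor\<close>

text \<open>
  A finite-dimensional oriented inner-product space is a linear subspace of an ambient real vector
  space, with an inner product and a predicate telling which ordered bases are positively oriented.
\<close>

record 'v oriented_ip_space =
  carrier :: "'v set"
  ip :: "'v \<Rightarrow> 'v \<Rightarrow> real"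
  pos_oriented :: "'v list \<Rightarrow> bool"

definition vdim :: "('v::real_vector) oriented_ip_space \<Rightarrow> nat"
  where "vdim V = dim (carrier V)"

definition orthonormal_basis :: "('v::real_vector) oriented_ip_space \<Rightarrow> 'v list \<Rightarrow> bool"
  where "orthonormal_basis V e \<longleftrightarrow>
    length e = vdim V \<and> set e \<subseteq> carrier V \<and>
    (\<forall>i<vdim V. \<forall>j<vdim V. ip V (e ! i) (e ! j) = (if i = j then 1 else 0))"

text \<open>
  Alternating \<open>k\<close>-linear forms on \<open>V\<close>, as functions of argument lists.  Only the values on lists of
  length \<open>k\<close> in \<open>V\<close> are constrained.
\<close>

definition alt_forms :: "('v::real_vector) oriented_ip_space \<Rightarrow> nat \<Rightarrow> ('v list \<Rightarrow> real) set"
  where "alt_forms V k = {\<omega>. \<forall>xs. length xs = k \<and> set xs \<subseteq> carrier V \<longrightarrow>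
    (\<forall>i<k. \<forall>u\<in>carrier V. \<forall>v\<in>carrier V. \<forall>a b.
       \<omega> (xs[i := a *\<^sub>R u + b *\<^sub>R v]) = a * \<omega> (xs[i := u]) + b * \<omega> (xs[i := v])) \<and>
    (\<forall>i<k. \<forall>j<k. i \<noteq> j \<and> xs ! i = xs ! j \<longrightarrow> \<omega> xs = 0)}"

text \<open>
  A \<open>k\<close>-vector is represented by the functional it induces on alternating \<open>k\<close>-forms, extended by
  zero to all other functions: \<open>v\<^sub>1 \<and> \<dots> \<and> v\<^sub>k\<close> is evaluation at \<open>(v\<^sub>1, \<dots>, v\<^sub>k)\<close>, and the \<open>k\<close>-th
  exterior power is the span of these.  (In finite dimension the exterior power is the dual of the
  space of alternating forms.)  On the decomposable \<open>k\<close>-vectors, the functions below are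
  \<^item> \<open>wedge_prod\<close>: \<open>(x\<^sub>1 \<and> \<dots> \<and> x\<^sub>k) \<and> (y\<^sub>1 \<and> \<dots> \<and> y\<^sub>l) = x\<^sub>1 \<and> \<dots> \<and> x\<^sub>k \<and> y\<^sub>1 \<and> \<dots> \<and> y\<^sub>l\<close>,
  \<^item> \<open>ext_ip\<close>: the Gram determinant \<open>det (\<langle>x\<^sub>i, y\<^sub>j\<rangle>)\<close>,
  \<^item> \<open>ext_map\<close>: \<open>x\<^sub>1 \<and> \<dots> \<and> x\<^sub>k \<mapsto> A x\<^sub>1 \<and> \<dots> \<and> A x\<^sub>k\<close>.
\<close>

type_synonym 'v multivector = "('v list \<Rightarrow> real) \<Rightarrow> real"

definition wedge :: "('v::real_vector) oriented_ip_space \<Rightarrow> 'v list \<Rightarrow> 'v multivector"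
  where "wedge V xs = (\<lambda>\<omega>. if \<omega> \<in> alt_forms V (length xs) then \<omega> xs else 0)"

definition ext_power :: "('v::real_vector) oriented_ip_space \<Rightarrow> nat \<Rightarrow> 'v multivector set"
  where "ext_power V k = span {wedge V xs | xs. length xs = k \<and> set xs \<subseteq> carrier V}"

definition wedge_prod :: "('v::real_vector) oriented_ip_space \<Rightarrow> nat \<Rightarrow> nat \<Rightarrow>
    'v multivector \<Rightarrow> 'v multivector \<Rightarrow> 'v multivector"
  where "wedge_prod V k l \<alpha> \<beta> =
    (\<lambda>\<omega>. if \<omega> \<in> alt_forms V (k + l) then \<alpha> (\<lambda>xs. \<beta> (\<lambda>ys. \<omega> (xs @ ys))) else 0)"

definition ext_ip :: "('v::real_vector) oriented_ip_space \<Rightarrow> nat \<Rightarrow>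
    'v multivector \<Rightarrow> 'v multivector \<Rightarrow> real"
  where "ext_ip V k \<alpha> \<beta> =
    \<alpha> (\<lambda>xs. \<beta> (\<lambda>ys.
      \<Sum>\<pi> | \<pi> permutes {..<k}. of_int (sign \<pi>) * (\<Prod>i<k. ip V (xs ! i) (ys ! \<pi> i))))"

definition ext_map :: "('w::real_vector) oriented_ip_space \<Rightarrow> nat \<Rightarrow> ('v::real_vector \<Rightarrow> 'w) \<Rightarrow>
    'v multivector \<Rightarrow> 'w multivector"
  where "ext_map W k A \<alpha> =
    (\<lambda>\<omega>. if \<omega> \<in> alt_forms W k then \<alpha> (\<lambda>xs. \<omega> (map A xs)) else 0)"

definition hodge :: "('v::real_vector) oriented_ip_space \<Rightarrow> nat \<Rightarrow> 'v multivector \<Rightarrow> 'v multivector"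
  where "hodge V k \<beta> = (THE \<gamma>. \<gamma> \<in> ext_power V (vdim V - k) \<and>
    (\<forall>\<alpha>\<in>ext_power V k. \<forall>e. orthonormal_basis V e \<and> pos_oriented V e \<longrightarrow>
       wedge_prod V k (vdim V - k) \<alpha> \<gamma> = ext_ip V k \<alpha> \<beta> *\<^sub>R wedge V e))"

text \<open>
  \<open>(-1)\<^sup>d\<^sup>-\<^sup>1 \<star>\<^sub>W\<^sup>d\<^sup>-\<^sup>1 \<circ> \<Lambda>\<^sup>d\<^sup>-\<^sup>1 A \<circ> \<star>\<^sub>V\<^sup>1\<close>, with \<open>V\<close> and \<open>W\<close> identified with their first exterior powers
  by \<open>v \<mapsto> wedge V [v]\<close>.
\<close>

definition cof :: "('v::real_vector) oriented_ip_space \<Rightarrow> ('w::real_vector) oriented_ip_space \<Rightarrow>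
    ('v \<Rightarrow> 'w) \<Rightarrow> 'v \<Rightarrow> 'w"
  where "cof V W A v = (THE w. w \<in> carrier W \<and>
    wedge W [w] = (- 1) ^ (vdim V - 1) *\<^sub>R
      hodge W (vdim V - 1) (ext_map W (vdim V - 1) A (hodge V 1 (wedge V [v]))))"

definition hom_ip :: "('v::real_vector) oriented_ip_space \<Rightarrow> ('w::real_vector) oriented_ip_space \<Rightarrow>
    ('v \<Rightarrow> 'w) \<Rightarrow> ('v \<Rightarrow> 'w) \<Rightarrow> real"
  where "hom_ip V W A B = (THE r. \<forall>e. orthonormal_basis V e \<longrightarrow>
    r = (\<Sum>i<vdim V. ip W (A (e ! i)) (B (e ! i))))"


section \<open>Differentiability classes on open subsets of Euclidean space\<close>

primrec Ck_on :: "nat \<Rightarrow> ('a::real_normed_vector) set \<Rightarrow> ('a \<Rightarrow> 'b::real_normed_vector) \<Rightarrow> bool"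
  where
    "Ck_on 0 S f \<longleftrightarrow> continuous_on S f"
  | "Ck_on (Suc k) S f \<longleftrightarrow> (\<forall>x\<in>S. f differentiable (at x)) \<and>
       (\<forall>v. Ck_on k S (\<lambda>x. frechet_derivative f (at x) v))"

definition smooth_on :: "('a::real_normed_vector) set \<Rightarrow> ('a \<Rightarrow> 'b::real_normed_vector) \<Rightarrow> bool"
  where "smooth_on S f \<longleftrightarrow> (\<forall>k. Ck_on k S f)"


section \<open>Oriented Riemannian manifolds\<close>

text \<open>
  A chart consists of a domain and a coordinate map, whose values off the domain are irrelevant.
  A tangent vector at \<open>p\<close> is the family of its coordinate vectors in all the charts of the atlas
  around \<open>p\<close>, related by the derivatives of the chart transitions; the entry at anything else than
  a chart around \<open>p\<close> is zero.  The linear order on the index type \<open>'n\<close> of the coordinates serves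
  to orient \<open>real^'n\<close>; the dimension is \<open>CARD('n)\<close>.
\<close>

type_synonym 'n rvec = "real^'n"
type_synonym 'n rmat = "real^'n^'n"
type_synonym ('a, 'n) chart = "'a set \<times> ('a \<Rightarrow> real^'n)"
type_synonym ('a, 'n) tvec = "('a, 'n) chart \<Rightarrow> 'n rvec"

record ('a, 'n) manifold =
  mtop :: "'a topology"
  atlas :: "('a, 'n) chart set"
  metric :: "'a \<Rightarrow> ('a, 'n) tvec \<Rightarrow> ('a, 'n) tvec \<Rightarrow> real"

abbreviation points :: "('a, 'n::{finite,linorder}) manifold \<Rightarrow> 'a set"
  where "points M \<equiv> topspace (mtop M)"

definition charts_at :: "('a, 'n::{finite,linorder}) manifold \<Rightarrow> 'a \<Rightarrow> ('a, 'n) chart set"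
  where "charts_at M p = {c \<in> atlas M. p \<in> fst c}"

definition chart_inv :: "('a, 'n::{finite,linorder}) chart \<Rightarrow> 'n rvec \<Rightarrow> 'a"
  where "chart_inv c = inv_into (fst c) (snd c)"

definition transition :: "('a, 'n::{finite,linorder}) chart \<Rightarrow> ('a, 'n) chart \<Rightarrow> 'n rvec \<Rightarrow> 'n rvec"
  where "transition c c' = snd c' \<circ> chart_inv c"

definition oriented_smooth_manifold :: "('a, 'n::{finite,linorder}) manifold \<Rightarrow> bool"
  where "oriented_smooth_manifold M \<longleftrightarrow>
    Hausdorff_space (mtop M) \<and> second_countable (mtop M) \<and>
    (\<Union>c\<in>atlas M. fst c) = points M \<and>
    (\<forall>c\<in>atlas M. openin (mtop M) (fst c) \<and> open (snd c ` fst c) \<and>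
       homeomorphic_map (subtopology (mtop M) (fst c)) (top_of_set (snd c ` fst c)) (snd c)) \<and>
    (\<forall>c\<in>atlas M. \<forall>c'\<in>atlas M.
       smooth_on (snd c ` (fst c \<inter> fst c')) (transition c c') \<and>
       (\<forall>x\<in>snd c ` (fst c \<inter> fst c').
          det (matrix (frechet_derivative (transition c c') (at x))) > 0))"

definition tangent_space :: "('a, 'n::{finite,linorder}) manifold \<Rightarrow> 'a \<Rightarrow> ('a, 'n) tvec set"
  where "tangent_space M p = {v.
    (\<forall>c\<in>charts_at M p. \<forall>c'\<in>charts_at M p.
       v c' = frechet_derivative (transition c c') (at (snd c p)) (v c)) \<and>
    (\<forall>c. c \<notin> charts_at M p \<longrightarrow> v c = 0)}"

text \<open>The tangent vector at \<open>p\<close> whose coordinate vector in the chart \<open>c\<close> is \<open>w\<close>.\<close>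

definition coord_vec :: "('a, 'n::{finite,linorder}) manifold \<Rightarrow> ('a, 'n) chart \<Rightarrow> 'a \<Rightarrow>
    'n rvec \<Rightarrow> ('a, 'n) tvec"
  where "coord_vec M c p w = (\<lambda>c'. if c' \<in> charts_at M p
    then frechet_derivative (transition c c') (at (snd c p)) w else 0)"

definition metric_matrix :: "('a, 'n::{finite,linorder}) manifold \<Rightarrow> ('a, 'n) chart \<Rightarrow>
    'n rvec \<Rightarrow> 'n rmat"
  where "metric_matrix M c x = (let p = chart_inv c x in
    \<chi> i j. metric M p (coord_vec M c p (axis i 1)) (coord_vec M c p (axis j 1)))"

definition inner_product_on :: "('v::real_vector) set \<Rightarrow> ('v \<Rightarrow> 'v \<Rightarrow> real) \<Rightarrow> bool"
  where "inner_product_on V g \<longleftrightarrow>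
    (\<forall>u\<in>V. \<forall>v\<in>V. g u v = g v u) \<and>
    (\<forall>u\<in>V. \<forall>v\<in>V. \<forall>w\<in>V. \<forall>a b. g (a *\<^sub>R u + b *\<^sub>R v) w = a * g u w + b * g v w) \<and>
    (\<forall>u\<in>V. u \<noteq> 0 \<longrightarrow> g u u > 0)"

definition oriented_riemannian_manifold :: "('a, 'n::{finite,linorder}) manifold \<Rightarrow> bool"
  where "oriented_riemannian_manifold M \<longleftrightarrow>
    oriented_smooth_manifold M \<and>
    (\<forall>p\<in>points M. inner_product_on (tangent_space M p) (metric M p)) \<and>
    (\<forall>c\<in>atlas M. smooth_on (snd c ` fst c) (metric_matrix M c))"

text \<open>
  The orientation declares every coordinate frame, listed in the order of \<open>'n\<close>, to be positive;
  \<open>card {k. k < j}\<close> is the position of the index \<open>j\<close> in that order.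
\<close>

definition tangent :: "('a, 'n::{finite,linorder}) manifold \<Rightarrow> 'a \<Rightarrow> ('a, 'n) tvec oriented_ip_space"
  where "tangent M p = \<lparr>
    carrier = tangent_space M p,
    ip = metric M p,
    pos_oriented = (\<lambda>vs. length vs = CARD('n) \<and> set vs \<subseteq> tangent_space M p \<and>
      (\<forall>c\<in>charts_at M p. det (\<chi> i j. (vs ! card {k. k < j}) c $ i) > 0))\<rparr>"

text \<open>The measure of the Riemannian volume form: the Borel measure with density \<open>sqrt (det g)\<close> in every chart.\<close>

definition riemannian_volume :: "('a, 'n::{finite,linorder}) manifold \<Rightarrow> 'a measure"
  where "riemannian_volume M = (THE \<mu>.
    space \<mu> = points M \<and> sets \<mu> = sigma_sets (points M) {U. openin (mtop M) U} \<and>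
    (\<forall>c\<in>atlas M. \<forall>B\<in>sets \<mu>. B \<subseteq> fst c \<longrightarrow>
       emeasure \<mu> B =
         (\<integral>\<^sup>+x\<in>snd c ` B. ennreal (sqrt (det (metric_matrix M c x))) \<partial>lborel)))"


section \<open>Maps between manifolds and vector fields along them\<close>

definition local_rep :: "('a, 'n::{finite,linorder}) chart \<Rightarrow> ('b, 'm::{finite,linorder}) chart \<Rightarrow>
    ('a \<Rightarrow> 'b) \<Rightarrow> 'n rvec \<Rightarrow> 'm rvec"
  where "local_rep c c' f = snd c' \<circ> f \<circ> chart_inv c"

definition Ck_map :: "nat \<Rightarrow> ('a, 'n::{finite,linorder}) manifold \<Rightarrow>
    ('b, 'm::{finite,linorder}) manifold \<Rightarrow> ('a \<Rightarrow> 'b) \<Rightarrow> bool"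
  where "Ck_map k M N f \<longleftrightarrow> continuous_map (mtop M) (mtop N) f \<and>
    (\<forall>c\<in>atlas M. \<forall>c'\<in>atlas N.
       Ck_on k (snd c ` {q \<in> fst c. f q \<in> fst c'}) (local_rep c c' f))"

definition differential :: "('a, 'n::{finite,linorder}) manifold \<Rightarrow>
    ('b, 'm::{finite,linorder}) manifold \<Rightarrow> ('a \<Rightarrow> 'b) \<Rightarrow> 'a \<Rightarrow> ('a, 'n) tvec \<Rightarrow> ('b, 'm) tvec"
  where "differential M N f p v = (THE w. w \<in> tangent_space N (f p) \<and>
    (\<forall>c\<in>charts_at M p. \<forall>c'\<in>charts_at N (f p).
       w c' = frechet_derivative (local_rep c c' f) (at (snd c p)) (v c)))"

text \<open>
  A section of \<open>f\<^sup>*TN\<close> over the open set \<open>U\<close>, of class \<open>C\<^sup>k\<close>; for \<open>f\<close> the identity this is a vector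
  field.
\<close>

definition Ck_section :: "nat \<Rightarrow> ('a, 'n::{finite,linorder}) manifold \<Rightarrow>
    ('b, 'm::{finite,linorder}) manifold \<Rightarrow> ('a \<Rightarrow> 'b) \<Rightarrow> 'a set \<Rightarrow> ('a \<Rightarrow> ('b, 'm) tvec) \<Rightarrow> bool"
  where "Ck_section k M N f U \<xi> \<longleftrightarrow> (\<forall>q\<in>U. \<xi> q \<in> tangent_space N (f q)) \<and>
    (\<forall>c\<in>atlas M. \<forall>c'\<in>atlas N.
       Ck_on k (snd c ` {q \<in> fst c \<inter> U. f q \<in> fst c'}) (\<lambda>x. \<xi> (chart_inv c x) c'))"

definition compactly_supported :: "('a, 'n::{finite,linorder}) manifold \<Rightarrow>
    ('a \<Rightarrow> 'v::zero) \<Rightarrow> bool"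
  where "compactly_supported M \<xi> \<longleftrightarrow>
    (\<exists>K. compactin (mtop M) K \<and> (\<forall>q\<in>points M - K. \<xi> q = 0))"


section \<open>Levi-Civita connection, pullback connection, coderivative\<close>

text \<open>
  The Christoffel symbols
  \<open>\<Gamma>\<^sup>k\<^sub>i\<^sub>j = 1/2 g\<^sup>k\<^sup>l (\<partial>\<^sub>i g\<^sub>j\<^sub>l + \<partial>\<^sub>j g\<^sub>i\<^sub>l - \<partial>\<^sub>l g\<^sub>i\<^sub>j)\<close> of the Levi-Civita connection, and the bilinear map
  \<open>(u, v) \<mapsto> (\<Gamma>\<^sup>k\<^sub>i\<^sub>j u\<^sup>i v\<^sup>j)\<^sub>k\<close> they define.
\<close>

definition christoffel :: "('a, 'n::{finite,linorder}) manifold \<Rightarrow> ('a, 'n) chart \<Rightarrow> 'n rvec \<Rightarrow>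
    'n \<Rightarrow> 'n \<Rightarrow> 'n \<Rightarrow> real"
  where "christoffel M c x k i j =
    (let dg = (\<lambda>l. frechet_derivative (metric_matrix M c) (at x) (axis l 1)) in
     1/2 * (\<Sum>l\<in>UNIV. matrix_inv (metric_matrix M c x) $ k $ l *
       (dg i $ j $ l + dg j $ i $ l - dg l $ i $ j)))"

definition christoffel_map :: "('a, 'n::{finite,linorder}) manifold \<Rightarrow> ('a, 'n) chart \<Rightarrow> 'n rvec \<Rightarrow>
    'n rvec \<Rightarrow> 'n rvec \<Rightarrow> 'n rvec"
  where "christoffel_map M c x u v =
    (\<chi> k. \<Sum>i\<in>UNIV. \<Sum>j\<in>UNIV. christoffel M c x k i j * u $ i * v $ j)"

text \<open>
  \<open>pullback_conn M N f \<xi> p u\<close> is the covariant derivative at \<open>p\<close> in the direction \<open>u\<close> of the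
  section \<open>\<xi>\<close> of \<open>f\<^sup>*TN\<close>.  In coordinates,
  \<open>(\<nabla>\<^sub>u \<xi>)\<^sup>k = \<partial>\<^sub>u \<xi>\<^sup>k + (\<Gamma>\<^sup>k\<^sub>i\<^sub>j \<circ> f) (df u)\<^sup>i \<xi>\<^sup>j\<close>.
\<close>

definition pullback_conn :: "('a, 'n::{finite,linorder}) manifold \<Rightarrow>
    ('b, 'm::{finite,linorder}) manifold \<Rightarrow> ('a \<Rightarrow> 'b) \<Rightarrow> ('a \<Rightarrow> ('b, 'm) tvec) \<Rightarrow>
    'a \<Rightarrow> ('a, 'n) tvec \<Rightarrow> ('b, 'm) tvec"
  where "pullback_conn M N f \<xi> p u = (THE w. w \<in> tangent_space N (f p) \<and>
    (\<forall>c\<in>charts_at M p. \<forall>c'\<in>charts_at N (f p).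
       w c' = frechet_derivative (\<lambda>x. \<xi> (chart_inv c x) c') (at (snd c p)) (u c) +
         christoffel_map N c' (snd c' (f p)) (differential M N f p u c') (\<xi> p c')))"

definition levi_civita :: "('a, 'n::{finite,linorder}) manifold \<Rightarrow> ('a \<Rightarrow> ('a, 'n) tvec) \<Rightarrow>
    'a \<Rightarrow> ('a, 'n) tvec \<Rightarrow> ('a, 'n) tvec"
  where "levi_civita M X = pullback_conn M M (\<lambda>q. q) X"

text \<open>
  The induced connection on \<open>T\<^sup>*M \<otimes> f\<^sup>*TN\<close>: \<open>(\<nabla>\<^sub>u \<omega>)(v) = \<nabla>\<^sub>u (\<omega>(X)) - \<omega>(\<nabla>\<^sub>u X)\<close> for any local vector
  field \<open>X\<close> with \<open>X p = v\<close>.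
\<close>

definition hom_conn :: "('a, 'n::{finite,linorder}) manifold \<Rightarrow>
    ('b, 'm::{finite,linorder}) manifold \<Rightarrow> ('a \<Rightarrow> 'b) \<Rightarrow>
    ('a \<Rightarrow> ('a, 'n) tvec \<Rightarrow> ('b, 'm) tvec) \<Rightarrow>
    'a \<Rightarrow> ('a, 'n) tvec \<Rightarrow> ('a, 'n) tvec \<Rightarrow> ('b, 'm) tvec"
  where "hom_conn M N f \<omega> p u v = (THE w. \<forall>U X.
    openin (mtop M) U \<and> p \<in> U \<and> Ck_section 1 M M (\<lambda>q. q) U X \<and> X p = v \<longrightarrow>
    w = pullback_conn M N f (\<lambda>q. \<omega> q (X q)) p u - \<omega> p (levi_civita M X p u))"

text \<open>
  \<open>\<delta> \<omega> = - \<Sum>\<^sub>i (\<nabla>\<^bsub>E\<^sub>i\<^esub> \<omega>)(E\<^sub>i)\<close>.  The right-hand side is tensorial in the frame, so that orthonormal bases of the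
  single tangent space at \<open>p\<close> take the place of local orthonormal frames.
\<close>

definition coderivative :: "('a, 'n::{finite,linorder}) manifold \<Rightarrow>
    ('b, 'm::{finite,linorder}) manifold \<Rightarrow> ('a \<Rightarrow> 'b) \<Rightarrow>
    ('a \<Rightarrow> ('a, 'n) tvec \<Rightarrow> ('b, 'm) tvec) \<Rightarrow> 'a \<Rightarrow> ('b, 'm) tvec"
  where "coderivative M N f \<omega> p = (THE w. \<forall>e. orthonormal_basis (tangent M p) e \<longrightarrow>
    w = - (\<Sum>i<vdim (tangent M p). hom_conn M N f \<omega> p (e ! i) (e ! i)))"

definition cof_df :: "('a, 'n::{finite,linorder}) manifold \<Rightarrow>
    ('b, 'm::{finite,linorder}) manifold \<Rightarrow> ('a \<Rightarrow> 'b) \<Rightarrow>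
    'a \<Rightarrow> ('a, 'n) tvec \<Rightarrow> ('b, 'm) tvec"
  where "cof_df M N f p = cof (tangent M p) (tangent N (f p)) (differential M N f p)"

end

theory Submission
  imports Defs
begin

text \<open>
  In charts, let \<open>G\<close> and \<open>H\<close> be the matrices of the two metrics, \<open>A\<close> the Jacobian matrix of \<open>f\<close> and
  \<open>cofm A\<close> its matrix of cofactors, which is the gradient of the determinant at \<open>A\<close>.  Unfolding the
  Hodge duals shows that \<open>\<langle>Cof A v, z\<rangle>\<close> is the derivative of the volume spanned by the \<open>A e\<^sub>j\<close> when \<open>A\<close> is
  varied in the direction \<open>\<langle>v, _\<rangle> z\<close> (\<open>cof_characterization\<close>).  Hence \<open>Cof df\<close> has the matrix
  \<open>sqrt (det H / det G) H\<^sup>-\<^sup>1 (cofm A) G\<close> (\<open>cof_df_coords\<close>).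

  Three facts about this matrix make the theorem true.
  \<^item> The rows of \<open>cofm A\<close> are divergence free: the second derivative of the determinant is antisymmetric
    in the column indices, the second derivative of \<open>f\<close> is symmetric in them (\<open>piola_euclidean\<close>).
  \<^item> \<open>cofm A\<close> times the transpose of \<open>A\<close> is \<open>det A\<close> times the identity (\<open>cofm_row\<close>).
  \<^item> The logarithmic derivative of \<open>sqrt (det H)\<close> is the trace of the Christoffel map (\<open>gamma_trace\<close>).

  When \<open>Cof df\<close> is differentiated covariantly and traced, metric compatibility turns the derivatives of
  \<open>G\<close> and \<open>H\<close> into Christoffel terms.  By the three facts these are \<open>det A\<close> times two equal traces of
  opposite sign (\<open>divergence_zero\<close>).  The same facts show that \<open>sqrt (det G) \<langle>Cof df, \<nabla>\<xi>\<rangle>\<close> is the Euclidean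
  divergence of the field \<open>sqrt (det H) (cofm A)\<^sup>T \<xi>\<close> (\<open>weighted_integrand\<close>, \<open>integrand_divergence\<close>).
  That field is once continuously differentiable, so its divergence integrates to zero when it has
  compact support in a chart; bump functions reduce the general case to this one.

  The differential, the connections, the coderivative, the inner product of homomorphisms and the volume
  measure are definite descriptions over all charts, frames or local extensions.  Each has to be
  shown to exist before it can be computed in one chart.  For the connections this rests on the
  transformation law of the Christoffel symbols (\<open>christoffel_transform\<close>), for the volume on the change of
  variables formula (\<open>chart_volume_compatible\<close>).
\<close>

section \<open>Alternating forms\<close>

definition lists_in :: "('v::real_vector) oriented_ip_space \<Rightarrow> nat \<Rightarrow> 'v list set"
  where "lists_in V k = {xs. length xs = k \<and> set xs \<subseteq> carrier V}"

locale carrier_subspace =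
  fixes V :: "('v::real_vector) oriented_ip_space"
  assumes subspace_carrier: "subspace (carrier V)"
begin

lemma add_carrier [simp]: "x \<in> carrier V \<Longrightarrow> y \<in> carrier V \<Longrightarrow> x + y \<in> carrier V"
  and scale_carrier [simp]: "x \<in> carrier V \<Longrightarrow> a *\<^sub>R x \<in> carrier V"
  and zero_carrier [simp]: "0 \<in> carrier V"
  using subspace_carrier by (auto simp: subspace_def)

lemma sum_carrier: "(\<And>i. i \<in> I \<Longrightarrow> x i \<in> carrier V) \<Longrightarrow> sum x I \<in> carrier V"
  using subspace_sum[OF subspace_carrier] by blast

lemma alt_forms_linear:
  assumes "\<omega> \<in> alt_forms V k" "Suc (length ps + length qs) = k"
    "set ps \<subseteq> carrier V" "set qs \<subseteq> carrier V" "x \<in> carrier V" "y \<in> carrier V"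
  shows "\<omega> (ps @ (a *\<^sub>R x + b *\<^sub>R y) # qs) = a * \<omega> (ps @ x # qs) + b * \<omega> (ps @ y # qs)"
proof -
  have "\<forall>i<k. \<forall>u\<in>carrier V. \<forall>v\<in>carrier V. \<forall>a b.
       \<omega> ((ps @ x # qs)[i := a *\<^sub>R u + b *\<^sub>R v]) =
         a * \<omega> ((ps @ x # qs)[i := u]) + b * \<omega> ((ps @ x # qs)[i := v])"
    using assms(1,2,3,4,5) unfolding alt_forms_def mem_Collect_eq by force
  from this[rule_format, of "length ps" x y a b] show ?thesis
    using assms by simp
qed

lemma alt_forms_add:
  assumes "\<omega> \<in> alt_forms V k" "Suc (length ps + length qs) = k"
    "set ps \<subseteq> carrier V" "set qs \<subseteq> carrier V" "x \<in> carrier V" "y \<in> carrier V"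
  shows "\<omega> (ps @ (x + y) # qs) = \<omega> (ps @ x # qs) + \<omega> (ps @ y # qs)"
  using alt_forms_linear[OF assms, of 1 1] by simp

lemma alt_forms_zero:
  assumes "\<omega> \<in> alt_forms V k" "Suc (length ps + length qs) = k"
    "set ps \<subseteq> carrier V" "set qs \<subseteq> carrier V"
  shows "\<omega> (ps @ 0 # qs) = 0"
  using alt_forms_linear[OF assms, of 0 0 0 0] by simp

lemma alt_forms_sum:
  assumes "\<omega> \<in> alt_forms V k" "Suc (length ps + length qs) = k"
    "set ps \<subseteq> carrier V" "set qs \<subseteq> carrier V" "\<And>i. i \<in> I \<Longrightarrow> x i \<in> carrier V"
  shows "\<omega> (ps @ (\<Sum>i\<in>I. a i *\<^sub>R x i) # qs) = (\<Sum>i\<in>I. a i * \<omega> (ps @ x i # qs))"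
  using assms(5)
proof (induction I rule: infinite_finite_induct)
  case (insert j I)
  have "\<omega> (ps @ (a j *\<^sub>R x j + 1 *\<^sub>R (\<Sum>i\<in>I. a i *\<^sub>R x i)) # qs) =
    a j * \<omega> (ps @ x j # qs) + 1 * \<omega> (ps @ (\<Sum>i\<in>I. a i *\<^sub>R x i) # qs)"
    by (rule alt_forms_linear[OF assms(1-4)]) (auto intro!: sum_carrier scale_carrier insert.prems)
  with insert show ?case by simp
qed (use alt_forms_zero[OF assms(1-4)] in auto)

lemma alt_forms_eq:
  assumes "\<omega> \<in> alt_forms V k" "xs \<in> lists_in V k" "i < k" "j < k" "i \<noteq> j" "xs ! i = xs ! j"
  shows "\<omega> xs = 0"
  using assms unfolding alt_forms_def lists_in_def by blast

lemma alt_forms_not_distinct: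
  assumes "\<omega> \<in> alt_forms V k" "xs \<in> lists_in V k" "\<not> distinct xs"
  shows "\<omega> xs = 0"
  using assms alt_forms_eq[of \<omega> k xs] by (auto simp: distinct_conv_nth lists_in_def)

lemma alt_forms_swap:
  assumes "\<omega> \<in> alt_forms V k" "Suc (Suc (length ps + length qs)) = k"
    "set ps \<subseteq> carrier V" "set qs \<subseteq> carrier V" "x \<in> carrier V" "y \<in> carrier V"
  shows "\<omega> (ps @ x # y # qs) = - \<omega> (ps @ y # x # qs)"
proof -
  have z: "\<omega> (ps @ u # u # qs) = 0" if "u \<in> carrier V" for u
    by (rule alt_forms_not_distinct[OF assms(1)]) (use assms that in \<open>auto simp: lists_in_def\<close>)
  have l: "\<omega> (ps @ (x + y) # w # qs) = \<omega> (ps @ x # w # qs) + \<omega> (ps @ y # w # qs)"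
    if "w \<in> carrier V" for w
    by (rule alt_forms_add[OF assms(1)]) (use assms that in auto)
  have r: "\<omega> (ps @ w # (x + y) # qs) = \<omega> (ps @ w # x # qs) + \<omega> (ps @ w # y # qs)"
    if "w \<in> carrier V" for w
    using alt_forms_add[OF assms(1), of "ps @ [w]" qs x y] assms that by simp
  show ?thesis
    using z[of "x + y"] l[of "x + y"] r[of x] r[of y] z[of x] z[of y] assms by simp
qed

lemma alt_forms_move:
  assumes "\<omega> \<in> alt_forms V k" "ps @ x # as @ qs \<in> lists_in V k"
  shows "\<omega> (ps @ x # as @ qs) = (-1) ^ length as * \<omega> (ps @ as @ x # qs)"
  using assms(2)
proof (induction as arbitrary: ps)
  case (Cons a as)
  have "\<omega> (ps @ x # a # as @ qs) = - \<omega> (ps @ a # x # as @ qs)"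
    by (rule alt_forms_swap[OF assms(1)]) (use Cons.prems in \<open>auto simp: lists_in_def\<close>)
  with Cons.IH[of "ps @ [a]"] Cons.prems show ?case by (simp add: lists_in_def)
qed simp

text \<open>Moving the entries to their places one by one changes only the sign.\<close>

lemma alt_forms_permute:
  assumes "\<omega> \<in> alt_forms V k" "ps @ xs \<in> lists_in V k" "mset ys = mset xs" "\<omega> (ps @ xs) = 0"
  shows "\<omega> (ps @ ys) = 0"
  using assms(2-)
proof (induction xs arbitrary: ps ys)
  case (Cons x xs)
  have sety: "set ys = set (x # xs)" using Cons.prems(2) by (rule mset_eq_setD)
  then have "x \<in> set ys" by simp
  then obtain as cs where y: "ys = as @ x # cs" by (auto simp: in_set_conv_decomp)
  have "mset (as @ cs) = mset xs" using Cons.prems(2) y by simp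
  moreover have "(ps @ [x]) @ xs \<in> lists_in V k" "\<omega> ((ps @ [x]) @ xs) = 0" using Cons.prems by simp_all
  ultimately have 0: "\<omega> ((ps @ [x]) @ as @ cs) = 0"
    using Cons.IH[of "ps @ [x]" "as @ cs"] by blast
  have "length ys = length (x # xs)" using Cons.prems(2) by (rule mset_eq_length)
  then have "ps @ x # as @ cs \<in> lists_in V k"
    using Cons.prems(1) y sety by (auto simp: lists_in_def)
  from alt_forms_move[OF assms(1) this] 0 y show ?case by simp
qed simp

text \<open>Multilinear expansion: replace the entries by members of a spanning set one at a time,
  the last one first.\<close>

lemma alt_forms_vanish_span:
  assumes \<omega>: "\<omega> \<in> alt_forms V k" and E: "finite E" "E \<subseteq> carrier V" "carrier V \<subseteq> span E"
    and 0: "\<And>xs. length xs = k \<Longrightarrow> set xs \<subseteq> E \<Longrightarrow> distinct xs \<Longrightarrow> \<omega> xs = 0"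
    and xs: "xs \<in> lists_in V k"
  shows "\<omega> xs = 0"
proof -
  have "\<omega> (ps @ qs) = 0" if "ps @ qs \<in> lists_in V k" "set qs \<subseteq> E" for ps qs
    using that
  proof (induction ps arbitrary: qs rule: rev_induct)
    case Nil
    then show ?case using 0[of qs] alt_forms_not_distinct[OF \<omega>, of qs]
      by (cases "distinct qs") (auto simp: lists_in_def)
  next
    case (snoc x ps)
    have "x \<in> span E" using snoc E by (auto simp: lists_in_def)
    then obtain a where a: "x = (\<Sum>v\<in>E. a v *\<^sub>R v)" using span_finite[OF E(1)] by blast
    have "\<omega> (ps @ (\<Sum>v\<in>E. a v *\<^sub>R v) # qs) = (\<Sum>v\<in>E. a v * \<omega> (ps @ v # qs))"
      by (rule alt_forms_sum[OF \<omega>]) (use snoc.prems E in \<open>auto simp: lists_in_def\<close>)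
    also have "\<dots> = 0"
      using snoc.prems E by (intro sum.neutral ballI) (auto simp: lists_in_def intro!: snoc.IH)
    finally show ?case using a by simp
  qed
  from this[of xs "[]"] xs show ?thesis by simp
qed

lemma alt_forms_lincomb:
  assumes "\<omega> \<in> alt_forms V k" "\<omega>' \<in> alt_forms V k"
  shows "(\<lambda>xs. a * \<omega> xs + b * \<omega>' xs) \<in> alt_forms V k"
  using assms unfolding alt_forms_def by (auto simp: algebra_simps)

lemma alt_forms_cmult:
  assumes "\<omega> \<in> alt_forms V k" shows "(\<lambda>xs. a * \<omega> xs) \<in> alt_forms V k"
  using alt_forms_lincomb[OF assms assms, of a 0] by simp

lemma alt_forms_summation:
  assumes "\<And>i. i \<in> I \<Longrightarrow> \<omega> i \<in> alt_forms V k"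
  shows "(\<lambda>xs. \<Sum>i\<in>I. a i * \<omega> i xs) \<in> alt_forms V k"
  using assms
proof (induction I rule: infinite_finite_induct)
  case (insert j I)
  then show ?case using alt_forms_lincomb[of "\<omega> j" k "\<lambda>xs. \<Sum>i\<in>I. a i * \<omega> i xs" "a j" 1] by simp
qed (auto simp: alt_forms_def)

text \<open>The wedge product and the inner product of multivectors freeze some arguments of a form; what is
  left must again be an alternating form, or evaluation yields the default value 0.\<close>

lemma alt_forms_append_left:
  assumes "\<omega> \<in> alt_forms V (k + l)" "xs \<in> lists_in V k"
  shows "(\<lambda>ys. \<omega> (xs @ ys)) \<in> alt_forms V l"
  unfolding alt_forms_def mem_Collect_eq
proof (intro allI impI conjI ballI)
  fix ys i u v a b assume y: "length ys = l \<and> set ys \<subseteq> carrier V" "i < l" "u \<in> carrier V" "v \<in> carrier V"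
  have "\<forall>j<k+l. \<forall>u\<in>carrier V. \<forall>v\<in>carrier V. \<forall>a b.
       \<omega> ((xs @ ys)[j := a *\<^sub>R u + b *\<^sub>R v]) = a * \<omega> ((xs @ ys)[j := u]) + b * \<omega> ((xs @ ys)[j := v])"
    using assms y unfolding alt_forms_def lists_in_def mem_Collect_eq by force
  from this[rule_format, of "k + i" u v a b] show
    "\<omega> (xs @ ys[i := a *\<^sub>R u + b *\<^sub>R v]) = a * \<omega> (xs @ ys[i := u]) + b * \<omega> (xs @ ys[i := v])"
    using assms y by (simp add: lists_in_def list_update_append)
next
  fix ys i j assume y: "length ys = l \<and> set ys \<subseteq> carrier V" "i < l" "j < l" "i \<noteq> j \<and> ys ! i = ys ! j"
  show "\<omega> (xs @ ys) = 0"
    by (rule alt_forms_eq[OF assms(1), of _ "k + i" "k + j"])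
      (use y assms in \<open>auto simp: lists_in_def nth_append\<close>)
qed

lemma alt_forms_append_right:
  assumes "\<omega> \<in> alt_forms V (k + l)" "ys \<in> lists_in V l"
  shows "(\<lambda>xs. \<omega> (xs @ ys)) \<in> alt_forms V k"
  unfolding alt_forms_def mem_Collect_eq
proof (intro allI impI conjI ballI)
  fix xs i u v a b assume y: "length xs = k \<and> set xs \<subseteq> carrier V" "i < k" "u \<in> carrier V" "v \<in> carrier V"
  have "\<forall>j<k+l. \<forall>u\<in>carrier V. \<forall>v\<in>carrier V. \<forall>a b.
       \<omega> ((xs @ ys)[j := a *\<^sub>R u + b *\<^sub>R v]) = a * \<omega> ((xs @ ys)[j := u]) + b * \<omega> ((xs @ ys)[j := v])"
    using assms y unfolding alt_forms_def lists_in_def mem_Collect_eq by force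
  from this[rule_format, of i u v a b] show
    "\<omega> (xs[i := a *\<^sub>R u + b *\<^sub>R v] @ ys) = a * \<omega> (xs[i := u] @ ys) + b * \<omega> (xs[i := v] @ ys)"
    using assms y by (simp add: lists_in_def list_update_append)
next
  fix xs i j assume y: "length xs = k \<and> set xs \<subseteq> carrier V" "i < k" "j < k" "i \<noteq> j \<and> xs ! i = xs ! j"
  show "\<omega> (xs @ ys) = 0"
    by (rule alt_forms_eq[OF assms(1), of _ i j])
      (use y assms in \<open>auto simp: lists_in_def nth_append\<close>)
qed

lemma alt_forms_cong:
  assumes "\<omega> \<in> alt_forms V k" "\<And>xs. xs \<in> lists_in V k \<Longrightarrow> \<omega>' xs = \<omega> xs"
  shows "\<omega>' \<in> alt_forms V k"
  unfolding alt_forms_def mem_Collect_eq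
proof (intro allI impI conjI ballI)
  fix xs i u v a b
  assume y: "length xs = k \<and> set xs \<subseteq> carrier V" "i < k" "u \<in> carrier V" "v \<in> carrier V"
  have "xs[i := w] \<in> lists_in V k" if "w \<in> carrier V" for w
    using that y set_update_subset_insert[of xs i w] by (auto simp: lists_in_def)
  moreover have "\<omega> (xs[i := a *\<^sub>R u + b *\<^sub>R v]) = a * \<omega> (xs[i := u]) + b * \<omega> (xs[i := v])"
    using y assms(1) unfolding alt_forms_def mem_Collect_eq by blast
  ultimately show "\<omega>' (xs[i := a *\<^sub>R u + b *\<^sub>R v]) = a * \<omega>' (xs[i := u]) + b * \<omega>' (xs[i := v])"
    using y by (simp add: assms(2))
next
  fix xs i j
  assume y: "length xs = k \<and> set xs \<subseteq> carrier V" "i < k" "j < k" "i \<noteq> j \<and> xs ! i = xs ! j"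
  then have "\<omega> xs = 0" using assms(1) unfolding alt_forms_def mem_Collect_eq by blast
  then show "\<omega>' xs = 0" using y assms(2)[of xs] by (simp add: lists_in_def)
qed

text \<open>Forms are arbitrary functions off the lists in the carrier.  Multivectors do not see these values, so
  that two forms may be identified once they agree on the carrier.\<close>

lemma ext_power_cong:
  assumes "\<alpha> \<in> ext_power V k" "\<omega> \<in> alt_forms V k" "\<And>xs. xs \<in> lists_in V k \<Longrightarrow> \<omega>' xs = \<omega> xs"
  shows "\<alpha> \<omega>' = \<alpha> \<omega>"
proof -
  have \<omega>': "\<omega>' \<in> alt_forms V k" by (rule alt_forms_cong[OF assms(2,3)])
  show ?thesis using assms(1) unfolding ext_power_def
  proof (induction rule: span_induct)
    case base
    show ?case by (auto simp: subspace_def scaleR_fun_def)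
  next
    case (step x)
    then show ?case using assms(2,3) \<omega>' by (auto simp: wedge_def lists_in_def)
  qed
qed

lemma ext_power_zero:
  assumes "\<alpha> \<in> ext_power V k" "\<omega> \<notin> alt_forms V k"
  shows "\<alpha> \<omega> = 0"
  using assms(1) unfolding ext_power_def
proof (induction rule: span_induct)
  case base
  show ?case by (auto simp: subspace_def scaleR_fun_def)
next
  case (step x)
  then show ?case using assms(2) by (auto simp: wedge_def)
qed

lemma ext_power_linear:
  assumes "\<alpha> \<in> ext_power V k" "\<And>i. i \<in> I \<Longrightarrow> \<omega> i \<in> alt_forms V k"
  shows "\<alpha> (\<lambda>xs. \<Sum>i\<in>I. a i * \<omega> i xs) = (\<Sum>i\<in>I. a i * \<alpha> (\<omega> i))"
  using assms(1) unfolding ext_power_def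
proof (induction rule: span_induct)
  case base
  show ?case
    by (auto simp: subspace_def scaleR_fun_def algebra_simps sum.distrib sum_distrib_left)
next
  case (step x)
  then show ?case using assms(2) alt_forms_summation[of I \<omega> k a] by (auto simp: wedge_def)
qed

lemma ext_power_wedge: "xs \<in> lists_in V k \<Longrightarrow> wedge V xs \<in> ext_power V k"
  unfolding ext_power_def lists_in_def by (auto intro!: span_base)

lemma wedge_lin1:
  assumes "x \<in> carrier V" "y \<in> carrier V"
  shows "wedge V [a *\<^sub>R x + b *\<^sub>R y] = a *\<^sub>R wedge V [x] + b *\<^sub>R wedge V [y]"
proof
  fix \<omega>
  show "wedge V [a *\<^sub>R x + b *\<^sub>R y] \<omega> = (a *\<^sub>R wedge V [x] + b *\<^sub>R wedge V [y]) \<omega>"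
    using alt_forms_linear[of \<omega> 1 "[]" "[]" x y a b] assms
    by (simp add: wedge_def scaleR_fun_def)
qed

lemma ext_power_1: "ext_power V 1 = {wedge V [x] | x. x \<in> carrier V}"
proof -
  let ?S = "{wedge V [x] | x. x \<in> carrier V}"
  have eq: "{wedge V xs | xs. length xs = 1 \<and> set xs \<subseteq> carrier V} = ?S"
  proof (intro equalityI subsetI)
    fix y assume "y \<in> {wedge V xs | xs. length xs = 1 \<and> set xs \<subseteq> carrier V}"
    then obtain xs where "y = wedge V xs" "length xs = 1" "set xs \<subseteq> carrier V" by blast
    then show "y \<in> ?S" by (cases xs) auto
  next
    fix y assume "y \<in> ?S"
    then obtain x where "y = wedge V [x]" "x \<in> carrier V" by blast
    then show "y \<in> {wedge V xs | xs. length xs = 1 \<and> set xs \<subseteq> carrier V}"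
      by (intro CollectI exI[of _ "[x]"]) auto
  qed
  have "subspace ?S"
    unfolding subspace_def
  proof (intro conjI ballI allI)
    have "wedge V [0] = 0" using wedge_lin1[of 0 0 0 0] by simp
    then show "0 \<in> ?S" by (metis (mono_tags, lifting) mem_Collect_eq zero_carrier)
  next
    fix a b assume "a \<in> ?S" "b \<in> ?S"
    then obtain x y where xy: "a = wedge V [x]" "b = wedge V [y]" "x \<in> carrier V" "y \<in> carrier V" by auto
    then show "a + b \<in> ?S" using wedge_lin1[of x y 1 1] by (auto intro!: exI[of _ "x + y"])
  next
    fix r a assume "a \<in> ?S"
    then obtain x where xy: "a = wedge V [x]" "x \<in> carrier V" by auto
    then show "r *\<^sub>R a \<in> ?S" using wedge_lin1[of x x r 0] by (auto intro!: exI[of _ "r *\<^sub>R x"])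
  qed
  then show ?thesis unfolding ext_power_def eq by (simp add: span_eq_iff)
qed

end

lemma alt_forms_comp:
  assumes "carrier_subspace V" "\<omega> \<in> alt_forms W k"
    and "\<And>u v a b. u \<in> carrier V \<Longrightarrow> v \<in> carrier V \<Longrightarrow> A (a *\<^sub>R u + b *\<^sub>R v) = a *\<^sub>R A u + b *\<^sub>R A v"
    and "\<And>u. u \<in> carrier V \<Longrightarrow> A u \<in> carrier W"
  shows "(\<lambda>xs. \<omega> (map A xs)) \<in> alt_forms V k"
  unfolding alt_forms_def mem_Collect_eq
proof (intro allI impI conjI ballI)
  fix xs i u v a b assume y: "length xs = k \<and> set xs \<subseteq> carrier V" "i < k" "u \<in> carrier V" "v \<in> carrier V"
  have "\<forall>j<k. \<forall>u\<in>carrier W. \<forall>v\<in>carrier W. \<forall>a b.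
       \<omega> ((map A xs)[j := a *\<^sub>R u + b *\<^sub>R v]) = a * \<omega> ((map A xs)[j := u]) + b * \<omega> ((map A xs)[j := v])"
  proof -
    have "length (map A xs) = k \<and> set (map A xs) \<subseteq> carrier W" using y assms(4) by auto
    then show ?thesis using assms(2) unfolding alt_forms_def mem_Collect_eq by blast
  qed
  from this[rule_format, of i "A u" "A v" a b] show
    "\<omega> (map A (xs[i := a *\<^sub>R u + b *\<^sub>R v])) = a * \<omega> (map A (xs[i := u])) + b * \<omega> (map A (xs[i := v]))"
    using assms(3)[of u v a b] assms(4) y by (simp add: map_update)
next
  fix xs i j assume y: "length xs = k \<and> set xs \<subseteq> carrier V" "i < k" "j < k" "i \<noteq> j \<and> xs ! i = xs ! j"
  then have "length (map A xs) = k \<and> set (map A xs) \<subseteq> carrier W" "map A xs ! i = map A xs ! j"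
    using assms(4) by auto
  then show "\<omega> (map A xs) = 0" using assms(2) y unfolding alt_forms_def mem_Collect_eq by blast
qed

section \<open>Gram determinants, Hodge duals and the cofactor\<close>

lemma sum_fun_apply: "(\<Sum>i\<in>I. f i) x = (\<Sum>i\<in>I. f i x)"
  for f :: "'i \<Rightarrow> 'a \<Rightarrow> 'b::comm_monoid_add"
  by (induction I rule: infinite_finite_induct) auto

definition gram :: "('v::real_vector) oriented_ip_space \<Rightarrow> nat \<Rightarrow> 'v list \<Rightarrow> 'v list \<Rightarrow> real"
  where "gram V k xs ys =
    (\<Sum>\<pi> | \<pi> permutes {..<k}. of_int (sign \<pi>) * (\<Prod>i<k. ip V (xs ! i) (ys ! \<pi> i)))"

locale inner_product_carrier = carrier_subspace +
  assumes inner_product: "inner_product_on (carrier V) (ip V)"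
begin

lemma ip_sym: "u \<in> carrier V \<Longrightarrow> v \<in> carrier V \<Longrightarrow> ip V u v = ip V v u"
  and ip_lin: "u \<in> carrier V \<Longrightarrow> v \<in> carrier V \<Longrightarrow> w \<in> carrier V \<Longrightarrow>
    ip V (a *\<^sub>R u + b *\<^sub>R v) w = a * ip V u w + b * ip V v w"
  and ip_pos: "u \<in> carrier V \<Longrightarrow> u \<noteq> 0 \<Longrightarrow> ip V u u > 0"
  using inner_product by (auto simp: inner_product_on_def)

lemma ip_sum_left:
  assumes "w \<in> carrier V" "\<And>i. i \<in> I \<Longrightarrow> x i \<in> carrier V"
  shows "ip V (\<Sum>i\<in>I. a i *\<^sub>R x i) w = (\<Sum>i\<in>I. a i * ip V (x i) w)"
  using assms(2)
proof (induction I rule: infinite_finite_induct)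
  case (insert j I)
  have "ip V (a j *\<^sub>R x j + 1 *\<^sub>R (\<Sum>i\<in>I. a i *\<^sub>R x i)) w =
     a j * ip V (x j) w + 1 * ip V (\<Sum>i\<in>I. a i *\<^sub>R x i) w"
    by (rule ip_lin) (auto intro!: sum_carrier scale_carrier insert.prems assms(1))
  with insert show ?case by simp
qed (use ip_lin[of w w w 0 0] assms in auto)

lemma ip_sum_right:
  assumes "w \<in> carrier V" "\<And>i. i \<in> I \<Longrightarrow> x i \<in> carrier V"
  shows "ip V w (\<Sum>i\<in>I. a i *\<^sub>R x i) = (\<Sum>i\<in>I. a i * ip V w (x i))"
proof -
  have "(\<Sum>i\<in>I. a i *\<^sub>R x i) \<in> carrier V" by (auto intro!: sum_carrier scale_carrier assms(2))
  then have "ip V w (\<Sum>i\<in>I. a i *\<^sub>R x i) = ip V (\<Sum>i\<in>I. a i *\<^sub>R x i) w"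
    using assms(1) by (rule ip_sym[rotated])
  also have "\<dots> = (\<Sum>i\<in>I. a i * ip V (x i) w)" using assms by (rule ip_sum_left)
  also have "\<dots> = (\<Sum>i\<in>I. a i * ip V w (x i))"
    by (intro sum.cong refl arg_cong2[of _ _ _ _ "(*)"] ip_sym assms)
  finally show ?thesis .
qed

lemma ip_ext:
  assumes "u \<in> carrier V" "v \<in> carrier V" "\<And>z. z \<in> carrier V \<Longrightarrow> ip V u z = ip V v z"
  shows "u = v"
proof (rule ccontr)
  assume "u \<noteq> v"
  have m: "u - v \<in> carrier V" using assms subspace_carrier by (simp add: subspace_diff)
  have "ip V (u - v) (u - v) > 0" using \<open>u \<noteq> v\<close> by (intro ip_pos m) simp
  moreover have "ip V (u - v) (u - v) = 0"
    using ip_lin[of u v "u - v" 1 "-1"] m assms by simp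
  ultimately show False by simp
qed

lemma gram_sym:
  assumes "xs \<in> lists_in V k" "ys \<in> lists_in V k"
  shows "gram V k xs ys = gram V k ys xs"
proof -
  have "gram V k xs ys = (\<Sum>\<pi> | \<pi> permutes {..<k}. of_int (sign (inv \<pi>)) * (\<Prod>i<k. ip V (xs ! i) (ys ! inv \<pi> i)))"
    unfolding gram_def by (rule sum_permutations_inverse)
  also have "\<dots> = gram V k ys xs" unfolding gram_def
  proof (rule sum.cong, simp, clarify)
    fix \<pi> :: "nat \<Rightarrow> nat" assume p: "\<pi> permutes {..<k}"
    have "(\<Prod>i<k. ip V (xs ! i) (ys ! inv \<pi> i)) = (\<Prod>i<k. ip V (xs ! \<pi> i) (ys ! inv \<pi> (\<pi> i)))"
      by (rule prod.reindex_bij_betw[OF permutes_imp_bij[OF p], symmetric])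
    also have "\<dots> = (\<Prod>i<k. ip V (ys ! i) (xs ! \<pi> i))"
    proof (rule prod.cong)
      fix i assume i: "i \<in> {..<k}"
      then have "\<pi> i < k" using permutes_in_image[OF p] by auto
      then have "xs ! \<pi> i \<in> carrier V" "ys ! i \<in> carrier V" using assms i by (auto simp: lists_in_def)
      then show "ip V (xs ! \<pi> i) (ys ! inv \<pi> (\<pi> i)) = ip V (ys ! i) (xs ! \<pi> i)"
        by (simp add: permutes_inverses(2)[OF p] ip_sym)
    qed simp
    finally show "of_int (sign (inv \<pi>)) * (\<Prod>i<k. ip V (xs ! i) (ys ! inv \<pi> i)) =
        of_int (sign \<pi>) * (\<Prod>i<k. ip V (ys ! i) (xs ! \<pi> i))"
      by (simp add: sign_inverse permutes_imp_permutation[OF _ p])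
  qed
  finally show ?thesis .
qed

text \<open>Composition of the permutations with the transposition of two equal arguments negates the Leibniz
  sum.\<close>

lemma gram_alt_left:
  assumes "ys \<in> lists_in V k"
  shows "(\<lambda>xs. gram V k xs ys) \<in> alt_forms V k"
  unfolding alt_forms_def mem_Collect_eq
proof (intro allI impI conjI ballI)
  fix xs m u v a b assume y: "length xs = k \<and> set xs \<subseteq> carrier V" "m < k" "u \<in> carrier V" "v \<in> carrier V"
  have upd: "(\<Prod>i<k. ip V (xs[m := w] ! i) (ys ! \<pi> i)) =
    ip V w (ys ! \<pi> m) * (\<Prod>i\<in>{..<k}-{m}. ip V (xs ! i) (ys ! \<pi> i))" for w and \<pi> :: "nat \<Rightarrow> nat"
    using y by (subst prod.remove[of _ m]) (auto intro!: prod.cong)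
  have c: "ys ! \<pi> m \<in> carrier V" if "\<pi> permutes {..<k}" for \<pi>
    using assms y permutes_in_image[OF that, of m] by (auto simp: lists_in_def)
  show "gram V k (xs[m := a *\<^sub>R u + b *\<^sub>R v]) ys = a * gram V k (xs[m := u]) ys + b * gram V k (xs[m := v]) ys"
    unfolding gram_def upd sum_distrib_left sum.distrib[symmetric]
    using y c by (intro sum.cong refl) (simp add: ip_lin algebra_simps)
next
  fix xs i j assume y: "length xs = k \<and> set xs \<subseteq> carrier V" "i < k" "j < k" "i \<noteq> j \<and> xs ! i = xs ! j"
  let ?t = "Transposition.transpose i j"
  have t: "?t permutes {..<k}" using y by (simp add: permutes_swap_id)
  have "gram V k xs ys = (\<Sum>\<pi> | \<pi> permutes {..<k}. of_int (sign (\<pi> \<circ> ?t)) * (\<Prod>i<k. ip V (xs ! i) (ys ! (\<pi> \<circ> ?t) i)))"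
    unfolding gram_def by (rule sum_permutations_compose_right[OF t])
  also have "\<dots> = (\<Sum>\<pi> | \<pi> permutes {..<k}. - (of_int (sign \<pi>) * (\<Prod>i<k. ip V (xs ! i) (ys ! \<pi> i))))"
  proof (rule sum.cong, simp, clarify)
    fix \<pi> :: "nat \<Rightarrow> nat" assume p: "\<pi> permutes {..<k}"
    have "(\<Prod>l<k. ip V (xs ! l) (ys ! \<pi> l)) = (\<Prod>l<k. ip V (xs ! ?t l) (ys ! \<pi> (?t l)))"
      by (rule prod.reindex_bij_betw[OF permutes_imp_bij[OF t], symmetric])
    also have "\<dots> = (\<Prod>l<k. ip V (xs ! l) (ys ! (\<pi> \<circ> ?t) l))"
      using y by (intro prod.cong) (auto simp: Transposition.transpose_def)
    finally show "of_int (sign (\<pi> \<circ> ?t)) * (\<Prod>i<k. ip V (xs ! i) (ys ! (\<pi> \<circ> ?t) i)) =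
        - (of_int (sign \<pi>) * (\<Prod>i<k. ip V (xs ! i) (ys ! \<pi> i)))"
      using y permutes_imp_permutation[OF _ p] by (simp add: sign_compose permutation_swap_id sign_swap_id)
  qed
  also have "\<dots> = - gram V k xs ys" by (simp add: gram_def sum_negf)
  finally show "gram V k xs ys = 0" by simp
qed

lemma gram_alt_right: "xs \<in> lists_in V k \<Longrightarrow> (\<lambda>ys. gram V k xs ys) \<in> alt_forms V k"
  by (rule alt_forms_cong[OF gram_alt_left]) (auto simp: gram_sym)

lemma gram_zero:
  assumes "m < k" "\<And>l. l < k \<Longrightarrow> ip V (xs ! l) (ys ! m) = 0"
  shows "gram V k xs ys = 0"
  unfolding gram_def
proof (intro sum.neutral ballI, clarify)
  fix \<pi> :: "nat \<Rightarrow> nat" assume p: "\<pi> permutes {..<k}"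
  then have "inv \<pi> m < k" using assms(1) permutes_in_image[OF permutes_inv[OF p], of m] by auto
  moreover have "\<pi> (inv \<pi> m) = m" using p by (simp add: permutes_inverses)
  ultimately have "(\<Prod>i<k. ip V (xs ! i) (ys ! \<pi> i)) = 0"
    using assms(2) by (intro prod_zero) (auto intro!: bexI[of _ "inv \<pi> m"])
  then show "of_int (sign \<pi>) * (\<Prod>i<k. ip V (xs ! i) (ys ! \<pi> i)) = 0" by simp
qed

lemma gram_orthonormal:
  assumes "\<And>i j. i < k \<Longrightarrow> j < k \<Longrightarrow> ip V (xs ! i) (xs ! j) = (if i = j then 1 else 0)"
  shows "gram V k xs xs = 1"
proof -
  have "gram V k xs xs = (\<Sum>\<pi> | \<pi> permutes {..<k}. if \<pi> = id then 1 else 0)"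
    unfolding gram_def
  proof (rule sum.cong, simp, clarify)
    fix \<pi> :: "nat \<Rightarrow> nat" assume p: "\<pi> permutes {..<k}"
    show "of_int (sign \<pi>) * (\<Prod>i<k. ip V (xs ! i) (xs ! \<pi> i)) = (if \<pi> = id then 1 else 0)"
    proof (cases "\<pi> = id")
      case False
      then obtain i where i: "\<pi> i \<noteq> i" by (auto simp: fun_eq_iff)
      then have "i < k" using p by (auto simp: permutes_def)
      moreover have "\<pi> i < k" using permutes_in_image[OF p, of i] \<open>i < k\<close> by auto
      ultimately have "(\<Prod>i<k. ip V (xs ! i) (xs ! \<pi> i)) = 0"
        using i assms[of i "\<pi> i"] by (intro prod_zero) (auto intro!: bexI[of _ i])
      then show ?thesis using False by simp
    qed (use assms in simp)
  qed
  also have "\<dots> = 1" by (simp add: finite_permutations permutes_id)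
  finally show ?thesis .
qed

lemma ext_power_sum:
  assumes "\<And>i. i \<in> I \<Longrightarrow> xs i \<in> lists_in V k"
  shows "(\<Sum>i\<in>I. c i *\<^sub>R wedge V (xs i)) \<in> ext_power V k"
  unfolding ext_power_def using ext_power_wedge[OF assms] unfolding ext_power_def
  by (intro span_sum span_scale) blast

lemma wedge_prod_linear:
  "wedge_prod V k l 0 \<gamma> = 0"
  "wedge_prod V k l (\<alpha> + \<alpha>') \<gamma> = wedge_prod V k l \<alpha> \<gamma> + wedge_prod V k l \<alpha>' \<gamma>"
  "wedge_prod V k l (a *\<^sub>R \<alpha>) \<gamma> = a *\<^sub>R wedge_prod V k l \<alpha> \<gamma>"
  by (auto simp: wedge_prod_def scaleR_fun_def fun_eq_iff)

lemma ext_ip_linear: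
  "ext_ip V k 0 \<gamma> = 0" "ext_ip V k (\<alpha> + \<alpha>') \<gamma> = ext_ip V k \<alpha> \<gamma> + ext_ip V k \<alpha>' \<gamma>"
  "ext_ip V k (a *\<^sub>R \<alpha>) \<gamma> = a * ext_ip V k \<alpha> \<gamma>"
  by (auto simp: ext_ip_def scaleR_fun_def)

text \<open>By induction over the span, it suffices to consider decomposable multivectors.\<close>

lemma wedge_apply_alt:
  assumes "\<gamma> \<in> ext_power V l" "\<And>xs. xs \<in> lists_in V k \<Longrightarrow> f xs \<in> alt_forms V l"
    "\<And>ys. ys \<in> lists_in V l \<Longrightarrow> (\<lambda>xs. f xs ys) \<in> alt_forms V k"
  shows "(\<lambda>xs. \<gamma> (f xs)) \<in> alt_forms V k"
  using assms(1) unfolding ext_power_def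
proof (induction rule: span_induct)
  case base
  show ?case unfolding mem_Collect_eq subspace_def
    using alt_forms_lincomb[where a=1 and b=1] alt_forms_cmult
    by (auto simp: scaleR_fun_def) (auto simp: alt_forms_def)
next
  case (step x)
  then obtain ys where ys: "x = wedge V ys" "ys \<in> lists_in V l" by (auto simp: lists_in_def)
  show ?case unfolding ys(1)
    by (rule alt_forms_cong[OF assms(3)[OF ys(2)]])
      (use assms(2) ys(2) in \<open>auto simp: wedge_def lists_in_def\<close>)
qed

lemma wedge_prod_wedge:
  assumes "xs \<in> lists_in V k" "\<gamma> \<in> ext_power V l"
  shows "wedge_prod V k l (wedge V xs) \<gamma> \<Omega> =
    (if \<Omega> \<in> alt_forms V (k + l) then \<gamma> (\<lambda>ys. \<Omega> (xs @ ys)) else 0)"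
proof -
  have "(\<lambda>xs. \<gamma> (\<lambda>ys. \<Omega> (xs @ ys))) \<in> alt_forms V k" if "\<Omega> \<in> alt_forms V (k + l)"
    using wedge_apply_alt[OF assms(2), of k "\<lambda>xs ys. \<Omega> (xs @ ys)"]
      alt_forms_append_left[OF that] alt_forms_append_right[OF that] by blast
  then show ?thesis using assms(1) by (simp add: wedge_prod_def wedge_def lists_in_def)
qed

lemma ext_ip_wedge:
  assumes "xs \<in> lists_in V k" "\<beta> \<in> ext_power V k"
  shows "ext_ip V k (wedge V xs) \<beta> = \<beta> (gram V k xs)"
proof -
  have "(\<lambda>xs. \<beta> (gram V k xs)) \<in> alt_forms V k"
    using wedge_apply_alt[OF assms(2), of k "gram V k"] gram_alt_left gram_alt_right by blast
  then show ?thesis using assms(1) by (simp add: ext_ip_def wedge_def lists_in_def flip: gram_def)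
qed

end

text \<open>
  The normalized volume form is a parameter.  Its value 1 on all positive orthonormal bases is what the
  Hodge dual needs in order not to depend on the basis; on a tangent space it will be the determinant of the coordinates
  times \<open>sqrt (det G)\<close>, so that matrix determinants replace determinants indexed by lists.
\<close>

locale oriented_space = inner_product_carrier V
  for V :: "('v::real_vector) oriented_ip_space" +
  fixes vol :: "'v list \<Rightarrow> real"
  assumes dim_pos: "0 < vdim V"
    and vol_alt: "vol \<in> alt_forms V (vdim V)"
    and vol_basis: "orthonormal_basis V e \<Longrightarrow> pos_oriented V e \<Longrightarrow> vol e = 1"
    and ex_basis: "\<exists>e. orthonormal_basis V e \<and> pos_oriented V e"
begin

abbreviation (input) d where "d \<equiv> vdim V"

definition omit :: "nat \<Rightarrow> 'v list \<Rightarrow> 'v list"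
  where "omit i e = take i e @ drop (Suc i) e"

context
  fixes e assumes e: "orthonormal_basis V e"
begin

lemma basis_in [simp]: "i < d \<Longrightarrow> e ! i \<in> carrier V" and length_basis [simp]: "length e = d"
  and set_basis: "set e \<subseteq> carrier V" and basis_list: "e \<in> lists_in V d"
  using e by (auto simp: orthonormal_basis_def lists_in_def)

lemma basis_ip: "i < d \<Longrightarrow> j < d \<Longrightarrow> ip V (e ! i) (e ! j) = (if i = j then 1 else 0)"
  using e by (auto simp: orthonormal_basis_def)

lemma distinct_basis: "distinct e"
proof -
  have "e ! i \<noteq> e ! j" if "i < d" "j < d" "i \<noteq> j" for i j
    using basis_ip[of i i] basis_ip[of i j] that by auto
  then show ?thesis by (auto simp: distinct_conv_nth)
qed

text \<open>An orthonormal list is independent, and its length is the dimension; a vector outside its span would make a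
  larger independent set.\<close>

lemma basis_spans: "carrier V \<subseteq> span (set e)"
proof (rule ccontr)
  assume "\<not> carrier V \<subseteq> span (set e)"
  then obtain x where x: "x \<in> carrier V" "x \<notin> span (set e)" by blast
  have "independent (set e)"
  proof (rule independent_if_scalars_zero)
    fix f v assume s: "(\<Sum>x\<in>set e. f x *\<^sub>R x) = 0" and v: "v \<in> set e"
    then obtain i where i: "i < d" "v = e ! i" by (auto simp: in_set_conv_nth)
    have "0 = ip V (\<Sum>x\<in>set e. f x *\<^sub>R x) v"
      unfolding s using ip_lin[of v v v 0 0] v set_basis by auto
    also have "\<dots> = (\<Sum>x\<in>set e. f x * ip V x v)" using v set_basis by (intro ip_sum_left) auto
    also have "\<dots> = (\<Sum>x\<in>set e. if x = v then f x else 0)"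
    proof (rule sum.cong)
      fix x assume "x \<in> set e"
      then obtain j where j: "j < d" "x = e ! j" by (auto simp: in_set_conv_nth)
      then show "f x * ip V x v = (if x = v then f x else 0)"
        using i basis_ip[of j i] distinct_basis by (auto simp: nth_eq_iff_index_eq)
    qed simp
    also have "\<dots> = f v" using v by simp
    finally show "f v = 0" by simp
  qed simp
  then have ind: "independent (insert x (set e))" using x by (simp add: independent_insertI)
  obtain B where B: "B \<subseteq> carrier V" "independent B" "carrier V \<subseteq> span B" "card B = d"
    using basis_exists[of "carrier V"] unfolding vdim_def by blast
  have "finite B" using B(4) dim_pos by (simp add: card_ge_0_finite)
  from independent_span_bound[OF this ind] B(3) x set_basis
  have "card (insert x (set e)) \<le> card B" by auto
  moreover have "x \<notin> set e" using x(2) span_base by blast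
  ultimately show False using B(4) distinct_card[OF distinct_basis] by simp
qed

lemma basis_expand:
  assumes x: "x \<in> carrier V"
  shows "x = (\<Sum>i<d. ip V x (e ! i) *\<^sub>R e ! i)"
proof -
  have "x \<in> span (set e)" using basis_spans x by blast
  then obtain a where a: "x = (\<Sum>v\<in>set e. a v *\<^sub>R v)" using span_finite[of "set e"] by auto
  also have "\<dots> = (\<Sum>i<d. a (e ! i) *\<^sub>R e ! i)"
    using sum.reindex_bij_betw[OF bij_betw_nth[OF distinct_basis refl refl], of "\<lambda>v. a v *\<^sub>R v"]
    by simp
  finally have xa: "x = (\<Sum>i<d. a (e ! i) *\<^sub>R e ! i)" .
  have "ip V x (e ! j) = a (e ! j)" if "j < d" for j
  proof -
    have "ip V x (e ! j) = (\<Sum>i<d. a (e ! i) * ip V (e ! i) (e ! j))"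
      unfolding xa using that by (subst ip_sum_left) auto
    also have "\<dots> = (\<Sum>i<d. if i = j then a (e ! i) else 0)"
      using that by (intro sum.cong) (auto simp: basis_ip)
    finally show ?thesis using that by simp
  qed
  with xa show ?thesis by simp
qed

lemma basis_parseval:
  assumes "x \<in> carrier V" "y \<in> carrier V"
  shows "ip V x y = (\<Sum>i<d. ip V x (e ! i) * ip V y (e ! i))"
proof -
  have "ip V x y = ip V x (\<Sum>i<d. ip V y (e ! i) *\<^sub>R e ! i)" using basis_expand[OF assms(2)] by simp
  also have "\<dots> = (\<Sum>i<d. ip V y (e ! i) * ip V x (e ! i))" using assms by (intro ip_sum_right) auto
  finally show ?thesis by (simp add: mult.commute)
qed

lemma omit_list: "i < d \<Longrightarrow> omit i e \<in> lists_in V (d - 1)"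
  using set_basis by (auto simp: omit_def lists_in_def dest: in_set_takeD in_set_dropD)

lemma omit_nth: "l < d - 1 \<Longrightarrow> i < d \<Longrightarrow> omit i e ! l = e ! (if l < i then l else Suc l)"
  by (auto simp: omit_def nth_append min_def)

lemma omit_split: "i < d \<Longrightarrow> e = take i e @ e ! i # drop (Suc i) e"
  by (simp add: id_take_nth_drop)

lemma set_omit: "i < d \<Longrightarrow> set (omit i e) = set e - {e ! i}" and distinct_omit: "i < d \<Longrightarrow> distinct (omit i e)"
proof -
  assume i: "i < d"
  have "distinct (take i e @ e ! i # drop (Suc i) e)" using omit_split[OF i] distinct_basis by metis
  moreover have "set e = set (take i e @ e ! i # drop (Suc i) e)" using omit_split[OF i] by metis
  ultimately show "set (omit i e) = set e - {e ! i}" "distinct (omit i e)"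
    by (auto simp: omit_def)
qed

lemma top_form_unique:
  assumes "\<Omega> \<in> alt_forms V d" "\<Omega> e = 0" "xs \<in> lists_in V d"
  shows "\<Omega> xs = 0"
proof (rule alt_forms_vanish_span[OF assms(1) finite_set set_basis basis_spans _ assms(3)])
  fix xs assume xs: "length xs = d" "set xs \<subseteq> set e" "distinct xs"
  then have "set xs = set e"
    using distinct_card[OF xs(3)] distinct_card[OF distinct_basis] by (intro card_subset_eq) auto
  then have "mset xs = mset e" using xs distinct_basis by (simp add: set_eq_iff_mset_eq_distinct)
  then show "\<Omega> xs = 0" using alt_forms_permute[OF assms(1), of "[]" e xs] basis_list assms(2) by simp
qed

text \<open>A list of \<open>d - 1\<close> distinct basis vectors is, up to order, the basis with one vector omitted.  This
  lemma turns identities between forms of degree \<open>d - 1\<close> into evaluations at \<open>d\<close> lists.\<close>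

lemma cotop_form_unique:
  assumes "\<omega> \<in> alt_forms V (d - 1)" "\<And>i. i < d \<Longrightarrow> \<omega> (omit i e) = 0" "xs \<in> lists_in V (d - 1)"
  shows "\<omega> xs = 0"
proof (rule alt_forms_vanish_span[OF assms(1) finite_set set_basis basis_spans _ assms(3)])
  fix xs assume xs: "length xs = d - 1" "set xs \<subseteq> set e" "distinct xs"
  have "card (set e - set xs) = 1"
    using distinct_card[OF xs(3)] distinct_card[OF distinct_basis] xs dim_pos by (subst card_Diff_subset) auto
  then obtain x where x: "set e - set xs = {x}" by (auto simp: card_1_singleton_iff)
  then obtain i where i: "i < d" "x = e ! i" by (metis DiffE in_set_conv_nth insertI1 length_basis)
  have "set xs = set (omit i e)" using set_omit[OF i(1)] x i xs(2) by auto
  then have "mset xs = mset (omit i e)" using xs distinct_omit[OF i(1)] by (simp add: set_eq_iff_mset_eq_distinct)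
  then show "\<omega> xs = 0"
    using alt_forms_permute[OF assms(1), of "[]" "omit i e" xs] omit_list[OF i(1)] assms(2)[OF i(1)] by simp
qed

lemma insert_omit:
  assumes "\<Omega> \<in> alt_forms V d" "i < d" "j < d"
  shows "\<Omega> (e ! i # omit j e) = (if i = j then (-1) ^ j * \<Omega> e else 0)"
proof (cases "i = j")
  case True
  have "\<Omega> ([] @ e ! j # take j e @ drop (Suc j) e) = (-1) ^ length (take j e) * \<Omega> ([] @ take j e @ e ! j # drop (Suc j) e)"
    by (rule alt_forms_move[OF assms(1)])
      (use omit_list[OF assms(3)] assms dim_pos in \<open>auto simp: lists_in_def omit_def dest: in_set_takeD\<close>)
  moreover have "length (take j e) = j" using assms by simp
  ultimately show ?thesis using True omit_split[OF assms(3)] by (simp add: omit_def)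
next
  case False
  have "\<Omega> (e ! i # omit j e) = 0"
    by (rule alt_forms_not_distinct[OF assms(1)])
      (use omit_list[OF assms(3)] assms dim_pos False distinct_basis in
        \<open>auto simp: lists_in_def set_omit nth_eq_iff_index_eq\<close>)
  with False show ?thesis by simp
qed

lemma append_omit:
  assumes "\<Omega> \<in> alt_forms V d" "i < d" "j < d"
  shows "\<Omega> (omit j e @ [e ! i]) = (if i = j then (-1) ^ (d - Suc j) * \<Omega> e else 0)"
proof (cases "i = j")
  case True
  have "\<Omega> (take j e @ e ! j # drop (Suc j) e @ []) = (-1) ^ length (drop (Suc j) e) * \<Omega> (take j e @ drop (Suc j) e @ e ! j # [])"
    by (rule alt_forms_move[OF assms(1)])
      (use basis_list omit_split[OF assms(3)] in simp)
  moreover have "length (drop (Suc j) e) = d - Suc j" using assms by simp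
  ultimately have "\<Omega> e = (-1) ^ (d - Suc j) * \<Omega> (omit j e @ [e ! j])"
    using omit_split[OF assms(3)] by (simp add: omit_def)
  then show ?thesis using True by simp
next
  case False
  have "\<Omega> (omit j e @ [e ! i]) = 0"
    by (rule alt_forms_not_distinct[OF assms(1)])
      (use omit_list[OF assms(3)] assms dim_pos False distinct_basis in
        \<open>auto simp: lists_in_def set_omit nth_eq_iff_index_eq\<close>)
  with False show ?thesis by simp
qed

text \<open>The Laplace expansion along a unit column, obtained by comparing both sides on the lists
  \<open>omit j e\<close>.\<close>

lemma gram_omit:
  assumes "i < d" "zs \<in> lists_in V (d - 1)" "pos_oriented V e"
  shows "gram V (d - 1) (omit i e) zs = (-1) ^ i * vol (e ! i # zs)"
proof -
  let ?f = "\<lambda>zs. 1 * gram V (d - 1) (omit i e) zs + (- ((-1) ^ i)) * vol (e ! i # zs)"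
  have v: "(\<lambda>zs. vol ([e ! i] @ zs)) \<in> alt_forms V (d - 1)"
    using vol_alt dim_pos assms by (intro alt_forms_append_left[of _ 1]) (auto simp: lists_in_def)
  have "?f \<in> alt_forms V (d - 1)"
    using alt_forms_lincomb[OF gram_alt_right[OF omit_list[OF assms(1)]] v, of 1 "- ((-1) ^ i)"] by simp
  then have "?f zs = 0"
  proof (rule cotop_form_unique[OF _ _ assms(2)])
    fix j assume j: "j < d"
    have "gram V (d - 1) (omit i e) (omit j e) = (if i = j then 1 else 0)"
    proof (cases "i = j")
      case True
      then show ?thesis using assms(1) by (auto intro!: gram_orthonormal simp: omit_nth basis_ip)
    next
      case False
      define m where "m = (if i < j then i else i - 1)"
      have m: "m < d - 1" "omit j e ! m = e ! i" using False j assms(1) by (auto simp: m_def omit_nth)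
      have "gram V (d - 1) (omit i e) (omit j e) = 0"
        by (rule gram_zero[OF m(1)]) (use m assms(1) in \<open>auto simp: omit_nth basis_ip\<close>)
      then show ?thesis using False by simp
    qed
    moreover have "vol (e ! i # omit j e) = (if i = j then (-1) ^ j else 0)"
      using insert_omit[OF vol_alt assms(1) j] vol_basis[OF e assms(3)] by auto
    ultimately show "?f (omit j e) = 0" by (simp flip: power_add)
  qed
  then show ?thesis by simp
qed

end

lemma top_form_vol:
  assumes "\<Omega> \<in> alt_forms V d" "orthonormal_basis V e" "pos_oriented V e" "xs \<in> lists_in V d"
  shows "\<Omega> xs = \<Omega> e * vol xs"
  using top_form_unique[OF assms(2) alt_forms_lincomb[OF assms(1) vol_alt, of 1 "- \<Omega> e"] _ assms(4)]
    vol_basis[OF assms(2,3)] by simp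

lemma top_form_basis:
  assumes "\<Omega> \<in> alt_forms V d" "orthonormal_basis V e" "pos_oriented V e"
     "orthonormal_basis V e'" "pos_oriented V e'"
  shows "\<Omega> e' = \<Omega> e"
  using top_form_vol[OF assms(1,2,3) basis_list[OF assms(4)]] vol_basis[OF assms(4,5)] by simp

text \<open>Uniqueness of the dual: every form of degree \<open>d - 1\<close> is a combination of the contractions of the
  volume form with basis vectors, and on these the defining equation prescribes the value of the dual.\<close>

lemma hodge_1:
  assumes e: "orthonormal_basis V e" "pos_oriented V e" and v: "v \<in> carrier V"
  shows "hodge V 1 (wedge V [v]) = (\<Sum>j<d. ((-1) ^ j * ip V v (e ! j)) *\<^sub>R wedge V (omit j e))"
    (is "_ = ?star")
proof -
  have star: "?star \<omega> = (\<Sum>j<d. ((-1) ^ j * ip V v (e ! j)) * \<omega> (omit j e))"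
    if "\<omega> \<in> alt_forms V (d - 1)" for \<omega>
    using that omit_list[OF e(1)]
    by (simp add: sum_fun_apply scaleR_fun_def wedge_def lists_in_def) 
  have star_in: "?star \<in> ext_power V (d - 1)"
    by (rule ext_power_sum) (use omit_list[OF e(1)] in auto)
  have d1: "1 + (d - 1) = d" using dim_pos by simp
  have v1: "wedge V [v] \<in> ext_power V 1" using v by (intro ext_power_wedge) (auto simp: lists_in_def)
  have ip1: "ext_ip V 1 (wedge V [x]) (wedge V [v]) = ip V x v" if "x \<in> carrier V" for x
  proof -
    have x: "[x] \<in> lists_in V 1" using that by (simp add: lists_in_def)
    have "ext_ip V 1 (wedge V [x]) (wedge V [v]) = gram V 1 [x] [v]"
      using gram_alt_right[OF x] by (subst ext_ip_wedge[OF x v1]) (simp add: wedge_def)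
    also have "{\<pi>. \<pi> permutes {..<Suc 0}} = {id}" by (auto simp: permutes_sing lessThan_Suc)
    then have "gram V 1 [x] [v] = ip V x v" by (simp add: gram_def)
    finally show ?thesis .
  qed
  show ?thesis
    unfolding hodge_def
  proof (rule the_equality, intro conjI ballI allI impI)
    show "?star \<in> ext_power V (d - 1)" by (rule star_in)
  next
    fix \<alpha> e' assume a: "\<alpha> \<in> ext_power V 1" and e': "orthonormal_basis V e' \<and> pos_oriented V e'"
    then obtain x where x: "\<alpha> = wedge V [x]" "x \<in> carrier V" unfolding ext_power_1 by auto
    have xl: "[x] \<in> lists_in V 1" using x by (simp add: lists_in_def)
    show "wedge_prod V 1 (d - 1) \<alpha> ?star = ext_ip V 1 \<alpha> (wedge V [v]) *\<^sub>R wedge V e'"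
    proof
      fix \<Omega>
      show "wedge_prod V 1 (d - 1) \<alpha> ?star \<Omega> = (ext_ip V 1 \<alpha> (wedge V [v]) *\<^sub>R wedge V e') \<Omega>"
      proof (cases "\<Omega> \<in> alt_forms V d")
        case True
        have "wedge_prod V 1 (d - 1) \<alpha> ?star \<Omega> = ?star (\<lambda>ys. \<Omega> (x # ys))"
          unfolding x(1) wedge_prod_wedge[OF xl star_in] d1 using True by simp
        also have "\<dots> = (\<Sum>j<d. ((-1) ^ j * ip V v (e ! j)) * \<Omega> (x # omit j e))"
          using alt_forms_append_left[of \<Omega> 1 "d - 1" "[x]"] True xl d1 by (subst star) auto
        also have "\<dots> = (\<Sum>j<d. ip V v (e ! j) * ip V x (e ! j) * \<Omega> e)"
        proof (rule sum.cong)
          fix j assume j: "j \<in> {..<d}"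
          have "\<Omega> (x # omit j e) = \<Omega> ([] @ (\<Sum>i<d. ip V x (e ! i) *\<^sub>R e ! i) # omit j e)"
            using basis_expand[OF e(1) x(2)] by simp
          also have "\<dots> = (\<Sum>i<d. ip V x (e ! i) * \<Omega> ([] @ e ! i # omit j e))"
            by (rule alt_forms_sum[OF True])
              (use omit_list[OF e(1)] j dim_pos in \<open>auto simp: lists_in_def basis_in[OF e(1)]\<close>)
          also have "\<dots> = (\<Sum>i<d. if i = j then ip V x (e ! j) * ((-1) ^ j * \<Omega> e) else 0)"
            using insert_omit[OF e(1) True] j by (intro sum.cong) auto
          also have "\<dots> = ip V x (e ! j) * ((-1) ^ j * \<Omega> e)" using j by simp
          finally show "(- 1) ^ j * ip V v (e ! j) * \<Omega> (x # omit j e) = ip V v (e ! j) * ip V x (e ! j) * \<Omega> e"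
            by (simp flip: power_add)
        qed simp
        also have "\<dots> = ip V x v * \<Omega> e"
          unfolding basis_parseval[OF e(1) x(2) v] sum_distrib_right by (simp add: mult_ac)
        also have "\<Omega> e = \<Omega> e'" using top_form_basis[OF True e, of e'] e' by simp
        finally show ?thesis
          using True x ip1[OF x(2)] length_basis[of e'] e' by (simp add: scaleR_fun_def wedge_def)
      next
        case False
        then show ?thesis
          using d1 length_basis[of e'] e' by (simp add: scaleR_fun_def wedge_def wedge_prod_def)
      qed
    qed
  next
    fix \<gamma> assume \<gamma>: "\<gamma> \<in> ext_power V (d - 1) \<and> (\<forall>\<alpha>\<in>ext_power V 1. \<forall>e. orthonormal_basis V e \<and> pos_oriented V e \<longrightarrow>
      wedge_prod V 1 (d - 1) \<alpha> \<gamma> = ext_ip V 1 \<alpha> (wedge V [v]) *\<^sub>R wedge V e)"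
    show "\<gamma> = ?star"
    proof
      fix \<omega>
      show "\<gamma> \<omega> = ?star \<omega>"
      proof (cases "\<omega> \<in> alt_forms V (d - 1)")
        case True
        define \<iota> where "\<iota> j ys = vol (e ! j # ys)" for j ys
        have \<iota>: "\<iota> j \<in> alt_forms V (d - 1)" if "j \<in> {..<d}" for j
          using alt_forms_append_left[of vol 1 "d - 1" "[e ! j]"] vol_alt d1 that
          by (simp add: \<iota>_def[abs_def] lists_in_def basis_in[OF e(1)])
        let ?\<omega>' = "\<lambda>ys. \<Sum>j<d. ((-1) ^ j * \<omega> (omit j e)) * \<iota> j ys"
        have \<omega>': "?\<omega>' \<in> alt_forms V (d - 1)" by (rule alt_forms_summation[OF \<iota>])
        have eq: "?\<omega>' ys = \<omega> ys" if "ys \<in> lists_in V (d - 1)" for ys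
        proof -
          have "1 * ?\<omega>' ys + (-1) * \<omega> ys = 0"
          proof (rule cotop_form_unique[OF e(1) alt_forms_lincomb[OF \<omega>' True] _ that])
            fix i assume i: "i < d"
            have "?\<omega>' (omit i e) = (\<Sum>j<d. if j = i then \<omega> (omit i e) else 0)"
              using insert_omit[OF e(1) vol_alt] i vol_basis[OF e]
              by (intro sum.cong) (auto simp: \<iota>_def simp flip: power_add)
            then show "1 * ?\<omega>' (omit i e) + (-1) * \<omega> (omit i e) = 0" using i by simp
          qed
          then show ?thesis by simp
        qed
        have val: "\<gamma> (\<iota> j) = ip V v (e ! j)" if j: "j < d" for j
        proof -
          have ej: "wedge V [e ! j] \<in> ext_power V 1" "[e ! j] \<in> lists_in V 1"
            using j basis_in[OF e(1)] by (auto intro!: ext_power_wedge simp: lists_in_def)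
          have "wedge_prod V 1 (d - 1) (wedge V [e ! j]) \<gamma> vol = (ext_ip V 1 (wedge V [e ! j]) (wedge V [v]) *\<^sub>R wedge V e) vol"
            using \<gamma> ej(1) e by auto
          then show ?thesis
            using wedge_prod_wedge[OF ej(2), of \<gamma> "d - 1" vol] \<gamma> d1 vol_alt ip1[of "e ! j"] j basis_in[OF e(1)] v
              vol_basis[OF e] length_basis[OF e(1)]
            by (simp add: \<iota>_def[abs_def] scaleR_fun_def wedge_def ip_sym)
        qed
        have "\<gamma> \<omega> = \<gamma> ?\<omega>'" using ext_power_cong[of \<gamma> "d - 1" \<omega> ?\<omega>'] \<gamma> True eq by simp
        also have "\<dots> = (\<Sum>j<d. ((-1) ^ j * \<omega> (omit j e)) * \<gamma> (\<iota> j))"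
          using \<gamma> \<iota> by (intro ext_power_linear) auto
        also have "\<dots> = ?star \<omega>" unfolding star[OF True] by (intro sum.cong) (auto simp: val)
        finally show ?thesis .
      next
        case False
        have "\<gamma> \<omega> = 0" by (rule ext_power_zero[OF conjunct1[OF \<gamma>] False])
        then show ?thesis using ext_power_zero[OF star_in False] by (rule trans[OF _ sym])
      qed
    qed
  qed
qed

text \<open>Existence: both sides of the defining equation are alternating in the \<open>d - 1\<close> vectors of a decomposable
  \<open>\<alpha>\<close>, so that they need to be compared only for \<open>\<alpha> = omit i h\<close>.  The same \<open>\<alpha>\<close> yield uniqueness.\<close>

lemma hodge_codim_1:
  assumes h: "orthonormal_basis V h" "pos_oriented V h" and \<beta>: "\<beta> \<in> ext_power V (d - 1)"
  shows "hodge V (d - 1) \<beta> =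
    wedge V [\<Sum>i<d. ((-1) ^ (d - Suc i) * \<beta> (gram V (d - 1) (omit i h))) *\<^sub>R h ! i]"
    (is "_ = wedge V [?w]")
proof -
  have dd: "d - (d - 1) = 1" "d - 1 + 1 = d" using dim_pos by auto
  have w: "?w \<in> carrier V" by (intro sum_carrier scale_carrier) (use basis_in[OF h(1)] in auto)
  have W: "wedge V [x] \<in> ext_power V 1" if "x \<in> carrier V" for x using that ext_power_1 by auto
  have prod: "wedge_prod V (d - 1) 1 (wedge V us) (wedge V [x]) \<Omega> = (if \<Omega> \<in> alt_forms V d then \<Omega> (us @ [x]) else 0)"
    if "us \<in> lists_in V (d - 1)" "x \<in> carrier V" for us x \<Omega>
    using wedge_prod_wedge[OF that(1) W[OF that(2)], of \<Omega>] dd alt_forms_append_left[of \<Omega> "d - 1" 1 us] that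
    by (auto simp: wedge_def)
  have last: "\<Omega> (omit i h @ [x]) = ip V x (h ! i) * ((-1) ^ (d - Suc i) * \<Omega> h)"
    if "\<Omega> \<in> alt_forms V d" "i < d" "x \<in> carrier V" for \<Omega> i x
  proof -
    have "\<Omega> (omit i h @ [x]) = \<Omega> (omit i h @ (\<Sum>j<d. ip V x (h ! j) *\<^sub>R h ! j) # [])"
      using basis_expand[OF h(1) that(3)] by simp
    also have "\<dots> = (\<Sum>j<d. ip V x (h ! j) * \<Omega> (omit i h @ [h ! j]))"
      by (rule alt_forms_sum[OF that(1)])
        (use omit_list[OF h(1)] that dim_pos in \<open>auto simp: lists_in_def basis_in[OF h(1)]\<close>)
    also have "\<dots> = (\<Sum>j<d. if j = i then ip V x (h ! i) * ((-1) ^ (d - Suc i) * \<Omega> h) else 0)"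
      using append_omit[OF h(1) that(1)] that(2) by (intro sum.cong) auto
    finally show ?thesis using that(2) by simp
  qed
  have wi: "ip V ?w (h ! i) = (-1) ^ (d - Suc i) * \<beta> (gram V (d - 1) (omit i h))" if "i < d" for i
  proof -
    have "ip V ?w (h ! i) = (\<Sum>j<d. ((-1) ^ (d - Suc j) * \<beta> (gram V (d - 1) (omit j h))) * ip V (h ! j) (h ! i))"
      using that basis_in[OF h(1)] by (intro ip_sum_left) auto
    also have "\<dots> = (\<Sum>j<d. if j = i then (-1) ^ (d - Suc i) * \<beta> (gram V (d - 1) (omit i h)) else 0)"
      using that basis_ip[OF h(1)] by (intro sum.cong) auto
    finally show ?thesis using that by simp
  qed
  show ?thesis
    unfolding hodge_def dd
  proof (rule the_equality, intro conjI ballI allI impI)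
    show "wedge V [?w] \<in> ext_power V 1" using W w by simp
  next
    fix \<alpha> h' assume a: "\<alpha> \<in> ext_power V (d - 1)" and h': "orthonormal_basis V h' \<and> pos_oriented V h'"
    show "wedge_prod V (d - 1) 1 \<alpha> (wedge V [?w]) = ext_ip V (d - 1) \<alpha> \<beta> *\<^sub>R wedge V h'"
      using a unfolding ext_power_def
    proof (induction rule: span_induct)
      case base
      show ?case
        by (auto simp: subspace_def wedge_prod_linear ext_ip_linear scaleR_left.add)
    next
      case (step \<alpha>)
      then obtain us where us: "\<alpha> = wedge V us" "us \<in> lists_in V (d - 1)" by (auto simp: lists_in_def)
      show ?case
      proof
        fix \<Omega>
        show "wedge_prod V (d - 1) 1 \<alpha> (wedge V [?w]) \<Omega> = (ext_ip V (d - 1) \<alpha> \<beta> *\<^sub>R wedge V h') \<Omega>"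
        proof (cases "\<Omega> \<in> alt_forms V d")
          case True
          have "1 * \<Omega> (us @ [?w]) + (- \<Omega> h) * \<beta> (gram V (d - 1) us) = 0"
          proof (rule cotop_form_unique[OF h(1) alt_forms_lincomb _ us(2)])
            show "(\<lambda>us. \<Omega> (us @ [?w])) \<in> alt_forms V (d - 1)"
              by (rule alt_forms_append_right[of _ _ 1]) (use True dd w in \<open>auto simp: lists_in_def\<close>)
            show "(\<lambda>us. \<beta> (gram V (d - 1) us)) \<in> alt_forms V (d - 1)"
              using wedge_apply_alt[OF \<beta>, of "d - 1" "gram V (d - 1)"] gram_alt_left gram_alt_right by blast
            fix i assume i: "i < d"
            show "1 * \<Omega> (omit i h @ [?w]) + (- \<Omega> h) * \<beta> (gram V (d - 1) (omit i h)) = 0"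
              unfolding last[OF True i w] wi[OF i] by (simp flip: power_add)
          qed
          then show ?thesis
            using True us prod[OF us(2) w] ext_ip_wedge[OF us(2) \<beta>] top_form_basis[OF True h, of h'] h'
              length_basis[of h']
            by (simp add: scaleR_fun_def wedge_def)
        next
          case False
          then show ?thesis using prod[OF us(2) w] us(1) length_basis[of h'] h'
            by (simp add: scaleR_fun_def wedge_def)
        qed
      qed
    qed
  next
    fix \<gamma> assume \<gamma>: "\<gamma> \<in> ext_power V 1 \<and> (\<forall>\<alpha>\<in>ext_power V (d - 1). \<forall>e. orthonormal_basis V e \<and> pos_oriented V e \<longrightarrow>
      wedge_prod V (d - 1) 1 \<alpha> \<gamma> = ext_ip V (d - 1) \<alpha> \<beta> *\<^sub>R wedge V e)"
    then obtain x where x: "\<gamma> = wedge V [x]" "x \<in> carrier V" unfolding ext_power_1 by auto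
    have "ip V x (h ! i) = ip V ?w (h ! i)" if i: "i < d" for i
    proof -
      have o: "omit i h \<in> lists_in V (d - 1)" using omit_list[OF h(1) i] .
      have "wedge_prod V (d - 1) 1 (wedge V (omit i h)) \<gamma> vol = (ext_ip V (d - 1) (wedge V (omit i h)) \<beta> *\<^sub>R wedge V h) vol"
        using \<gamma> ext_power_wedge[OF o] h by auto
      then have "\<beta> (gram V (d - 1) (omit i h)) = ip V x (h ! i) * (-1) ^ (d - Suc i)"
        unfolding x(1) prod[OF o x(2)] last[OF vol_alt i x(2)] ext_ip_wedge[OF o \<beta>]
        using vol_alt vol_basis[OF h] length_basis[OF h(1)] by (simp add: scaleR_fun_def wedge_def)
      then show ?thesis unfolding wi[OF i]
        by (simp add: mult.left_commute[of "(-1) ^ (d - Suc i)"] flip: power_add)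
    qed
    then have "x = ?w" using basis_expand[OF h(1) x(2)] basis_expand[OF h(1) w] by simp
    then show "\<gamma> = wedge V [?w]" using x by simp
  qed
qed

end

text \<open>
  The right-hand side is the derivative of \<open>volW (A e\<^sub>1, \<dots>, A e\<^sub>d)\<close> when \<open>A\<close> is varied in the direction \<open>\<langle>v, _\<rangle> z\<close>.
  The signs \<open>(-1)\<^sup>j\<close> of \<open>hodge_1\<close>, \<open>(-1)\<^sup>d\<^sup>-\<^sup>1\<^sup>-\<^sup>i\<close> of \<open>hodge_codim_1\<close>, \<open>(-1)\<^sup>i\<close> of \<open>gram_omit\<close> and the
  \<open>(-1)\<^sup>d\<^sup>-\<^sup>1\<close> in the definition of the cofactor cancel when \<open>z\<close> takes the place of \<open>A e\<^sub>j\<close>.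
\<close>

lemma cof_characterization:
  assumes V: "oriented_space V volV" and W: "oriented_space W volW" and dim: "vdim V = vdim W"
    and A: "\<And>u v a b. u \<in> carrier V \<Longrightarrow> v \<in> carrier V \<Longrightarrow> A (a *\<^sub>R u + b *\<^sub>R v) = a *\<^sub>R A u + b *\<^sub>R A v"
      "\<And>u. u \<in> carrier V \<Longrightarrow> A u \<in> carrier W"
    and e: "orthonormal_basis V e" "pos_oriented V e" and v: "v \<in> carrier V"
  shows "cof V W A v \<in> carrier W"
    and "z \<in> carrier W \<Longrightarrow> ip W (cof V W A v) z = (\<Sum>j<vdim V. ip V v (e ! j) * volW ((map A e)[j := z]))"
proof -
  interpret V: oriented_space V volV by (rule V)
  interpret W: oriented_space W volW by (rule W)
  let ?d = "vdim W"
  obtain h where h: "orthonormal_basis W h" "pos_oriented W h" using W.ex_basis by blast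
  let ?star = "hodge V 1 (wedge V [v])"
  have star: "?star = (\<Sum>j<?d. ((-1) ^ j * ip V v (e ! j)) *\<^sub>R wedge V (V.omit j e))"
    using V.hodge_1[OF e v] dim by simp
  have omit: "V.omit j e \<in> lists_in V (?d - 1)" if "j < ?d" for j using V.omit_list[OF e(1)] that dim by simp
  define \<beta> where "\<beta> = ext_map W (?d - 1) A ?star"
  have mapA: "map A (V.omit j e) \<in> lists_in W (?d - 1)" if "j < ?d" for j
    using omit[OF that] A(2) by (auto simp: lists_in_def)
  have \<beta>: "\<beta> = (\<Sum>j<?d. ((-1) ^ j * ip V v (e ! j)) *\<^sub>R wedge W (map A (V.omit j e)))"
  proof
    fix \<omega>
    have "\<beta> \<omega> = (\<Sum>j<?d. ((-1) ^ j * ip V v (e ! j)) * (if \<omega> \<in> alt_forms W (?d - 1) then \<omega> (map A (V.omit j e)) else 0))"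
      using alt_forms_comp[OF V.carrier_subspace_axioms _ A, of \<omega> "?d - 1"] omit
      unfolding \<beta>_def ext_map_def star by (auto simp: sum_fun_apply scaleR_fun_def wedge_def lists_in_def intro!: sum.cong)
    also have "\<dots> = (\<Sum>j<?d. ((-1) ^ j * ip V v (e ! j)) *\<^sub>R wedge W (map A (V.omit j e))) \<omega>"
      using mapA by (auto simp: sum_fun_apply scaleR_fun_def wedge_def lists_in_def intro!: sum.cong)
    finally show "\<beta> \<omega> = (\<Sum>j<?d. ((-1) ^ j * ip V v (e ! j)) *\<^sub>R wedge W (map A (V.omit j e))) \<omega>" .
  qed
  have \<beta>_in: "\<beta> \<in> ext_power W (?d - 1)"
    unfolding \<beta> by (rule W.ext_power_sum) (use mapA in auto)
  define w where "w = (\<Sum>i<?d. ((-1) ^ (?d - Suc i) * \<beta> (gram W (?d - 1) (W.omit i h))) *\<^sub>R h ! i)"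
  have w: "w \<in> carrier W" unfolding w_def
    by (intro W.sum_carrier W.scale_carrier) (use W.basis_in[OF h(1)] in auto)
  define w' where "w' = (-1) ^ (?d - 1) *\<^sub>R w"
  have w': "w' \<in> carrier W" using w by (simp add: w'_def)
  have hodge: "(-1) ^ (?d - 1) *\<^sub>R hodge W (?d - 1) \<beta> = wedge W [w']"
    using W.hodge_codim_1[OF h \<beta>_in] W.wedge_lin1[OF w w, of "(-1) ^ (?d - 1)" 0] by (simp add: w_def w'_def)
  have cof: "cof V W A v = w'"
    unfolding cof_def dim \<beta>_def[symmetric] hodge
  proof (rule the_equality)
    fix x assume x: "x \<in> carrier W \<and> wedge W [x] = wedge W [w']"
    show "x = w'"
    proof (rule W.ip_ext)
      fix z assume z: "z \<in> carrier W"
      then have "(\<lambda>xs. gram W 1 xs [z]) \<in> alt_forms W 1" by (intro W.gram_alt_left) (simp add: lists_in_def)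
      then have "gram W 1 [x] [z] = gram W 1 [w'] [z]"
        using x unfolding wedge_def by (auto simp: fun_eq_iff split: if_splits)
      moreover have "{\<pi>. \<pi> permutes {..<Suc 0}} = {id}" by (auto simp: permutes_sing lessThan_Suc)
      ultimately show "ip W x z = ip W w' z" by (simp add: gram_def)
    qed (use x w' in auto)
  qed (use w' in simp)
  show "cof V W A v \<in> carrier W" using cof w' by simp
  have upd: "(-1) ^ j * volW (x # map A (V.omit j e)) = volW ((map A e)[j := x])" if "j < ?d" "x \<in> carrier W" for j x
  proof -
    let ?a = "take j (map A e)" and ?c = "drop (Suc j) (map A e)"
    have len: "length (map A e) = ?d" using V.length_basis[OF e(1)] dim by simp
    have "volW ([] @ x # ?a @ ?c) = (-1) ^ length ?a * volW ([] @ ?a @ x # ?c)"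
    proof (rule W.alt_forms_move[OF W.vol_alt])
      have "set (map A e) \<subseteq> carrier W" using V.set_basis[OF e(1)] A(2) by auto
      then show "[] @ x # ?a @ ?c \<in> lists_in W ?d"
        using that len W.dim_pos set_take_subset[of j "map A e"] set_drop_subset[of "Suc j" "map A e"]
        by (simp add: lists_in_def del: set_map) (meson order_trans)
    qed
    moreover have "(map A e)[j := x] = ?a @ x # ?c" using that len by (simp add: upd_conv_take_nth_drop)
    moreover have "map A (V.omit j e) = ?a @ ?c" by (simp add: V.omit_def take_map drop_map)
    moreover have "length ?a = j" using len that by simp
    ultimately show ?thesis by (simp flip: power_add mult.assoc)
  qed
  have basis: "ip W w' (h ! i) = (\<Sum>j<?d. ip V v (e ! j) * volW ((map A e)[j := h ! i]))" if i: "i < ?d" for i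
  proof -
    have ci: "(-1) ^ (?d - 1) = (-1) ^ (?d - Suc i) * (-1 :: real) ^ i" using i by (simp flip: power_add)
    have "ip W w (h ! i) = (\<Sum>k<?d. ((-1) ^ (?d - Suc k) * \<beta> (gram W (?d - 1) (W.omit k h))) * ip W (h ! k) (h ! i))"
      unfolding w_def using W.basis_in[OF h(1)] i by (intro W.ip_sum_left) auto
    also have "\<dots> = (\<Sum>k<?d. if k = i then (-1) ^ (?d - Suc i) * \<beta> (gram W (?d - 1) (W.omit i h)) else 0)"
      using i W.basis_ip[OF h(1)] by (intro sum.cong) auto
    finally have 1: "ip W w (h ! i) = (-1) ^ (?d - Suc i) * \<beta> (gram W (?d - 1) (W.omit i h))" using i by simp
    have "\<beta> (gram W (?d - 1) (W.omit i h)) = (\<Sum>j<?d. ((-1) ^ j * ip V v (e ! j)) * gram W (?d - 1) (W.omit i h) (map A (V.omit j e)))"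
      unfolding \<beta> using W.gram_alt_right[OF W.omit_list[OF h(1) i]] mapA
      by (auto simp: sum_fun_apply scaleR_fun_def wedge_def lists_in_def intro!: sum.cong)
    also have "\<dots> = (\<Sum>j<?d. (-1) ^ i * (ip V v (e ! j) * volW ((map A e)[j := h ! i])))"
    proof (rule sum.cong)
      fix j assume "j \<in> {..<?d}" then have j: "j < ?d" by simp
      show "((-1) ^ j * ip V v (e ! j)) * gram W (?d - 1) (W.omit i h) (map A (V.omit j e)) =
        (-1) ^ i * (ip V v (e ! j) * volW ((map A e)[j := h ! i]))"
        unfolding W.gram_omit[OF h(1) i mapA[OF j] h(2)] upd[OF j W.basis_in[OF h(1) i], symmetric]
        by simp
    qed simp
    finally have 2: "\<beta> (gram W (?d - 1) (W.omit i h)) = (-1) ^ i * (\<Sum>j<?d. ip V v (e ! j) * volW ((map A e)[j := h ! i]))"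
      by (simp add: sum_distrib_left)
    have "ip W w' (h ! i) = (-1) ^ (?d - 1) * ip W w (h ! i)"
      using W.ip_lin[OF w w W.basis_in[OF h(1) i], of "(-1) ^ (?d - 1)" 0] by (simp add: w'_def)
    also have "\<dots> = (((-1) ^ (?d - Suc i) * (-1) ^ i) * ((-1) ^ (?d - Suc i) * (-1) ^ i)) * (\<Sum>j<?d. ip V v (e ! j) * volW ((map A e)[j := h ! i]))"
      unfolding 1 2 ci by (simp only: mult_ac)
    finally show ?thesis by (simp flip: power_add mult.assoc)
  qed
  show "ip W (cof V W A v) z = (\<Sum>j<vdim V. ip V v (e ! j) * volW ((map A e)[j := z]))" if z: "z \<in> carrier W"
  proof -
    have vz: "volW ((map A e)[j := z]) = (\<Sum>i<?d. ip W z (h ! i) * volW ((map A e)[j := h ! i]))" if j: "j < ?d" for j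
    proof -
      let ?a = "take j (map A e)" and ?c = "drop (Suc j) (map A e)"
      have len: "length (map A e) = ?d" using V.length_basis[OF e(1)] dim by simp
      have u: "(map A e)[j := x] = ?a @ x # ?c" for x using j len by (simp add: upd_conv_take_nth_drop)
      have "set (map A e) \<subseteq> carrier W" using V.set_basis[OF e(1)] A(2) by auto
      then have "volW (?a @ (\<Sum>i<?d. ip W z (h ! i) *\<^sub>R h ! i) # ?c) = (\<Sum>i<?d. ip W z (h ! i) * volW (?a @ h ! i # ?c))"
        using j len W.basis_in[OF h(1)]
          order_trans[OF set_take_subset[of j "map A e"]] order_trans[OF set_drop_subset[of "Suc j" "map A e"]]
        by (intro W.alt_forms_sum[OF W.vol_alt]) (auto simp del: set_map)
      then show ?thesis unfolding u using W.basis_expand[OF h(1) z] by simp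
    qed
    have "ip W w' z = (\<Sum>i<?d. ip W z (h ! i) * (\<Sum>j<?d. ip V v (e ! j) * volW ((map A e)[j := h ! i])))"
      using W.basis_parseval[OF h(1) w' z] basis by (simp add: mult.commute)
    also have "\<dots> = (\<Sum>j<?d. ip V v (e ! j) * (\<Sum>i<?d. ip W z (h ! i) * volW ((map A e)[j := h ! i])))"
      unfolding sum_distrib_left by (subst sum.swap) (simp add: mult_ac)
    also have "\<dots> = (\<Sum>j<?d. ip V v (e ! j) * volW ((map A e)[j := z]))"
      using vz by simp
    finally show ?thesis unfolding cof dim .
  qed
qed

section \<open>The derivative of the determinant\<close>

definition ddet :: "real^'n^'n \<Rightarrow> real^'n^'n \<Rightarrow> real"
  where "ddet B Z = (\<Sum>i\<in>UNIV. det (\<chi> a. if a = i then Z $ i else B $ a))"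

lemma has_derivative_det: "(det has_derivative ddet B) (at B)" for B :: "real^'n^'n"
proof -
  have nth: "((\<lambda>A. A $ i $ j) has_derivative (\<lambda>Z. Z $ i $ j)) (at B)" for i j :: 'n
    by (intro bounded_linear.has_derivative[OF bounded_linear_vec_nth] has_derivative_ident)
  have "(det has_derivative (\<lambda>Z. \<Sum>p | p permutes UNIV. of_int (sign p) *
      (\<Sum>i\<in>UNIV. Z $ i $ p i * (\<Prod>j\<in>UNIV - {i}. B $ j $ p j)))) (at B)"
    unfolding det_def[abs_def]
    by (intro has_derivative_sum has_derivative_mult_right has_derivative_prod nth)
  moreover have "(\<lambda>Z. \<Sum>p | p permutes UNIV. of_int (sign p) *
      (\<Sum>i\<in>UNIV. Z $ i $ p i * (\<Prod>j\<in>UNIV - {i}. B $ j $ p j))) = ddet B"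
  proof
    fix Z :: "real^'n^'n"
    have "ddet B Z = (\<Sum>i\<in>UNIV. \<Sum>p | p permutes UNIV. of_int (sign p) *
        (Z $ i $ p i * (\<Prod>j\<in>UNIV - {i}. B $ j $ p j)))"
      unfolding ddet_def det_def
      by (intro sum.cong refl arg_cong2[of _ _ _ _ "(*)"])
        (subst prod.remove[of UNIV], auto intro!: prod.cong)
    then show "(\<Sum>p | p permutes UNIV. of_int (sign p) *
      (\<Sum>i\<in>UNIV. Z $ i $ p i * (\<Prod>j\<in>UNIV - {i}. B $ j $ p j))) = ddet B Z"
      by (subst (asm) sum.swap) (simp add: sum_distrib_left)
  qed
  ultimately show ?thesis by simp
qed

lemma has_derivative_det_comp [derivative_intros]:
  assumes "(M has_derivative M') (at x within S)"
  shows "((\<lambda>x. det (M x :: real^'n^'n)) has_derivative (\<lambda>h. ddet (M x) (M' h))) (at x within S)"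
  using has_derivative_compose[OF assms has_derivative_det] by simp

lemma linear_ddet: "linear (ddet B)"
  using has_derivative_det has_derivative_linear by blast

lemma bounded_linear_matrix_left: "bounded_linear (\<lambda>A. E ** A :: real^'n^'n)"
  and bounded_linear_matrix_right: "bounded_linear (\<lambda>A. A ** E :: real^'n^'n)"
  and bounded_linear_transpose: "bounded_linear (transpose :: real^'n^'n \<Rightarrow> real^'n^'n)"
  by (auto intro!: linearI linear_conv_bounded_linear[THEN iffD1]
      simp: matrix_add_ldistrib transpose_def vec_eq_iff
        matrix_matrix_mult_def sum_distrib_left sum.distrib algebra_simps)

text \<open>This and the next lemma differentiate identities for the determinant, which is shorter than
  manipulating sums of determinants with one row replaced.\<close>

lemma ddet_mult_left: "ddet (E ** B) (E ** Z) = det E * ddet B Z"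
proof -
  have "((\<lambda>A. det (E ** A)) has_derivative (\<lambda>Z. ddet (E ** B) (E ** Z))) (at B)"
    by (intro derivative_intros bounded_linear.has_derivative[OF bounded_linear_matrix_left] has_derivative_ident)
  moreover have "((\<lambda>A. det (E ** A)) has_derivative (\<lambda>Z. det E * ddet B Z)) (at B)"
    unfolding det_mul by (intro derivative_intros has_derivative_det)
  ultimately show ?thesis using has_derivative_unique by metis
qed

lemma ddet_transpose: "ddet (transpose B) (transpose Z) = ddet B Z"
proof -
  have "((\<lambda>A. det (transpose A)) has_derivative (\<lambda>Z. ddet (transpose B) (transpose Z))) (at B)"
    by (intro derivative_intros bounded_linear.has_derivative[OF bounded_linear_transpose] has_derivative_ident)
  moreover have "((\<lambda>A. det (transpose A)) has_derivative ddet B) (at B)"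
    unfolding det_transpose by (rule has_derivative_det)
  ultimately show ?thesis using has_derivative_unique by metis
qed

lemma ddet_left_mult: "ddet A (W ** A) = trace W * det A" for A :: "real^'n^'n"
proof -
  have "det (\<chi> a. if a = i then (W ** A) $ i else A $ a) = W $ i $ i * det A" for i
  proof -
    have "(W ** A) $ i = (\<Sum>k\<in>UNIV. (W $ i) $ k *s row k A)"
      by (simp add: vec_eq_iff matrix_matrix_mult_def row_def)
    then show ?thesis using cramer_lemma_transpose[of i "W $ i" A]
      by (simp add: row_def cong: if_cong)
  qed
  then show ?thesis by (simp add: ddet_def trace_def sum_distrib_right)
qed

section \<open>The cofactor matrix\<close>

text \<open>The cofactors as determinants of the same size: a unit row in place of the row that a minor would
  strike out.\<close>

definition cofm :: "real^'n^'n \<Rightarrow> real^'n^'n"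
  where "cofm A = (\<chi> m j. det (\<chi> a. if a = m then axis j 1 else A $ a))"

lemma det_row_expand:
  "det (\<chi> a. if a = m then z else A $ a) = (\<Sum>j\<in>UNIV. z $ j * cofm A $ m $ j)" for A :: "real^'n^'n"
proof -
  have "det (\<chi> a. if a = m then \<Sum>j\<in>UNIV. z $ j *s axis j 1 else A $ a) =
      (\<Sum>j\<in>UNIV. det (\<chi> a. if a = m then z $ j *s axis j 1 else A $ a))"
    by (rule det_linear_row_sum) simp
  also have "\<dots> = (\<Sum>j\<in>UNIV. z $ j * cofm A $ m $ j)"
    by (simp add: cofm_def det_row_mul)
  finally show ?thesis unfolding basis_expansion .
qed

lemma ddet_cofm: "ddet A Z = (\<Sum>m\<in>UNIV. \<Sum>j\<in>UNIV. Z $ m $ j * cofm A $ m $ j)"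
  by (simp add: ddet_def det_row_expand)

lemma cofm_row:
  "(\<Sum>j\<in>UNIV. cofm A $ m $ j * A $ a $ j) = (if a = m then det A else 0)" for A :: "real^'n^'n"
proof -
  have "(\<Sum>j\<in>UNIV. cofm A $ m $ j * A $ a $ j) = det (\<chi> b. if b = m then A $ a else A $ b)"
    by (simp add: det_row_expand mult.commute)
  also have "\<dots> = (if a = m then det A else 0)"
  proof (cases "a = m")
    case True
    have "(\<chi> b. if b = m then A $ a else A $ b) = A" using True by (auto simp: vec_eq_iff)
    then show ?thesis using True by simp
  next
    case False
    then show ?thesis by (auto intro!: det_identical_rows[of a m] simp: row_def vec_eq_iff)
  qed
  finally show ?thesis .
qed

lemma matrix_inv_cofm:
  fixes A :: "real^'n^'n"
  assumes "det A \<noteq> 0" shows "matrix_inv A = (1 / det A) *\<^sub>R transpose (cofm A)"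
proof -
  let ?B = "(1 / det A) *\<^sub>R transpose (cofm A)"
  have 1: "A ** ?B = mat 1"
    using cofm_row[of A] assms
    by (auto simp: vec_eq_iff matrix_matrix_mult_def transpose_def mat_def mult.commute
        simp flip: sum_divide_distrib)
  then have 2: "?B ** A = mat 1" using matrix_left_right_inverse by blast
  have "A ** matrix_inv A = mat 1 \<and> matrix_inv A ** A = mat 1"
    unfolding matrix_inv_def by (rule someI[of _ ?B]) (use 1 2 in simp)
  then show ?thesis
    using 1 by (metis matrix_mul_assoc matrix_mul_lid matrix_mul_rid)
qed

text \<open>The derivative of the determinants in \<^const>\<open>cofm\<close>, whose row \<open>m\<close> is constant.\<close>

definition dcofm :: "real^'n^'n \<Rightarrow> real^'n^'n \<Rightarrow> real^'n^'n"
  where "dcofm A Z = (\<chi> m j. ddet (\<chi> a. if a = m then axis j 1 else A $ a) (\<chi> a. if a = m then 0 else Z $ a))"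

lemma has_derivative_vecI:
  fixes f :: "'a::real_normed_vector \<Rightarrow> 'b::euclidean_space^'n"
  assumes "\<And>i. ((\<lambda>x. f x $ i) has_derivative (\<lambda>h. f' h $ i)) (at x within S)"
  shows "(f has_derivative f') (at x within S)"
  unfolding has_derivative_componentwise_within[of f]
  using has_derivative_inner_left[OF assms] by (auto simp: Basis_vec_def inner_axis)

lemma has_derivative_cofm [derivative_intros]:
  assumes "(M has_derivative M') (at x within S)"
  shows "((\<lambda>x. cofm (M x :: real^'n^'n)) has_derivative (\<lambda>h. dcofm (M x) (M' h))) (at x within S)"
proof (intro has_derivative_vecI)
  fix m j
  have "((\<lambda>x. \<chi> a. if a = m then axis j 1 else M x $ a) has_derivative (\<lambda>h. \<chi> a. if a = m then 0 else M' h $ a)) (at x within S)"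
  proof (rule has_derivative_vecI)
    fix i
    show "((\<lambda>x. (\<chi> a. if a = m then axis j 1 else M x $ a) $ i) has_derivative
        (\<lambda>h. (\<chi> a. if a = m then 0 else M' h $ a) $ i)) (at x within S)"
      using bounded_linear.has_derivative[OF bounded_linear_vec_nth assms] by (cases "i = m") auto
  qed
  from has_derivative_det_comp[OF this]
  show "((\<lambda>x. cofm (M x) $ m $ j) has_derivative (\<lambda>h. dcofm (M x) (M' h) $ m $ j)) (at x within S)"
    by (simp add: cofm_def dcofm_def)
qed

text \<open>The second derivative of the determinant in the entries \<open>(m, j)\<close> and \<open>(i, k)\<close> is the determinant with
  row \<open>m\<close> replaced by the \<open>j\<close>-th and row \<open>i\<close> by the \<open>k\<close>-th unit vector.  Exchanging \<open>j\<close> and \<open>k\<close> exchanges the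
  two rows.  With \<open>Z j\<close> the derivative of a Jacobian matrix in the direction \<open>j\<close>, the assumption is the symmetry
  of second derivatives.\<close>

lemma piola_euclidean:
  fixes A :: "real^'n^'n" and Z :: "'n \<Rightarrow> real^'n^'n"
  assumes sym: "\<And>i j k. Z j $ i $ k = Z k $ i $ j"
  shows "(\<Sum>j\<in>UNIV. dcofm A (Z j) $ m $ j) = 0"
proof -
  define B where "B j = (\<chi> a. if a = m then axis j 1 else A $ a)" for j
  define s where "s i j k = cofm (B j) $ i $ k" for i j k
  have anti: "s i k j = - s i j k" if "i \<noteq> m" for i j k
  proof -
    have s: "s i j k = det (\<chi> a. if a = i then axis k 1 else if a = m then axis j 1 else A $ a)" for j k
      by (simp add: s_def cofm_def B_def cong: if_cong)
    let ?p = "Transposition.transpose i m"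
    have p: "?p permutes (UNIV :: 'n set)" by (rule permutes_swap_id) auto
    let ?C = "\<lambda>j k. \<chi> a. if a = i then axis k 1 else if a = m then axis j 1 else A $ a"
    have "?C k j = (\<chi> a. ?C j k $ ?p a)"
      using that by (auto simp: vec_eq_iff Transposition.transpose_def)
    then have "s i k j = of_int (sign ?p) * s i j k"
      unfolding s using det_permute_rows[OF p, of "?C j k"] by simp
    then show ?thesis using that by (simp add: sign_swap_id)
  qed
  have "dcofm A (Z j) $ m $ j = (\<Sum>i\<in>UNIV - {m}. \<Sum>k\<in>UNIV. Z j $ i $ k * s i j k)" for j
  proof -
    have "dcofm A (Z j) $ m $ j = (\<Sum>i\<in>UNIV. \<Sum>k\<in>UNIV. (if i = m then 0 else Z j $ i) $ k * s i j k)"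
      by (simp add: dcofm_def ddet_cofm s_def B_def)
    also have "\<dots> = (\<Sum>i\<in>UNIV - {m}. \<Sum>k\<in>UNIV. Z j $ i $ k * s i j k)"
      by (rule sum.mono_neutral_cong_right) auto
    finally show ?thesis .
  qed
  then have "(\<Sum>j\<in>UNIV. dcofm A (Z j) $ m $ j) = (\<Sum>j\<in>UNIV. \<Sum>i\<in>UNIV - {m}. \<Sum>k\<in>UNIV. Z j $ i $ k * s i j k)"
    by simp
  also have "\<dots> = (\<Sum>i\<in>UNIV - {m}. \<Sum>j\<in>UNIV. \<Sum>k\<in>UNIV. Z j $ i $ k * s i j k)" by (rule sum.swap)
  also have "\<dots> = 0"
  proof (rule sum.neutral, rule ballI)
    fix i assume "i \<in> UNIV - {m}"
    then have i: "i \<noteq> m" by simp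
    have "(\<Sum>j\<in>UNIV. \<Sum>k\<in>UNIV. Z j $ i $ k * s i j k) = (\<Sum>j\<in>UNIV. \<Sum>k\<in>UNIV. Z k $ i $ j * s i k j)"
      by (rule sum.swap)
    also have "\<dots> = - (\<Sum>j\<in>UNIV. \<Sum>k\<in>UNIV. Z j $ i $ k * s i j k)"
    proof -
      have "Z k $ i $ j * s i k j = - (Z j $ i $ k * s i j k)" for j k
        using sym[of j i k] anti[OF i, of k j] by simp
      then have "(\<Sum>j\<in>UNIV. \<Sum>k\<in>UNIV. Z k $ i $ j * s i k j) = (\<Sum>j\<in>UNIV. \<Sum>k\<in>UNIV. - (Z j $ i $ k * s i j k))"
        by (intro sum.cong refl)
      then show ?thesis by (simp only: sum_negf)
    qed
    finally show "(\<Sum>j\<in>UNIV. \<Sum>k\<in>UNIV. Z j $ i $ k * s i j k) = 0" by simp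
  qed
  finally show ?thesis .
qed

section \<open>Symmetry of second derivatives\<close>

text \<open>The mean value theorem, once in the direction \<open>u\<close> and once in the direction \<open>v\<close>.  The left-hand side is
  symmetric in \<open>u\<close> and \<open>v\<close>.\<close>

lemma second_difference:
  fixes f :: "'a::real_normed_vector \<Rightarrow> real"
  assumes f: "\<And>t s. 0 \<le> t \<Longrightarrow> t \<le> h \<Longrightarrow> 0 \<le> s \<Longrightarrow> s \<le> h \<Longrightarrow>
      (f has_derivative f' (x + t *\<^sub>R u + s *\<^sub>R v)) (at (x + t *\<^sub>R u + s *\<^sub>R v))"
    and f': "\<And>t s. 0 \<le> t \<Longrightarrow> t \<le> h \<Longrightarrow> 0 \<le> s \<Longrightarrow> s \<le> h \<Longrightarrow>
      ((\<lambda>y. f' y u) has_derivative f'' (x + t *\<^sub>R u + s *\<^sub>R v)) (at (x + t *\<^sub>R u + s *\<^sub>R v))"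
    and h: "0 < h"
  obtains t s where "0 \<le> t" "t \<le> h" "0 \<le> s" "s \<le> h"
    "f (x + h *\<^sub>R u + h *\<^sub>R v) - f (x + h *\<^sub>R u) - f (x + h *\<^sub>R v) + f x = h * h * f'' (x + t *\<^sub>R u + s *\<^sub>R v) v"
proof -
  let ?g = "\<lambda>t. f (x + t *\<^sub>R u + h *\<^sub>R v) - f (x + t *\<^sub>R u + 0 *\<^sub>R v)"
  let ?g' = "\<lambda>t. f' (x + t *\<^sub>R u + h *\<^sub>R v) u - f' (x + t *\<^sub>R u + 0 *\<^sub>R v) u"
  have d1: "((\<lambda>t. f (x + t *\<^sub>R u + s *\<^sub>R v)) has_derivative (\<lambda>k. k * f' (x + t *\<^sub>R u + s *\<^sub>R v) u)) (at t)"
    if "0 \<le> t" "t \<le> h" "0 \<le> s" "s \<le> h" for t s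
  proof -
    have "((\<lambda>t. x + t *\<^sub>R u + s *\<^sub>R v) has_derivative (\<lambda>k. k *\<^sub>R u)) (at t)"
      by (auto intro!: derivative_eq_intros)
    from has_derivative_compose[OF this f[OF that]] show ?thesis
      using linear_cmul[OF has_derivative_linear[OF f[OF that]]] by simp
  qed
  have "\<exists>t. 0 < t \<and> t < h \<and> ?g h - ?g 0 = (h - 0) * ?g' t"
  proof (rule MVT2[of 0 h ?g ?g', OF h])
    fix t assume t: "0 \<le> t" "t \<le> h"
    have "(?g has_derivative (\<lambda>k. k * f' (x + t *\<^sub>R u + h *\<^sub>R v) u - k * f' (x + t *\<^sub>R u + 0 *\<^sub>R v) u)) (at t)"
      using t h by (intro has_derivative_diff d1) auto
    then show "(?g has_field_derivative ?g' t) (at t)"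
      unfolding has_field_derivative_def
      by (rule has_derivative_eq_rhs) (simp add: fun_eq_iff left_diff_distrib right_diff_distrib mult.commute)
  qed
  then obtain t where t: "0 \<le> t" "t \<le> h" "?g h - ?g 0 = h * ?g' t" by (auto intro: less_imp_le)
  let ?k = "\<lambda>s. f' (x + t *\<^sub>R u + s *\<^sub>R v) u"
  have "\<exists>s. 0 < s \<and> s < h \<and> ?k h - ?k 0 = (h - 0) * f'' (x + t *\<^sub>R u + s *\<^sub>R v) v"
  proof (rule MVT2[of 0 h ?k "\<lambda>s. f'' (x + t *\<^sub>R u + s *\<^sub>R v) v", OF h])
    fix s assume s: "0 \<le> s" "s \<le> h"
    have "((\<lambda>s. x + t *\<^sub>R u + s *\<^sub>R v) has_derivative (\<lambda>k. k *\<^sub>R v)) (at s)"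
      by (auto intro!: derivative_eq_intros)
    from has_derivative_compose[OF this f'[OF t(1,2) s]]
    show "(?k has_field_derivative f'' (x + t *\<^sub>R u + s *\<^sub>R v) v) (at s)"
      unfolding has_field_derivative_def
      by (rule has_derivative_eq_rhs)
        (simp add: fun_eq_iff linear_cmul[OF has_derivative_linear[OF f'[OF t(1,2) s]]])
  qed
  then obtain s where "0 \<le> s" "s \<le> h" "?k h - ?k 0 = h * f'' (x + t *\<^sub>R u + s *\<^sub>R v) v" by (auto intro: less_imp_le)
  with t that[of t s] show ?thesis by (simp add: algebra_simps)
qed

lemma second_derivative_symmetric_real:
  fixes f :: "'a::real_normed_vector \<Rightarrow> real"
  assumes S: "open S" "x \<in> S"
    and f: "\<And>y. y \<in> S \<Longrightarrow> (f has_derivative f' y) (at y)"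
    and f': "\<And>y w. y \<in> S \<Longrightarrow> ((\<lambda>y. f' y w) has_derivative f'' w y) (at y)"
    and cont: "\<And>w w'. continuous_on S (\<lambda>y. f'' w y w')"
  shows "f'' u x v = f'' v x u"
proof (rule ccontr)
  assume ne: "f'' u x v \<noteq> f'' v x u"
  define \<epsilon> where "\<epsilon> = \<bar>f'' u x v - f'' v x u\<bar> / 2"
  have \<epsilon>: "\<epsilon> > 0" using ne by (simp add: \<epsilon>_def)
  have "\<forall>\<^sub>F y in nhds x. \<bar>f'' w y w' - f'' w x w'\<bar> < \<epsilon>" for w w'
  proof -
    have "isCont (\<lambda>y. f'' w y w') x" using cont S by (simp add: continuous_on_eq_continuous_at)
    then have "((\<lambda>y. f'' w y w') \<longlongrightarrow> f'' w x w') (nhds x)"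
      using tendsto_at_iff_tendsto_nhds[of "\<lambda>y. f'' w y w'" x] by (simp add: isCont_def)
    from tendstoD[OF this \<epsilon>] show ?thesis by (simp add: dist_real_def)
  qed
  from this[of u v] this[of v u] eventually_nhds_in_open[OF S]
  have "\<forall>\<^sub>F y in nhds x. y \<in> S \<and> \<bar>f'' u y v - f'' u x v\<bar> < \<epsilon> \<and> \<bar>f'' v y u - f'' v x u\<bar> < \<epsilon>"
    by eventually_elim auto
  then obtain r where r: "r > 0" "\<And>y. dist y x < r \<Longrightarrow> y \<in> S \<and> \<bar>f'' u y v - f'' u x v\<bar> < \<epsilon> \<and> \<bar>f'' v y u - f'' v x u\<bar> < \<epsilon>"
    unfolding eventually_nhds_metric by auto
  define h where "h = r / (norm u + norm v + 1) / 2"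
  have h: "h > 0" using r(1) by (simp add: h_def add_nonneg_pos)
  have near: "dist (x + t *\<^sub>R u + s *\<^sub>R v) x < r" if "0 \<le> t" "t \<le> h" "0 \<le> s" "s \<le> h" for t s
  proof -
    have "dist (x + t *\<^sub>R u + s *\<^sub>R v) x \<le> t * norm u + s * norm v"
      using norm_triangle_ineq[of "t *\<^sub>R u" "s *\<^sub>R v"] that by (simp add: dist_norm add.assoc)
    also have "\<dots> \<le> h * norm u + h * norm v" using that by (intro add_mono mult_right_mono) auto
    also have "\<dots> \<le> h * (norm u + norm v + 1)" using h by (simp add: algebra_simps)
    also have "\<dots> = r / 2"
    proof -
      have "norm u + norm v + 1 \<noteq> 0" by (smt (verit) norm_ge_zero)
      moreover have "n \<noteq> 0 \<Longrightarrow> a / n / 2 * n = a / 2" for a n :: real by simp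
      ultimately show ?thesis unfolding h_def by blast
    qed
    also have "\<dots> < r" using r by simp
    finally show ?thesis .
  qed
  obtain t s where ts: "0 \<le> t" "t \<le> h" "0 \<le> s" "s \<le> h"
    "f (x + h *\<^sub>R u + h *\<^sub>R v) - f (x + h *\<^sub>R u) - f (x + h *\<^sub>R v) + f x = h * h * f'' u (x + t *\<^sub>R u + s *\<^sub>R v) v"
    by (rule second_difference[of h f f' x u v "f'' u", OF f f' h]) (use near r(2) in blast)+
  have near': "dist (x + t *\<^sub>R v + s *\<^sub>R u) x < r" if "0 \<le> t" "t \<le> h" "0 \<le> s" "s \<le> h" for t s
    using near[of s t] that by (simp add: add_ac)
  obtain t' s' where ts': "0 \<le> t'" "t' \<le> h" "0 \<le> s'" "s' \<le> h"
    "f (x + h *\<^sub>R v + h *\<^sub>R u) - f (x + h *\<^sub>R v) - f (x + h *\<^sub>R u) + f x = h * h * f'' v (x + t' *\<^sub>R v + s' *\<^sub>R u) u"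
    by (rule second_difference[of h f f' x v u "f'' v", OF f f' h]) (use near' r(2) in blast)+
  have "f'' u (x + t *\<^sub>R u + s *\<^sub>R v) v = f'' v (x + t' *\<^sub>R v + s' *\<^sub>R u) u"
  proof -
    have "f (x + h *\<^sub>R v + h *\<^sub>R u) = f (x + h *\<^sub>R u + h *\<^sub>R v)" by (rule arg_cong) simp
    then have "h * h * f'' u (x + t *\<^sub>R u + s *\<^sub>R v) v = h * h * f'' v (x + t' *\<^sub>R v + s' *\<^sub>R u) u"
      using ts(5) ts'(5) by linarith
    then show ?thesis using h by simp
  qed
  moreover have "\<bar>f'' u (x + t *\<^sub>R u + s *\<^sub>R v) v - f'' u x v\<bar> < \<epsilon>" "\<bar>f'' v (x + t' *\<^sub>R v + s' *\<^sub>R u) u - f'' v x u\<bar> < \<epsilon>"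
    using r(2)[OF near] r(2)[OF near'] ts ts' by auto
  moreover have "\<lbrakk>\<bar>a - p\<bar> < \<bar>p - q\<bar> / 2; \<bar>a - q\<bar> < \<bar>p - q\<bar> / 2\<rbrakk> \<Longrightarrow> False" for a p q :: real
    using abs_triangle_ineq4[of "a - q" "a - p"] by (simp add: field_simps)
  ultimately show False unfolding \<epsilon>_def by metis
qed

lemma second_derivative_symmetric:
  fixes f :: "'a::real_normed_vector \<Rightarrow> 'b::euclidean_space"
  assumes S: "open S" "x \<in> S"
    and f: "\<And>y. y \<in> S \<Longrightarrow> (f has_derivative f' y) (at y)"
    and f': "\<And>y w. y \<in> S \<Longrightarrow> ((\<lambda>y. f' y w) has_derivative f'' w y) (at y)"
    and cont: "\<And>w w'. continuous_on S (\<lambda>y. f'' w y w')"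
  shows "f'' u x v = f'' v x u"
proof (rule euclidean_eqI)
  fix b :: 'b assume "b \<in> Basis"
  show "f'' u x v \<bullet> b = f'' v x u \<bullet> b"
    by (rule second_derivative_symmetric_real[OF S, of "\<lambda>y. f y \<bullet> b" "\<lambda>y w. f' y w \<bullet> b" "\<lambda>w y w'. f'' w y w' \<bullet> b"])
      (auto intro!: has_derivative_inner_left f f' continuous_intros cont)
qed

section \<open>The Levi-Civita connection in coordinates\<close>

text \<open>
  The Christoffel map of a metric with the value \<open>G\<close> and the partial derivatives \<open>dG i\<close> at a point.  Below,
  \<open>D w\<close> is the derivative in the direction \<open>w\<close>.
\<close>

definition gamma :: "real^'n^'n \<Rightarrow> ('n \<Rightarrow> real^'n^'n) \<Rightarrow> real^'n \<Rightarrow> real^'n \<Rightarrow> real^'n"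
  where "gamma G dG u v = (\<chi> k. \<Sum>i\<in>UNIV. \<Sum>j\<in>UNIV.
    (1/2 * (\<Sum>l\<in>UNIV. matrix_inv G $ k $ l * (dG i $ j $ l + dG j $ i $ l - dG l $ i $ j))) * u $ i * v $ j)"

lemma inner_matrix: "x \<bullet> (A *v y) = (\<Sum>i\<in>UNIV. \<Sum>j\<in>UNIV. A $ i $ j * x $ i * y $ j)" for A :: "real^'n^'n"
  by (simp add: inner_vec_def matrix_vector_mult_def sum_distrib_left mult_ac)

lemma matrix_inv_right_det: "det A \<noteq> 0 \<Longrightarrow> A ** matrix_inv A = mat 1" for A :: "real^'n^'n"
  unfolding matrix_inv_def
  by (rule someI2_ex) (auto simp: invertible_det_nz[symmetric] invertible_def)

lemma matrix_inv_left_det: "det A \<noteq> 0 \<Longrightarrow> matrix_inv A ** A = mat 1" for A :: "real^'n^'n"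
  using matrix_inv_right_det matrix_left_right_inverse by blast

lemma matrix_kernel_det:
  fixes A :: "real^'n^'n"
  assumes "det A \<noteq> 0" "A *v w = 0" shows "w = 0"
proof -
  have "w = (matrix_inv A ** A) *v w" using matrix_inv_left_det[OF assms(1)] by simp
  also have "\<dots> = matrix_inv A *v (A *v w)" by (simp add: matrix_vector_mul_assoc)
  finally show ?thesis using assms(2) by simp
qed

lemma symmetric_entries:
  assumes "transpose A = A" shows "A $ j $ k = A $ k $ j"
proof -
  have "transpose A $ j $ k = A $ k $ j" by (simp add: transpose_def)
  then show ?thesis using assms by simp
qed

lemma gamma_sym:
  assumes "\<And>i. transpose (dG i) = dG i"
  shows "gamma G dG u v = gamma G dG v u"
proof -
  have s: "dG i $ j $ k = dG i $ k $ j" for i j k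
    by (rule symmetric_entries[OF assms])
  show ?thesis
    unfolding gamma_def
    by (subst sum.swap, subst s) (simp add: mult_ac add.commute)
qed

lemma bilinear_coefficients:
  fixes c :: "'k::finite \<Rightarrow> 'i::finite \<Rightarrow> 'j::finite \<Rightarrow> real"
  shows "bilinear (\<lambda>u v. \<chi> k. \<Sum>i\<in>UNIV. \<Sum>j\<in>UNIV. c k i j * u $ i * v $ j)"
  unfolding bilinear_def
  by (auto intro!: linearI simp: vec_eq_iff sum.distrib sum_distrib_left algebra_simps)

lemma bilinear_gamma: "bilinear (gamma G dG)"
  unfolding gamma_def[abs_def] by (rule bilinear_coefficients)

lemma gamma_lower:
  fixes G :: "real^'n^'n"
  assumes "det G \<noteq> 0" and s: "\<And>i. transpose (dG i) = dG i"
    and D: "\<And>w. D w = (\<Sum>i\<in>UNIV. w $ i *\<^sub>R dG i)"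
  shows "y \<bullet> (G *v gamma G dG u v) = 1/2 * (v \<bullet> (D u *v y) + u \<bullet> (D v *v y) - u \<bullet> (D y *v v))"
proof -
  define K where "K = (\<chi> l. \<Sum>i\<in>UNIV. \<Sum>j\<in>UNIV. (dG i $ j $ l + dG j $ i $ l - dG l $ i $ j) * u $ i * v $ j)"
  have "gamma G dG u v = (1/2) *\<^sub>R (matrix_inv G *v K)"
  proof -
    have "gamma G dG u v $ k = (1/2) * (\<Sum>l\<in>UNIV. matrix_inv G $ k $ l * K $ l)" for k
    proof -
      have "gamma G dG u v $ k = (\<Sum>i\<in>UNIV. \<Sum>j\<in>UNIV. \<Sum>l\<in>UNIV. 1/2 * (matrix_inv G $ k $ l * ((dG i $ j $ l + dG j $ i $ l - dG l $ i $ j) * u $ i * v $ j)))"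
        by (simp add: gamma_def sum_distrib_left sum_distrib_right mult_ac)
      also have "\<dots> = (\<Sum>i\<in>UNIV. \<Sum>l\<in>UNIV. \<Sum>j\<in>UNIV. 1/2 * (matrix_inv G $ k $ l * ((dG i $ j $ l + dG j $ i $ l - dG l $ i $ j) * u $ i * v $ j)))"
        by (intro sum.cong refl sum.swap)
      also have "\<dots> = (\<Sum>l\<in>UNIV. \<Sum>i\<in>UNIV. \<Sum>j\<in>UNIV. 1/2 * (matrix_inv G $ k $ l * ((dG i $ j $ l + dG j $ i $ l - dG l $ i $ j) * u $ i * v $ j)))"
        by (rule sum.swap)
      finally show ?thesis by (simp add: K_def sum_distrib_left)
    qed
    then show ?thesis by (simp add: vec_eq_iff matrix_vector_mult_def)
  qed
  then have "G *v gamma G dG u v = (1/2) *\<^sub>R ((G ** matrix_inv G) *v K)"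
    by (simp add: matrix_vector_mult_scaleR matrix_vector_mul_assoc)
  then have "y \<bullet> (G *v gamma G dG u v) = 1/2 * (y \<bullet> K)"
    using matrix_inv_right_det[OF assms(1)] by simp
  also have "y \<bullet> K = v \<bullet> (D u *v y) + u \<bullet> (D v *v y) - u \<bullet> (D y *v v)"
  proof -
    have "y \<bullet> K = (\<Sum>l\<in>UNIV. \<Sum>i\<in>UNIV. \<Sum>j\<in>UNIV. dG i $ j $ l * u $ i * v $ j * y $ l)
       + (\<Sum>l\<in>UNIV. \<Sum>i\<in>UNIV. \<Sum>j\<in>UNIV. dG j $ i $ l * u $ i * v $ j * y $ l)
       - (\<Sum>l\<in>UNIV. \<Sum>i\<in>UNIV. \<Sum>j\<in>UNIV. dG l $ i $ j * u $ i * v $ j * y $ l)"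
      by (simp add: K_def inner_vec_def sum_distrib_left algebra_simps sum.distrib sum_subtractf)
    moreover have D: "x \<bullet> (D w *v z) = (\<Sum>a\<in>UNIV. \<Sum>b\<in>UNIV. \<Sum>c\<in>UNIV. dG c $ a $ b * w $ c * x $ a * z $ b)" for x w z
      unfolding inner_matrix D by (simp add: sum_distrib_left sum_distrib_right mult_ac)
    have rot: "(\<Sum>a\<in>UNIV. \<Sum>b\<in>UNIV. \<Sum>c\<in>UNIV. F a b c) = (\<Sum>b\<in>UNIV. \<Sum>c\<in>UNIV. \<Sum>a\<in>UNIV. F a b c)" for F :: "'n \<Rightarrow> 'n \<Rightarrow> 'n \<Rightarrow> real"
      by (subst sum.swap) (intro sum.cong refl sum.swap)
    have "(\<Sum>l\<in>UNIV. \<Sum>i\<in>UNIV. \<Sum>j\<in>UNIV. dG i $ j $ l * u $ i * v $ j * y $ l) = v \<bullet> (D u *v y)"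
      unfolding D by (subst rot, subst rot) (rule refl)
    moreover have "(\<Sum>l\<in>UNIV. \<Sum>i\<in>UNIV. \<Sum>j\<in>UNIV. dG j $ i $ l * u $ i * v $ j * y $ l) = u \<bullet> (D v *v y)"
      unfolding D by (subst sum.swap) (intro sum.cong refl, simp add: mult_ac)
    moreover have "(\<Sum>l\<in>UNIV. \<Sum>i\<in>UNIV. \<Sum>j\<in>UNIV. dG l $ i $ j * u $ i * v $ j * y $ l) = u \<bullet> (D y *v v)"
      unfolding D by (subst rot) (intro sum.cong refl, simp add: mult_ac)
    ultimately show ?thesis by simp
  qed
  finally show ?thesis .
qed

lemma inner_transpose: "x \<bullet> (A *v y) = (transpose A *v x) \<bullet> y" for A :: "real^'n^'m"
  using dot_lmul_matrix[of x A y] by simp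

lemma symmetric_matrix_inner:
  fixes A :: "real^'n^'n"
  assumes "transpose A = A" shows "x \<bullet> (A *v y) = y \<bullet> (A *v x)"
  unfolding inner_transpose[of x A y] assms by (rule inner_commute)

lemma transpose_sum_scaleR:
  fixes dG :: "'n \<Rightarrow> real^'n^'n"
  assumes "\<And>i. transpose (dG i) = dG i"
  shows "transpose (\<Sum>i\<in>UNIV. w $ i *\<^sub>R dG i) = (\<Sum>i\<in>UNIV. w $ i *\<^sub>R dG i)"
proof -
  have s: "dG i $ j $ k = dG i $ k $ j" for i j k
    by (rule symmetric_entries[OF assms])
  show ?thesis by (simp add: transpose_def vec_eq_iff s)
qed

lemma gamma_metric:
  fixes G :: "real^'n^'n"
  assumes "det G \<noteq> 0" "transpose G = G" "\<And>i. transpose (dG i) = dG i"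
    and "\<And>w. D w = (\<Sum>i\<in>UNIV. w $ i *\<^sub>R dG i)"
  shows "y \<bullet> (D u *v v) = gamma G dG u y \<bullet> (G *v v) + y \<bullet> (G *v gamma G dG u v)"
proof -
  have sD: "transpose (D w) = D w" for w unfolding assms(4) by (rule transpose_sum_scaleR[OF assms(3)])
  have "gamma G dG u y \<bullet> (G *v v) = v \<bullet> (G *v gamma G dG u y)" by (rule symmetric_matrix_inner[OF assms(2)])
  then show ?thesis
    using gamma_lower[OF assms(1,3,4), of v u y] gamma_lower[OF assms(1,3,4), of y u v]
      symmetric_matrix_inner[OF sD, of v u y] by argo
qed

text \<open>Koszul's formula: a torsion-free metric connection is determined by the metric.\<close>

lemma gamma_unique:
  fixes G :: "real^'n^'n"
  assumes "det G \<noteq> 0" "transpose G = G" "\<And>i. transpose (dG i) = dG i"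
    and "\<And>w. D w = (\<Sum>i\<in>UNIV. w $ i *\<^sub>R dG i)"
    and sym: "\<And>u v. T u v = T v u"
    and met: "\<And>u v y. y \<bullet> (D u *v v) = T u y \<bullet> (G *v v) + y \<bullet> (G *v T u v)"
  shows "T u v = gamma G dG u v"
proof -
  have sD: "transpose (D w) = D w" for w unfolding assms(4) by (rule transpose_sum_scaleR[OF assms(3)])
  have sG: "x \<bullet> (G *v y) = y \<bullet> (G *v x)" for x y by (rule symmetric_matrix_inner[OF assms(2)])
  have "y \<bullet> (G *v (T u v - gamma G dG u v)) = 0" for y
  proof -
    have "y \<bullet> (G *v T u v) = 1/2 * (v \<bullet> (D u *v y) + u \<bullet> (D v *v y) - u \<bullet> (D y *v v))"
      unfolding met[of v u y] met[of u v y] met[of u y v] sym[of v u] sym[of y u] sym[of y v]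
      using sG[of "T u v" y] sG[of v "T u y"] sG[of u "T v y"] by simp
    then show ?thesis using gamma_lower[OF assms(1,3,4), of y u v]
      by (simp add: matrix_vector_mult_diff_distrib inner_diff_right)
  qed
  then have "G *v (T u v - gamma G dG u v) = 0" by (metis inner_eq_zero_iff)
  then have "T u v - gamma G dG u v = 0" by (rule matrix_kernel_det[OF assms(1)])
  then show ?thesis by simp
qed

lemma matrix_linear:
  fixes f :: "real^'n \<Rightarrow> real^'m"
  assumes "linear f" shows "matrix f *v x = f x"
  using assms by (simp add: matrix_works linear_matrix_vector_mul_eq)

text \<open>As matrices, \<open>D u = \<Gamma>\<^sup>T G + G \<Gamma>\<close> by metric compatibility; both summands contribute \<open>det G\<close> times the trace
  of \<open>\<Gamma>\<close> to the derivative of the determinant.\<close>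

lemma gamma_trace:
  fixes G :: "real^'n^'n"
  assumes "det G \<noteq> 0" "transpose G = G" "\<And>i. transpose (dG i) = dG i"
    and "\<And>w. D w = (\<Sum>i\<in>UNIV. w $ i *\<^sub>R dG i)"
  shows "ddet G (D u) = 2 * det G * (\<Sum>a\<in>UNIV. gamma G dG u (axis a 1) $ a)"
proof -
  define \<Gamma> where "\<Gamma> = matrix (gamma G dG u)"
  have lin: "linear (gamma G dG u)" using bilinear_gamma unfolding bilinear_def by blast
  have \<Gamma>: "gamma G dG u v = \<Gamma> *v v" for v unfolding \<Gamma>_def matrix_linear[OF lin] ..
  have "D u = transpose \<Gamma> ** G + G ** \<Gamma>"
  proof -
    have "y \<bullet> (D u *v v) = y \<bullet> ((transpose \<Gamma> ** G + G ** \<Gamma>) *v v)" for y v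
    proof -
      have "(\<Gamma> *v y) \<bullet> (G *v v) = y \<bullet> (transpose \<Gamma> *v (G *v v))"
        by (simp only: inner_transpose[of y] transpose_transpose)
      then show ?thesis
        unfolding gamma_metric[OF assms, of y u v] \<Gamma>
        by (simp add: matrix_vector_mult_add_rdistrib inner_add_right flip: matrix_vector_mul_assoc)
    qed
    then have "D u *v v = (transpose \<Gamma> ** G + G ** \<Gamma>) *v v" for v
      using vector_eq_ldot by blast
    then show ?thesis unfolding matrix_eq[of "D u"] by blast
  qed
  then have "ddet G (D u) = ddet G (transpose \<Gamma> ** G) + ddet G (G ** \<Gamma>)"
    by (simp only: linear_add[OF linear_ddet])
  also have "ddet G (G ** \<Gamma>) = ddet G (transpose \<Gamma> ** G)"
    using ddet_transpose[of G "G ** \<Gamma>"] assms(2) by (simp add: matrix_transpose_mul)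
  finally have "ddet G (D u) = 2 * det G * trace (transpose \<Gamma>)" by (simp add: ddet_left_mult)
  also have "trace (transpose \<Gamma>) = (\<Sum>a\<in>UNIV. gamma G dG u (axis a 1) $ a)"
    by (simp add: trace_def transpose_def \<Gamma>_def matrix_def)
  finally show ?thesis .
qed

section \<open>The Piola identity at a point\<close>

lemma bilinear_trace:
  fixes T :: "real^'n \<Rightarrow> real^'n \<Rightarrow> real" and x y :: "'i \<Rightarrow> real^'n"
  assumes T: "bilinear T"
    and xy: "\<And>a b. (\<Sum>i\<in>I. x i $ a * y i $ b) = (if a = b then D else 0)"
  shows "(\<Sum>i\<in>I. T (x i) (y i)) = D * (\<Sum>j\<in>UNIV. T (axis j 1) (axis j 1))"
proof -
  have expand: "T u v = (\<Sum>a\<in>UNIV. \<Sum>b\<in>UNIV. u $ a * v $ b * T (axis a 1) (axis b 1))" for u v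
  proof -
    have "T u v = T (\<Sum>a\<in>UNIV. u $ a *\<^sub>R axis a 1) (\<Sum>b\<in>UNIV. v $ b *\<^sub>R axis b 1)"
      using basis_expansion[of u] basis_expansion[of v] by (simp add: scalar_mult_eq_scaleR)
    also have "\<dots> = (\<Sum>(a,b)\<in>UNIV \<times> UNIV. T (u $ a *\<^sub>R axis a 1) (v $ b *\<^sub>R axis b 1))"
      using bilinear_sum[OF T, of _ UNIV _ UNIV] by simp
    finally show ?thesis
      using T by (simp add: sum.cartesian_product bilinear_lmul bilinear_rmul mult_ac)
  qed
  have "(\<Sum>i\<in>I. T (x i) (y i)) = (\<Sum>i\<in>I. \<Sum>a\<in>UNIV. \<Sum>b\<in>UNIV. x i $ a * y i $ b * T (axis a 1) (axis b 1))"
    by (intro sum.cong refl expand)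
  also have "\<dots> = (\<Sum>a\<in>UNIV. \<Sum>i\<in>I. \<Sum>b\<in>UNIV. x i $ a * y i $ b * T (axis a 1) (axis b 1))"
    by (rule sum.swap)
  also have "\<dots> = (\<Sum>a\<in>UNIV. \<Sum>b\<in>UNIV. (\<Sum>i\<in>I. x i $ a * y i $ b) * T (axis a 1) (axis b 1))"
    unfolding sum_distrib_right by (intro sum.cong refl sum.swap)
  also have "\<dots> = (\<Sum>a\<in>UNIV. \<Sum>b\<in>UNIV. if a = b then D * T (axis a 1) (axis a 1) else 0)"
    unfolding xy by (intro sum.cong refl) auto
  also have "\<dots> = D * (\<Sum>j\<in>UNIV. T (axis j 1) (axis j 1))"
    by (simp add: sum_distrib_left)
  finally show ?thesis .
qed

lemma inner_axis_1: "x \<bullet> axis j 1 = x $ j" for x :: "real^'n"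
  by (simp add: inner_axis)

lemma linear_matrix: "linear (\<lambda>x. A *v x)" for A :: "real^'n^'m"
  by (rule matrix_vector_mul_linear)

text \<open>
  The data at one point: the metrics \<open>G\<close>, \<open>H\<close> with their derivatives \<open>G'\<close>, \<open>H'\<close> and Christoffel maps, the
  Jacobian matrix \<open>A\<close> with its cofactor matrix \<open>\<kappa>\<close>, the derivative \<open>\<kappa>'\<close> of the latter, the matrix \<open>C\<close> of
  \<open>Cof df\<close> and \<open>R = H C G\<^sup>-\<^sup>1\<close>, the densities \<open>sG\<close>, \<open>sH\<close>, and a frame \<open>e\<close> that is orthonormal for \<open>G\<close>.
  Working with \<open>R\<close>, that is with the lowered index, avoids derivatives of inverse matrices.
\<close>

locale piola_at_point =
  fixes G H A C R \<kappa> :: "real^'n^'n" and G' H' \<kappa>' :: "real^'n \<Rightarrow> real^'n^'n"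
    and \<Gamma>M \<Gamma>N :: "real^'n \<Rightarrow> real^'n \<Rightarrow> real^'n" and sG sH D :: real
    and e :: "nat \<Rightarrow> real^'n" and d :: nat
  assumes bilM: "bilinear \<Gamma>M" and bilN: "bilinear \<Gamma>N"
    and symM: "\<Gamma>M u v = \<Gamma>M v u" and symN: "\<Gamma>N u v = \<Gamma>N v u"
    and metM: "y \<bullet> (G' u *v v) = \<Gamma>M u y \<bullet> (G *v v) + y \<bullet> (G *v \<Gamma>M u v)"
    and metN: "y \<bullet> (H' u *v v) = \<Gamma>N u y \<bullet> (H *v v) + y \<bullet> (H *v \<Gamma>N u v)"
    and symH: "transpose H = H" and detH: "det H \<noteq> 0"
    and sG: "sG \<noteq> 0"
    and HC: "H ** C = R ** G"
    and RS: "sG *\<^sub>R R = sH *\<^sub>R \<kappa>"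
    and cofactor: "(\<Sum>j\<in>UNIV. \<kappa> $ m $ j * A $ a $ j) = (if a = m then D else 0)"
    and piola: "(\<Sum>j\<in>UNIV. \<kappa>' (axis j 1) $ m $ j) = 0"
    and e: "(\<Sum>i<d. e i $ a * (G *v e i) $ b) = (if a = b then 1 else 0)"
begin

definition "trM u = (\<Sum>a\<in>UNIV. \<Gamma>M u (axis a 1) $ a)"
definition "trN u = (\<Sum>a\<in>UNIV. \<Gamma>N u (axis a 1) $ a)"

lemma linear_tr: "linear trM" "linear trN"
  unfolding trM_def[abs_def] trN_def[abs_def]
  by (auto intro!: linearI simp: bilinear_ladd[OF bilM] bilinear_ladd[OF bilN] bilinear_lmul[OF bilM]
      bilinear_lmul[OF bilN] sum.distrib sum_distrib_left)

lemma frame_trace: "bilinear T \<Longrightarrow> (\<Sum>i<d. T (e i) (G *v e i)) = (\<Sum>j\<in>UNIV. T (axis j 1) (axis j 1))"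
  for T :: "real^'n \<Rightarrow> real^'n \<Rightarrow> real"
  using bilinear_trace[where T = T and I = "{..<d}" and x = e and y = "\<lambda>i. G *v e i" and D = 1] e by simp

lemma cofactor_trace:
  fixes T :: "real^'n \<Rightarrow> real^'n \<Rightarrow> real"
  assumes "bilinear T"
  shows "(\<Sum>j\<in>UNIV. T (A *v axis j 1) (\<kappa> *v axis j 1)) = D * (\<Sum>j\<in>UNIV. T (axis j 1) (axis j 1))"
  by (rule bilinear_trace[OF assms])
    (use cofactor in \<open>simp add: matrix_vector_mult_basis column_def mult.commute\<close>)

lemma trace_N: "(\<Sum>j\<in>UNIV. \<Gamma>N (A *v axis j 1) z \<bullet> (\<kappa> *v axis j 1)) = D * trN z"
proof -
  have "bilinear (\<lambda>u b. \<Gamma>N u z \<bullet> b)"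
    unfolding bilinear_def
    by (auto intro!: linearI simp: bilinear_ladd[OF bilN] bilinear_lmul[OF bilN] inner_add_left inner_add_right)
  from cofactor_trace[OF this] show ?thesis by (simp add: trN_def inner_axis_1 symN[of _ z])
qed

lemma trace_trN: "(\<Sum>j\<in>UNIV. trN (A *v axis j 1) * (z \<bullet> (\<kappa> *v axis j 1))) = D * trN z"
proof -
  have "bilinear (\<lambda>u b. trN u * (z \<bullet> b))"
    unfolding bilinear_def
    by (auto intro!: linearI simp: linear_add[OF linear_tr(2)] linear_cmul[OF linear_tr(2)] inner_add_right algebra_simps)
  from cofactor_trace[OF this] have "(\<Sum>j\<in>UNIV. trN (A *v axis j 1) * (z \<bullet> (\<kappa> *v axis j 1))) = D * (\<Sum>j\<in>UNIV. z $ j * trN (axis j 1))"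
    by (simp add: inner_axis_1 mult.commute)
  also have "(\<Sum>j\<in>UNIV. z $ j * trN (axis j 1)) = trN (\<Sum>j\<in>UNIV. z $ j *\<^sub>R axis j 1)"
    by (simp add: linear_sum[OF linear_tr(2)] linear_cmul[OF linear_tr(2)])
  finally show ?thesis using basis_expansion[of z] by (simp add: scalar_mult_eq_scaleR)
qed

lemma piola_trace: "(\<Sum>j\<in>UNIV. z \<bullet> (\<kappa>' (axis j 1) *v axis j 1)) = 0"
proof -
  have "(\<Sum>j\<in>UNIV. z \<bullet> (\<kappa>' (axis j 1) *v axis j 1)) = (\<Sum>j\<in>UNIV. \<Sum>m\<in>UNIV. z $ m * \<kappa>' (axis j 1) $ m $ j)"
    by (simp add: inner_vec_def matrix_vector_mult_basis column_def)
  also have "\<dots> = (\<Sum>m\<in>UNIV. z $ m * (\<Sum>j\<in>UNIV. \<kappa>' (axis j 1) $ m $ j))"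
    unfolding sum_distrib_left by (rule sum.swap)
  finally show ?thesis by (simp add: piola)
qed

lemma scaled_R: "sG * (z \<bullet> (R *v b)) = sH * (z \<bullet> (\<kappa> *v b))"
proof -
  have "z \<bullet> ((sG *\<^sub>R R) *v b) = z \<bullet> ((sH *\<^sub>R \<kappa>) *v b)" using RS by simp
  then show ?thesis by (simp add: scaleR_matrix_vector_assoc[symmetric])
qed

lemma HC_apply: "H *v (C *v v) = R *v (G *v v)"
  using HC by (simp add: matrix_vector_mul_assoc)

text \<open>
  Paired with \<open>H z\<close>, the covariant derivative of \<open>C\<close> becomes a bilinear form \<open>T u (G v)\<close> in which only \<open>R'\<close> and
  the Christoffel maps occur.  Over an orthonormal frame \<open>T\<close> has the same trace as over the coordinate
  frame.  There \<open>R'\<close> is known from differentiating \<open>sG R = sH \<kappa>\<close>, \<open>\<kappa>'\<close> drops out by the Euclidean Piola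
  identity, and the Christoffel terms of each metric cancel.
\<close>

lemma divergence_zero:
  fixes C' R' :: "real^'n \<Rightarrow> real^'n^'n"
  assumes HC': "\<And>u. H' (A *v u) ** C + H ** C' u = R' u ** G + R ** G' u"
    and linR': "linear R'"
    and RS': "\<And>u. (sG * trM u) *\<^sub>R R + sG *\<^sub>R R' u = (sH * trN (A *v u)) *\<^sub>R \<kappa> + sH *\<^sub>R \<kappa>' u"
  shows "(\<Sum>i<d. C' (e i) *v e i + \<Gamma>N (A *v e i) (C *v e i) - C *v \<Gamma>M (e i) (e i)) = 0" (is "?S = 0")
proof -
  have "z \<bullet> (H *v ?S) = 0" for z
  proof -
    define y where "y = transpose R *v z"
    have y: "z \<bullet> (R *v b) = y \<bullet> b" for b by (simp only: y_def inner_transpose)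
    define T where "T u b = z \<bullet> (R' u *v b) + \<Gamma>M u y \<bullet> b - \<Gamma>N (A *v u) z \<bullet> (R *v b)" for u b
    have step1: "z \<bullet> (H *v (C' u *v v + \<Gamma>N (A *v u) (C *v v) - C *v \<Gamma>M u v)) = T u (G *v v)" for u v
    proof -
      have "z \<bullet> ((H' (A *v u) ** C + H ** C' u) *v v) = z \<bullet> ((R' u ** G + R ** G' u) *v v)"
        by (simp only: HC')
      then have "z \<bullet> (H' (A *v u) *v (C *v v)) + z \<bullet> (H *v (C' u *v v)) =
          z \<bullet> (R' u *v (G *v v)) + z \<bullet> (R *v (G' u *v v))"
        by (simp only: matrix_vector_mult_add_rdistrib inner_add_right matrix_vector_mul_assoc)
      moreover have "z \<bullet> (R *v (G' u *v v)) = \<Gamma>M u y \<bullet> (G *v v) + z \<bullet> (R *v (G *v \<Gamma>M u v))"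
        unfolding y by (rule metM)
      moreover have "z \<bullet> (H' (A *v u) *v (C *v v)) = \<Gamma>N (A *v u) z \<bullet> (R *v (G *v v)) + z \<bullet> (H *v \<Gamma>N (A *v u) (C *v v))"
        unfolding HC_apply[symmetric] by (rule metN)
      moreover have "z \<bullet> (H *v (C' u *v v + \<Gamma>N (A *v u) (C *v v) - C *v \<Gamma>M u v)) =
        z \<bullet> (H *v (C' u *v v)) + z \<bullet> (H *v \<Gamma>N (A *v u) (C *v v)) - z \<bullet> (R *v (G *v \<Gamma>M u v))"
        by (simp only: matrix_vector_mult_diff_distrib matrix_vector_right_distrib inner_diff_right inner_add_right HC_apply)
      ultimately show ?thesis unfolding T_def by linarith
    qed
    have "bilinear T"
      unfolding bilinear_def T_def
      by (auto intro!: linearI simp: bilinear_ladd[OF bilM] bilinear_lmul[OF bilM]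
          bilinear_ladd[OF bilN] bilinear_lmul[OF bilN] linear_add[OF linR'] linear_cmul[OF linR'] inner_add_left
          inner_add_right matrix_vector_right_distrib matrix_vector_mult_scaleR matrix_vector_mult_add_rdistrib
          scaleR_matrix_vector_assoc[symmetric] algebra_simps)
    have "z \<bullet> (H *v ?S) = (\<Sum>i<d. T (e i) (G *v e i))"
      by (simp add: linear_sum[OF linear_matrix] inner_sum_right step1)
    also have "\<dots> = (\<Sum>j\<in>UNIV. T (axis j 1) (axis j 1))" by (rule frame_trace[OF \<open>bilinear T\<close>])
    also have "\<dots> = (\<Sum>j\<in>UNIV. z \<bullet> (R' (axis j 1) *v axis j 1)) + trM y - (\<Sum>j\<in>UNIV. \<Gamma>N (A *v axis j 1) z \<bullet> (R *v axis j 1))"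
      (is "_ = ?P + _ - ?Q")
      by (simp add: T_def sum.distrib sum_subtractf inner_axis_1 symM[of _ y] trM_def)
    finally have S: "z \<bullet> (H *v ?S) = ?P + trM y - ?Q" .
    have "sG * ?Q = sH * (D * trN z)"
      unfolding sum_distrib_left scaled_R trace_N[symmetric] by simp
    moreover have "sG * trM y + sG * ?P = sH * (D * trN z)"
    proof -
      have "(sG * trM (axis j 1)) * y $ j + sG * (z \<bullet> (R' (axis j 1) *v axis j 1)) =
         sH * (trN (A *v axis j 1) * (z \<bullet> (\<kappa> *v axis j 1))) + sH * (z \<bullet> (\<kappa>' (axis j 1) *v axis j 1))" for j
      proof -
        have "z \<bullet> (((sG * trM (axis j 1)) *\<^sub>R R + sG *\<^sub>R R' (axis j 1)) *v axis j 1) =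
          z \<bullet> (((sH * trN (A *v axis j 1)) *\<^sub>R \<kappa> + sH *\<^sub>R \<kappa>' (axis j 1)) *v axis j 1)"
          by (simp only: RS')
        then show ?thesis
          by (simp only: matrix_vector_mult_add_rdistrib scaleR_matrix_vector_assoc[symmetric]
              inner_add_right inner_scaleR_right y inner_axis_1 mult.assoc)
      qed
      then have "(\<Sum>j\<in>UNIV. (sG * trM (axis j 1)) * y $ j + sG * (z \<bullet> (R' (axis j 1) *v axis j 1))) =
         (\<Sum>j\<in>UNIV. sH * (trN (A *v axis j 1) * (z \<bullet> (\<kappa> *v axis j 1))) + sH * (z \<bullet> (\<kappa>' (axis j 1) *v axis j 1)))"
        by (intro sum.cong refl)
      then have "sG * (\<Sum>j\<in>UNIV. y $ j * trM (axis j 1)) + sG * ?P = sH * (D * trN z)"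
        unfolding sum.distrib sum_distrib_left[symmetric] trace_trN piola_trace
        by (simp add: sum_distrib_left mult_ac)
      moreover have "(\<Sum>j\<in>UNIV. y $ j * trM (axis j 1)) = trM (\<Sum>j\<in>UNIV. y $ j *\<^sub>R axis j 1)"
        by (simp add: linear_sum[OF linear_tr(1)] linear_cmul[OF linear_tr(1)])
      ultimately show ?thesis using basis_expansion[of y] by (simp add: scalar_mult_eq_scaleR)
    qed
    ultimately have "sG * (?P + trM y - ?Q) = 0" by (simp add: algebra_simps)
    then show ?thesis using S sG by simp
  qed
  from this[of "H *v ?S"] have "H *v ?S = 0" by (simp only: inner_eq_zero_iff)
  then show ?thesis by (rule matrix_kernel_det[OF detH])
qed

text \<open>By the trace lemmas, \<open>\<Gamma>N\<close> in the covariant derivative of \<open>\<xi>\<close> contributes the derivative of \<open>sH\<close>, and the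
  term with \<open>\<kappa>'\<close> vanishes.  The right-hand side is the divergence of \<open>sH \<kappa>\<^sup>T \<xi>\<close>.\<close>

lemma weighted_integrand:
  fixes \<xi> :: "real^'n" and \<xi>' :: "real^'n \<Rightarrow> real^'n"
  assumes "linear \<xi>'"
  shows "sG * (\<Sum>i<d. (C *v e i) \<bullet> (H *v (\<xi>' (e i) + \<Gamma>N (A *v e i) \<xi>))) =
    (\<Sum>j\<in>UNIV. (sH * trN (A *v axis j 1)) * (\<xi> \<bullet> (\<kappa> *v axis j 1)) + sH * (\<xi> \<bullet> (\<kappa>' (axis j 1) *v axis j 1)) +
      sH * (\<xi>' (axis j 1) \<bullet> (\<kappa> *v axis j 1)))"
proof -
  define T where "T u b = (\<xi>' u + \<Gamma>N (A *v u) \<xi>) \<bullet> (R *v b)" for u b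
  have T: "(C *v v) \<bullet> (H *v (\<xi>' u + \<Gamma>N (A *v u) \<xi>)) = T u (G *v v)" for u v
    unfolding T_def HC_apply[symmetric] by (rule symmetric_matrix_inner[OF symH])
  have "bilinear T"
    unfolding bilinear_def T_def
    by (auto intro!: linearI simp: bilinear_ladd[OF bilN] bilinear_lmul[OF bilN] linear_add[OF assms]
        linear_cmul[OF assms] inner_add_left
        inner_add_right matrix_vector_right_distrib matrix_vector_mult_scaleR algebra_simps)
  have "sG * (\<Sum>i<d. (C *v e i) \<bullet> (H *v (\<xi>' (e i) + \<Gamma>N (A *v e i) \<xi>))) = sG * (\<Sum>j\<in>UNIV. T (axis j 1) (axis j 1))"
    unfolding T frame_trace[OF \<open>bilinear T\<close>] ..
  also have "\<dots> = (\<Sum>j\<in>UNIV. sH * (\<xi>' (axis j 1) \<bullet> (\<kappa> *v axis j 1)) + sH * (\<Gamma>N (A *v axis j 1) \<xi> \<bullet> (\<kappa> *v axis j 1)))"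
    unfolding sum_distrib_left T_def scaled_R by (simp add: inner_add_left distrib_left)
  also have "\<dots> = (\<Sum>j\<in>UNIV. sH * (\<xi>' (axis j 1) \<bullet> (\<kappa> *v axis j 1))) + sH * (D * trN \<xi>)"
    unfolding sum.distrib trace_N[symmetric] by (simp add: sum_distrib_left)
  also have "sH * (D * trN \<xi>) = (\<Sum>j\<in>UNIV. (sH * trN (A *v axis j 1)) * (\<xi> \<bullet> (\<kappa> *v axis j 1)))
      + (\<Sum>j\<in>UNIV. sH * (\<xi> \<bullet> (\<kappa>' (axis j 1) *v axis j 1)))"
    unfolding sum_distrib_left[symmetric] piola_trace trace_trN[symmetric]
    by (simp add: sum_distrib_left mult.assoc)
  finally show ?thesis by (simp add: sum.distrib)
qed

end

section \<open>Manifolds in coordinates\<close>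

lemma Ck_on_SucD:
  assumes "Ck_on (Suc k) S f"
  shows "x \<in> S \<Longrightarrow> (f has_derivative frechet_derivative f (at x)) (at x)"
    and "Ck_on k S (\<lambda>x. frechet_derivative f (at x) v)"
  using assms by (auto simp: frechet_derivative_works)

lemma smooth_on_has_derivative:
  "smooth_on S f \<Longrightarrow> x \<in> S \<Longrightarrow> (f has_derivative frechet_derivative f (at x)) (at x)"
  using Ck_on_SucD(1)[of 0 S f x] by (simp only: smooth_on_def)

lemma symmetric_frechet_derivative:
  fixes f :: "'a::real_normed_vector \<Rightarrow> 'b::euclidean_space"
  assumes "open S" "Ck_on 2 S f" "x \<in> S"
  shows "frechet_derivative (\<lambda>y. frechet_derivative f (at y) u) (at x) v =
    frechet_derivative (\<lambda>y. frechet_derivative f (at y) v) (at x) u"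
proof -
  have C: "Ck_on (Suc (Suc 0)) S f" using assms(2) by (simp add: numeral_2_eq_2)
  note C' = Ck_on_SucD(2)[OF C]
  show ?thesis
    by (rule second_derivative_symmetric[OF assms(1,3), of f "\<lambda>y. frechet_derivative f (at y)"
          "\<lambda>w y. frechet_derivative (\<lambda>y. frechet_derivative f (at y) w) (at y)"])
      (use Ck_on_SucD(1)[OF C] Ck_on_SucD[OF C'] in auto)
qed

locale manifold =
  fixes M :: "('a, 'n::{finite,linorder}) manifold"
  assumes manifold: "oriented_smooth_manifold M"
begin

lemma chart_open: "c \<in> atlas M \<Longrightarrow> openin (mtop M) (fst c)"
  and image_open: "c \<in> atlas M \<Longrightarrow> open (snd c ` fst c)"
  and chart_homeomorphic: "c \<in> atlas M \<Longrightarrow>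
    homeomorphic_map (subtopology (mtop M) (fst c)) (top_of_set (snd c ` fst c)) (snd c)"
  and charts_cover: "(\<Union>c\<in>atlas M. fst c) = points M"
  and transition_smooth: "c \<in> atlas M \<Longrightarrow> c' \<in> atlas M \<Longrightarrow>
    smooth_on (snd c ` (fst c \<inter> fst c')) (transition c c')"
  and hausdorff: "Hausdorff_space (mtop M)" and second_countable: "second_countable (mtop M)"
  using manifold by (auto simp: oriented_smooth_manifold_def)

lemma transition_det: "c \<in> charts_at M p \<Longrightarrow> c' \<in> charts_at M p \<Longrightarrow>
    det (matrix (frechet_derivative (transition c c') (at (snd c p)))) > 0"
  using manifold by (auto simp: oriented_smooth_manifold_def charts_at_def)

lemma charts_at_iff: "c \<in> charts_at M p \<longleftrightarrow> c \<in> atlas M \<and> p \<in> fst c"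
  by (simp add: charts_at_def)

lemma chart_at_exists: "p \<in> points M \<Longrightarrow> \<exists>c. c \<in> charts_at M p"
  unfolding charts_at_def using charts_cover by blast

lemma chart_subset: "c \<in> atlas M \<Longrightarrow> fst c \<subseteq> points M"
  using charts_cover by blast

lemma charts_atD:
  assumes "c \<in> charts_at M p" shows "p \<in> points M" "c \<in> atlas M" "p \<in> fst c"
  using assms chart_subset unfolding charts_at_def by blast+

lemma chart_topspace: "c \<in> atlas M \<Longrightarrow> topspace (subtopology (mtop M) (fst c)) = fst c"
  using chart_subset[of c] unfolding topspace_subtopology by blast

lemma chart_inj: "c \<in> atlas M \<Longrightarrow> inj_on (snd c) (fst c)"
  using homeomorphic_imp_injective_map[OF chart_homeomorphic] chart_topspace by metis

lemma chart_inv_left [simp]: "c \<in> atlas M \<Longrightarrow> q \<in> fst c \<Longrightarrow> chart_inv c (snd c q) = q"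
  using chart_inj by (simp add: chart_inv_def)

lemma chart_image_open:
  assumes "c \<in> atlas M" "openin (mtop M) U"
  shows "open (snd c ` (fst c \<inter> U))"
proof -
  have "openin (subtopology (mtop M) (fst c)) (fst c \<inter> U)"
    using openin_subtopology_Int2[OF assms(2)] .
  then have "openin (top_of_set (snd c ` fst c)) (snd c ` (fst c \<inter> U))"
    using homeomorphic_imp_open_map[OF chart_homeomorphic[OF assms(1)]] by (simp add: open_map_def)
  then show ?thesis using image_open[OF assms(1)] openin_open_eq by blast
qed

lemma chart_preimage_open:
  assumes c: "c \<in> atlas M" and S: "open S" shows "openin (mtop M) {q \<in> fst c. snd c q \<in> S}"
proof -
  have "openin (top_of_set (snd c ` fst c)) (snd c ` fst c \<inter> S)" using S by (rule openin_open_Int)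
  then have "openin (subtopology (mtop M) (fst c)) {q \<in> fst c. snd c q \<in> snd c ` fst c \<inter> S}"
    using openin_continuous_map_preimage[OF homeomorphic_imp_continuous_map[OF chart_homeomorphic[OF c]]]
    unfolding chart_topspace[OF c] by blast
  then have "openin (mtop M) {q \<in> fst c. snd c q \<in> snd c ` fst c \<inter> S}"
    using openin_open_subtopology[OF chart_open[OF c]] by blast
  moreover have "{q \<in> fst c. snd c q \<in> snd c ` fst c \<inter> S} = {q \<in> fst c. snd c q \<in> S}" by blast
  ultimately show ?thesis by simp
qed

lemma overlap_open: "c \<in> atlas M \<Longrightarrow> c' \<in> atlas M \<Longrightarrow> open (snd c ` (fst c \<inter> fst c'))"
  using chart_image_open chart_open by blast

lemma transition_has_derivative:
  assumes "c \<in> charts_at M p" "c' \<in> charts_at M p"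
  shows "(transition c c' has_derivative frechet_derivative (transition c c') (at (snd c p))) (at (snd c p))"
  using smooth_on_has_derivative[OF transition_smooth] assms by (simp add: charts_at_iff)

lemma linear_transition:
  assumes "c \<in> charts_at M p" "c' \<in> charts_at M p"
  shows "linear (frechet_derivative (transition c c') (at (snd c p)))"
  using has_derivative_linear[OF transition_has_derivative[OF assms]] .

lemma transition_point [simp]: "c \<in> atlas M \<Longrightarrow> q \<in> fst c \<Longrightarrow> transition c c' (snd c q) = snd c' q"
  by (simp add: transition_def)

lemma transition_cocycle:
  assumes "c \<in> charts_at M p" "c' \<in> charts_at M p" "c'' \<in> charts_at M p"
  shows "frechet_derivative (transition c' c'') (at (snd c' p)) (frechet_derivative (transition c c') (at (snd c p)) v) =
    frechet_derivative (transition c c'') (at (snd c p)) v"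
proof -
  let ?D = "\<lambda>c c'. frechet_derivative (transition c c') (at (snd c p))"
  have a: "c \<in> atlas M" "p \<in> fst c" "c' \<in> atlas M" "p \<in> fst c'" "c'' \<in> atlas M" "p \<in> fst c''"
    using assms by (auto simp: charts_at_iff)
  let ?S = "snd c ` (fst c \<inter> (fst c' \<inter> fst c''))"
  have "((\<lambda>x. transition c' c'' (transition c c' x)) has_derivative (\<lambda>v. ?D c' c'' (?D c c' v))) (at (snd c p))"
    using has_derivative_compose[OF transition_has_derivative[OF assms(1,2)], of "transition c' c''" "?D c' c''"]
      transition_has_derivative[OF assms(2,3)] a by simp
  then have "(transition c c'' has_derivative (\<lambda>v. ?D c' c'' (?D c c' v))) (at (snd c p))"
    by (rule has_derivative_transform_within_open[of _ _ _ _ ?S])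
      (use a in \<open>auto intro!: chart_image_open openin_Int chart_open simp: transition_def\<close>)
  then have "(\<lambda>v. ?D c' c'' (?D c c' v)) = ?D c c''" by (rule frechet_derivative_at)
  then show ?thesis by (rule fun_cong)
qed

lemma transition_self:
  assumes "c \<in> charts_at M p"
  shows "frechet_derivative (transition c c) (at (snd c p)) v = v"
proof -
  have a: "c \<in> atlas M" "p \<in> fst c" using assms by (auto simp: charts_at_iff)
  have "((\<lambda>x. x) has_derivative (\<lambda>v. v)) (at (snd c p))" by (rule has_derivative_ident)
  then have "(transition c c has_derivative (\<lambda>v. v)) (at (snd c p))"
    by (rule has_derivative_transform_within_open[of _ _ _ _ "snd c ` fst c"])
      (use a image_open in \<open>auto simp: transition_def\<close>)
  then have "(\<lambda>v. v) = frechet_derivative (transition c c) (at (snd c p))" by (rule frechet_derivative_at)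
  then show ?thesis by (metis)
qed

lemma tangentD:
  assumes "v \<in> tangent_space M p" "c \<in> charts_at M p" "c' \<in> charts_at M p"
  shows "v c' = frechet_derivative (transition c c') (at (snd c p)) (v c)"
  using assms unfolding tangent_space_def mem_Collect_eq by blast

lemma tangent_off: "v \<in> tangent_space M p \<Longrightarrow> c \<notin> charts_at M p \<Longrightarrow> v c = 0"
  unfolding tangent_space_def mem_Collect_eq by blast

lemma tangent_ext:
  assumes "v \<in> tangent_space M p" "w \<in> tangent_space M p" "c \<in> charts_at M p" "v c = w c"
  shows "v = w"
proof
  fix c'
  show "v c' = w c'"
  proof (cases "c' \<in> charts_at M p")
    case True
    then show ?thesis using tangentD[OF assms(1,3)] tangentD[OF assms(2,3)] assms(4) by simp
  next
    case False
    then show ?thesis using tangent_off[OF assms(1)] tangent_off[OF assms(2)] by simp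
  qed
qed

lemma coord_vec_tangent:
  assumes "c \<in> charts_at M p" shows "coord_vec M c p w \<in> tangent_space M p"
  using transition_cocycle[OF assms] by (auto simp: coord_vec_def tangent_space_def)

lemma coord_vec_self [simp]: "c \<in> charts_at M p \<Longrightarrow> coord_vec M c p w c = w"
  by (simp add: coord_vec_def transition_self)

lemma coord_vec_coords:
  assumes "c \<in> charts_at M p" "v \<in> tangent_space M p" shows "coord_vec M c p (v c) = v"
  by (rule tangent_ext[OF coord_vec_tangent assms(2,1)]) (use assms in auto)

lemma linear_coord_vec: assumes "c \<in> charts_at M p" shows "linear (coord_vec M c p)"
  by (rule linearI)
    (auto simp: coord_vec_def fun_eq_iff scaleR_fun_def linear_add[OF linear_transition[OF assms]]
      linear_cmul[OF linear_transition[OF assms]])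

lemma tangent_space_image:
  assumes "c \<in> charts_at M p" shows "tangent_space M p = range (coord_vec M c p)"
  using coord_vec_coords[OF assms, symmetric] coord_vec_tangent[OF assms] by blast

lemma subspace_tangent: assumes "c \<in> charts_at M p" shows "subspace (tangent_space M p)"
  unfolding tangent_space_image[OF assms] by (rule linear_subspace_image[OF linear_coord_vec[OF assms]]) simp

lemma dim_tangent:
  assumes "c \<in> charts_at M p" shows "dim (tangent_space M p) = CARD('n)"
proof -
  let ?f = "coord_vec M c p"
  have inj: "inj ?f" by (metis assms coord_vec_self injI)
  have "independent (?f ` Basis)"
    by (rule linear_independent_injective_image[OF linear_coord_vec[OF assms]])
      (auto simp: independent_Basis intro: inj_on_subset[OF inj])
  moreover have "span (?f ` Basis) = span (tangent_space M p)"
    using linear_span_image[OF linear_coord_vec[OF assms], of Basis] subspace_tangent[OF assms]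
      tangent_space_image[OF assms] by (simp add: span_eq_iff[THEN iffD2])
  moreover have "card (?f ` Basis) = CARD('n)"
    using card_image[OF inj_on_subset[OF inj], of Basis] by simp
  ultimately show ?thesis using dim_eq_card by metis
qed

end

locale riemannian = manifold M for M :: "('a, 'n::{finite,linorder}) manifold" +
  assumes riemannian: "oriented_riemannian_manifold M"
begin

lemma metric_smooth: "c \<in> atlas M \<Longrightarrow> smooth_on (snd c ` fst c) (metric_matrix M c)"
  using riemannian by (simp add: oriented_riemannian_manifold_def)

lemma tangent_inner_product: "p \<in> points M \<Longrightarrow> inner_product_on (tangent_space M p) (metric M p)"
  using riemannian by (simp add: oriented_riemannian_manifold_def)

lemma tangent_carrier:
  assumes "p \<in> points M" shows "inner_product_carrier (tangent M p)"
proof -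
  obtain c where "c \<in> charts_at M p" using chart_at_exists[OF assms] by blast
  then show ?thesis using subspace_tangent tangent_inner_product[OF assms]
    by unfold_locales (auto simp: tangent_def)
qed

text \<open>Bilinearity, applied to the coordinate frame.\<close>

lemma metric_coords:
  assumes c: "c \<in> charts_at M p" and v: "v \<in> tangent_space M p" and w: "w \<in> tangent_space M p"
  shows "metric M p v w = v c \<bullet> (metric_matrix M c (snd c p) *v w c)"
proof -
  have p: "p \<in> points M" "c \<in> atlas M" "p \<in> fst c" using charts_atD[OF c] by simp_all
  interpret T: inner_product_carrier "tangent M p" by (rule tangent_carrier[OF p(1)])
  let ?e = "\<lambda>i. coord_vec M c p (axis i 1)"
  have ip: "ip (tangent M p) = metric M p" "carrier (tangent M p) = tangent_space M p" by (auto simp: tangent_def)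
  have e: "?e i \<in> tangent_space M p" for i by (rule coord_vec_tangent[OF c])
  have expand: "u = (\<Sum>i\<in>UNIV. u c $ i *\<^sub>R ?e i)" if "u \<in> tangent_space M p" for u
  proof -
    have "u = coord_vec M c p (\<Sum>i\<in>UNIV. u c $ i *\<^sub>R axis i 1)"
      using coord_vec_coords[OF c that] basis_expansion[of "u c"] by (simp add: scalar_mult_eq_scaleR)
    then show ?thesis by (simp add: linear_sum[OF linear_coord_vec[OF c]] linear_cmul[OF linear_coord_vec[OF c]])
  qed
  have "metric M p v w = (\<Sum>i\<in>UNIV. v c $ i * metric M p (?e i) w)"
    using T.ip_sum_left[of w UNIV ?e "\<lambda>i. v c $ i"] expand[OF v] w e unfolding ip by simp
  also have "\<dots> = (\<Sum>i\<in>UNIV. v c $ i * (\<Sum>j\<in>UNIV. w c $ j * metric M p (?e i) (?e j)))"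
  proof (rule sum.cong)
    fix i
    show "v c $ i * metric M p (?e i) w = v c $ i * (\<Sum>j\<in>UNIV. w c $ j * metric M p (?e i) (?e j))"
      using T.ip_sum_right[of "?e i" UNIV ?e "\<lambda>i. w c $ i"] expand[OF w] e unfolding ip by simp
  qed simp
  also have "\<dots> = v c \<bullet> (metric_matrix M c (snd c p) *v w c)"
    using p by (simp add: inner_vec_def matrix_vector_mult_def metric_matrix_def mult_ac)
  finally show ?thesis .
qed

lemma metric_matrix_symmetric:
  assumes c: "c \<in> charts_at M p"
  shows "transpose (metric_matrix M c (snd c p)) = metric_matrix M c (snd c p)"
proof -
  have p: "p \<in> points M" "c \<in> atlas M" "p \<in> fst c" using charts_atD[OF c] by simp_all
  then show ?thesis
    using tangent_inner_product[OF p(1)] coord_vec_tangent[OF c]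
    by (simp add: metric_matrix_def Let_def transpose_def vec_eq_iff inner_product_on_def)
qed

lemma metric_matrix_pos:
  assumes c: "c \<in> charts_at M p" and w: "w \<noteq> 0"
  shows "w \<bullet> (metric_matrix M c (snd c p) *v w) > 0"
proof -
  have p: "p \<in> points M" using charts_atD[OF c] by simp_all
  let ?v = "coord_vec M c p w"
  have "?v \<noteq> 0" using w coord_vec_self[OF c, of w] by auto
  then have "metric M p ?v ?v > 0"
    using tangent_inner_product[OF p] coord_vec_tangent[OF c] by (simp add: inner_product_on_def)
  then show ?thesis using metric_coords[OF c coord_vec_tangent[OF c] coord_vec_tangent[OF c], of w w] c by simp
qed

lemma metric_matrix_nz: "c \<in> charts_at M p \<Longrightarrow> det (metric_matrix M c (snd c p)) \<noteq> 0"
  unfolding invertible_det_nz[symmetric] invertible_left_inverse matrix_left_invertible_ker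
  using metric_matrix_pos by fastforce

definition pos :: "'n \<Rightarrow> nat" where "pos j = card {k. k < j}"

lemma pos_bij: "bij_betw pos UNIV {..<CARD('n)}"
proof (rule bij_betw_imageI)
  have less: "pos i < pos j" if "i < j" for i j
    unfolding pos_def by (rule psubset_card_mono) (use that in auto)
  then show inj: "inj pos" by (metis injI linorder_neq_iff)
  have "pos j < CARD('n)" for j unfolding pos_def by (rule psubset_card_mono) auto
  then show "range pos = {..<CARD('n)}"
    by (intro card_subset_eq) (auto simp: card_image[OF inj])
qed

lemma pos_less [simp]: "pos j < CARD('n)" using pos_bij by (auto simp: bij_betw_def)

lemma pos_eq [simp]: "pos i = pos j \<longleftrightarrow> i = j" using pos_bij by (auto simp: bij_betw_def inj_on_def)

lemma pos_surj: assumes "i < CARD('n)" obtains j where "i = pos j"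
  using pos_bij assms by (metis bij_betw_imp_surj_on imageE lessThan_iff)

lemma sum_pos: "(\<Sum>i<CARD('n). f i) = (\<Sum>j\<in>UNIV. f (pos j))"
  using sum.reindex_bij_betw[OF pos_bij, of f] by simp

definition frame :: "('a,'n) chart \<Rightarrow> ('a,'n) tvec list \<Rightarrow> 'n rmat"
  where "frame c vs = (\<chi> i j. (vs ! pos j) c $ i)"

definition vol :: "('a,'n) chart \<Rightarrow> 'a \<Rightarrow> ('a,'n) tvec list \<Rightarrow> real"
  where "vol c p vs = sqrt (det (metric_matrix M c (snd c p))) * det (frame c vs)"

lemma frame_update:
  assumes "length vs = CARD('n)"
  shows "transpose (frame c (vs[pos j := u])) = (\<chi> k. if k = j then u c else transpose (frame c vs) $ k)"
  using assms by (auto simp: frame_def transpose_def vec_eq_iff nth_list_update)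

lemma det_frame_update:
  assumes "length vs = CARD('n)"
  shows "det (frame c (vs[pos j := u])) = det (\<chi> k. if k = j then u c else transpose (frame c vs) $ k)"
  unfolding frame_update[OF assms, symmetric] by simp

lemma vol_alt: "vol c p \<in> alt_forms (tangent M p) (CARD('n))"
  unfolding alt_forms_def mem_Collect_eq
proof (intro allI impI conjI ballI)
  fix vs i u v a b assume vs: "length vs = CARD('n) \<and> set vs \<subseteq> carrier (tangent M p)" and i: "i < CARD('n)"
  obtain j where j: "i = pos j" using pos_surj[OF i] .
  have lin: "det (\<chi> k. if k = j then a *s u c + b *s v c else transpose (frame c vs) $ k) =
     a * det (\<chi> k. if k = j then u c else transpose (frame c vs) $ k) + b * det (\<chi> k. if k = j then v c else transpose (frame c vs) $ k)"
    by (simp add: det_row_add det_row_mul)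
  have eq: "(a *\<^sub>R u + b *\<^sub>R v) c = a *s u c + b *s v c" by (simp add: scaleR_fun_def scalar_mult_eq_scaleR)
  show "vol c p (vs[i := a *\<^sub>R u + b *\<^sub>R v]) = a * vol c p (vs[i := u]) + b * vol c p (vs[i := v])"
    unfolding vol_def j det_frame_update[OF conjunct1[OF vs]] eq lin
    by (simp only: distrib_left mult.left_commute)
next
  fix vs i j assume vs: "length vs = CARD('n) \<and> set vs \<subseteq> carrier (tangent M p)"
    "i < CARD('n)" "j < CARD('n)" "i \<noteq> j \<and> vs ! i = vs ! j"
  obtain k l where "i = pos k" "j = pos l" using pos_surj vs by metis
  then have "det (frame c vs) = 0"
    using vs by (intro det_identical_columns[of k l]) (auto simp: column_def frame_def vec_eq_iff)
  then show "vol c p vs = 0" by (simp add: vol_def)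
qed

text \<open>Orthonormality as a matrix identity.  It implies that the determinant of the metric matrix is
  positive.\<close>

lemma frame_gram:
  assumes c: "c \<in> charts_at M p" and e: "orthonormal_basis (tangent M p) e"
  shows "transpose (frame c e) ** (metric_matrix M c (snd c p) ** frame c e) = mat 1"
proof -
  have d: "vdim (tangent M p) = CARD('n)" using dim_tangent[OF c] by (simp add: vdim_def tangent_def)
  have in_T: "e ! pos i \<in> tangent_space M p" for i
    using e d by (auto simp: orthonormal_basis_def tangent_def)
  have "(transpose (frame c e) ** (metric_matrix M c (snd c p) ** frame c e)) $ i $ j = mat 1 $ i $ j" for i j
  proof -
    have "(e ! pos i) c \<bullet> (metric_matrix M c (snd c p) *v (e ! pos j) c) = (if i = j then 1 else 0)"
      unfolding metric_coords[OF c in_T in_T, symmetric]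
      using e d by (auto simp: orthonormal_basis_def tangent_def)
    then show ?thesis
      by (simp add: matrix_matrix_mult_def transpose_def frame_def mat_def inner_vec_def matrix_vector_mult_def)
  qed
  then show ?thesis by (simp add: vec_eq_iff)
qed

lemma det_frame:
  assumes c: "c \<in> charts_at M p" and e: "orthonormal_basis (tangent M p) e"
  shows "det (frame c e) * det (frame c e) * det (metric_matrix M c (snd c p)) = 1"
  using arg_cong[OF frame_gram[OF assms], of det] by (simp add: det_mul mult_ac)

lemma frame_change:
  assumes c: "c \<in> charts_at M p" "c' \<in> charts_at M p" and e: "set e \<subseteq> tangent_space M p" "length e = CARD('n)"
  shows "det (frame c' e) = det (matrix (frechet_derivative (transition c c') (at (snd c p)))) * det (frame c e)"
proof -
  let ?D = "frechet_derivative (transition c c') (at (snd c p))"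
  have "frame c' e = matrix ?D ** frame c e"
  proof -
    have "frame c' e $ i $ j = (matrix ?D ** frame c e) $ i $ j" for i j
    proof -
      have "e ! pos j \<in> tangent_space M p" using e by auto
      then have "(e ! pos j) c' = matrix ?D *v (e ! pos j) c"
        using tangentD[OF _ c] matrix_linear[OF linear_transition[OF c]] by metis
      then show ?thesis by (simp add: frame_def matrix_matrix_mult_def matrix_vector_mult_def)
    qed
    then show ?thesis by (simp add: vec_eq_iff)
  qed
  then show ?thesis by (simp add: det_mul)
qed

end

text \<open>Gram--Schmidt: an orthonormal list shorter than the dimension does not span, and a vector outside its
  span gives one more member.\<close>

lemma (in inner_product_carrier) orthonormal_exists:
  assumes "0 < vdim V" shows "\<exists>e. orthonormal_basis V e"
proof -
  have "\<exists>e. length e = k \<and> set e \<subseteq> carrier V \<and> (\<forall>i<k. \<forall>j<k. ip V (e ! i) (e ! j) = (if i = j then 1 else 0))"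
    if "k \<le> vdim V" for k
    using that
  proof (induction k)
    case (Suc k)
    then obtain e where e: "length e = k" "set e \<subseteq> carrier V"
      and on: "\<And>i j. i < k \<Longrightarrow> j < k \<Longrightarrow> ip V (e ! i) (e ! j) = (if i = j then 1 else 0)" by auto
    have "\<not> carrier V \<subseteq> span (set e)"
    proof
      assume "carrier V \<subseteq> span (set e)"
      then have "dim (carrier V) \<le> card (set e)" by (intro dim_le_card) auto
      then show False using Suc.prems card_length[of e] e(1) by (simp add: vdim_def)
    qed
    then obtain x where x: "x \<in> carrier V" "x \<notin> span (set e)" by blast
    define s where "s = (\<Sum>i<k. ip V x (e ! i) *\<^sub>R e ! i)"
    have ei: "e ! i \<in> carrier V" if "i < k" for i using e that by auto
    have s: "s \<in> carrier V" unfolding s_def using ei by (intro sum_carrier scale_carrier) auto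
    have "s \<in> span (set e)"
      unfolding s_def by (rule span_sum, rule span_scale, rule span_base) (use e(1) in auto)
    define y where "y = 1 *\<^sub>R x + (-1) *\<^sub>R s"
    have y: "y \<in> carrier V" unfolding y_def by (intro add_carrier scale_carrier x s)
    have "y \<noteq> 0" using x \<open>s \<in> span (set e)\<close> by (auto simp: y_def)
    then have pos: "ip V y y > 0" using y by (rule ip_pos[rotated])
    have orth: "ip V y (e ! j) = 0" if j: "j < k" for j
    proof -
      have "ip V s (e ! j) = (\<Sum>i<k. ip V x (e ! i) * ip V (e ! i) (e ! j))"
        unfolding s_def using ei j by (intro ip_sum_left) auto
      also have "\<dots> = (\<Sum>i<k. if i = j then ip V x (e ! j) else 0)"
        using on j by (intro sum.cong) auto
      finally have "ip V s (e ! j) = ip V x (e ! j)" using j by simp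
      then show ?thesis unfolding y_def using ip_lin[of x s "e ! j" 1 "-1"] x s ei[OF j] by simp
    qed
    define z where "z = (1 / sqrt (ip V y y)) *\<^sub>R y + 0 *\<^sub>R y"
    have z: "z \<in> carrier V" using y by (simp add: z_def)
    have zl: "ip V z w = (1 / sqrt (ip V y y)) * ip V y w" if "w \<in> carrier V" for w
      unfolding z_def using ip_lin[of y y w "1 / sqrt (ip V y y)" 0] y that by simp
    have zz: "ip V z z = 1"
      using zl[OF z] zl[OF y] ip_sym[OF y z] pos by (simp add: real_sqrt_mult_self flip: real_sqrt_mult)
    have ze: "ip V z (e ! j) = 0" "ip V (e ! j) z = 0" if "j < k" for j
      using zl[OF ei[OF that]] orth[OF that] ip_sym[OF ei[OF that] z] by auto
    have "ip V ((e @ [z]) ! i) ((e @ [z]) ! j) = (if i = j then 1 else 0)" if "i < Suc k" "j < Suc k" for i j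
      using that on zz ze e(1) by (auto simp: nth_append less_Suc_eq)
    then show ?case using e z by (intro exI[of _ "e @ [z]"]) auto
  qed auto
  from this[of "vdim V"] show ?thesis by (auto simp: orthonormal_basis_def)
qed

context riemannian
begin

lemma tangent_orthonormal_exists:
  assumes "p \<in> points M" shows "\<exists>e. orthonormal_basis (tangent M p) e"
proof -
  obtain c where c: "c \<in> charts_at M p" using chart_at_exists[OF assms] by blast
  interpret T: inner_product_carrier "tangent M p" by (rule tangent_carrier[OF assms])
  show ?thesis by (rule T.orthonormal_exists) (use dim_tangent[OF c] in \<open>simp add: vdim_def tangent_def\<close>)
qed

lemma metric_matrix_det_pos:
  assumes c: "c \<in> charts_at M p" shows "det (metric_matrix M c (snd c p)) > 0"
proof -
  have "p \<in> points M" using charts_atD[OF c] by simp_all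
  then obtain e where "orthonormal_basis (tangent M p) e" using tangent_orthonormal_exists by blast
  from det_frame[OF c this] show ?thesis by (smt (verit) mult_nonneg_nonpos zero_le_square)
qed

text \<open>The determinants of the coordinates in different charts differ by positive factors, so one chart decides
  the orientation.  The sign of a basis is corrected by negating its first vector.\<close>

lemma tangent_oriented_space:
  assumes c: "c \<in> charts_at M p" shows "oriented_space (tangent M p) (vol c p)"
proof -
  have p: "p \<in> points M" using charts_atD[OF c] by simp_all
  interpret T: inner_product_carrier "tangent M p" by (rule tangent_carrier[OF p])
  have d: "vdim (tangent M p) = CARD('n)" using dim_tangent[OF c] by (simp add: vdim_def tangent_def)
  have ip: "ip (tangent M p) = metric M p" "carrier (tangent M p) = tangent_space M p" by (auto simp: tangent_def)
  have oriented: "pos_oriented (tangent M p) e \<longleftrightarrow> det (frame c e) > 0" if e: "orthonormal_basis (tangent M p) e" for e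
  proof -
    have e': "length e = CARD('n)" "set e \<subseteq> tangent_space M p" using e d by (auto simp: orthonormal_basis_def ip)
    have "det (frame c' e) > 0 \<longleftrightarrow> det (frame c e) > 0" if "c' \<in> charts_at M p" for c'
      using frame_change[OF c that e'(2,1)] transition_det[OF c that] by (simp add: zero_less_mult_iff)
    then have "(\<forall>c'\<in>charts_at M p. det (frame c' e) > 0) \<longleftrightarrow> det (frame c e) > 0" using c by blast
    moreover have "pos_oriented (tangent M p) e \<longleftrightarrow> (\<forall>c'\<in>charts_at M p. det (frame c' e) > 0)"
      using e' by (simp add: tangent_def frame_def pos_def)
    ultimately show ?thesis by blast
  qed
  show ?thesis
  proof
    show "0 < vdim (tangent M p)" by (simp add: d)
    show "vol c p \<in> alt_forms (tangent M p) (vdim (tangent M p))" unfolding d by (rule vol_alt)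
  next
    fix e assume e: "orthonormal_basis (tangent M p) e" "pos_oriented (tangent M p) e"
    let ?g = "det (metric_matrix M c (snd c p))" and ?f = "det (frame c e)"
    have f: "?f > 0" using oriented e by simp
    have "(sqrt ?g * ?f)\<^sup>2 = 1"
      using det_frame[OF c e(1)] metric_matrix_det_pos[OF c] by (simp add: power_mult_distrib power2_eq_square mult_ac)
    moreover have "sqrt ?g * ?f > 0" using f metric_matrix_det_pos[OF c] by simp
    ultimately show "vol c p e = 1" unfolding vol_def by (simp add: power2_eq_1_iff)
  next
    obtain e where e: "orthonormal_basis (tangent M p) e" using tangent_orthonormal_exists[OF p] by blast
    then have e': "length e = CARD('n)" "set e \<subseteq> tangent_space M p" using d by (auto simp: orthonormal_basis_def ip)
    have nz: "det (frame c e) \<noteq> 0" using det_frame[OF c e] by auto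
    show "\<exists>e. orthonormal_basis (tangent M p) e \<and> pos_oriented (tangent M p) e"
    proof (cases "det (frame c e) > 0")
      case True
      then show ?thesis using e oriented by blast
    next
      case False
      obtain j where j: "0 = pos j" using pos_surj[of 0] by auto
      let ?e = "e[0 := (-1) *\<^sub>R e ! 0 + 0 *\<^sub>R e ! 0]"
      have e0: "e ! i \<in> tangent_space M p" if "i < CARD('n)" for i using e' that by auto
      have on: "metric M p (e ! i) (e ! j) = (if i = j then 1 else 0)" if "i < CARD('n)" "j < CARD('n)" for i j
        using e that d by (auto simp: orthonormal_basis_def ip)
      note lin = T.ip_lin[unfolded ip, of "e ! 0" "e ! 0" _ "-1" 0]
      have z: "(-1) *\<^sub>R e ! 0 + 0 *\<^sub>R e ! 0 \<in> tangent_space M p"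
        using T.add_carrier[OF T.scale_carrier T.scale_carrier, unfolded ip, OF e0 e0, of 0 0 "-1" 0] by simp
      have l: "metric M p ((-1) *\<^sub>R e ! 0 + 0 *\<^sub>R e ! 0) w = - metric M p (e ! 0) w" if "w \<in> tangent_space M p" for w
        using lin[OF e0 e0 that] by simp
      have r: "metric M p w ((-1) *\<^sub>R e ! 0 + 0 *\<^sub>R e ! 0) = - metric M p w (e ! 0)" if "w \<in> tangent_space M p" for w
        using l[OF that] T.ip_sym[unfolded ip, OF z that] T.ip_sym[unfolded ip, OF e0 that, of 0] by simp
      have "orthonormal_basis (tangent M p) ?e"
        unfolding orthonormal_basis_def d ip
      proof (intro conjI allI impI)
        show "length ?e = CARD('n)" using e' by simp
        show "set ?e \<subseteq> tangent_space M p" using e'(2) z set_update_subset_insert[of e 0] by blast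
        fix i k assume "i < CARD('n)" "k < CARD('n)"
        then show "metric M p (?e ! i) (?e ! k) = (if i = k then 1 else 0)"
          using e'(1) on e0 z l r by (auto simp: nth_list_update simp del: scaleR_left.minus)
      qed
      moreover have "det (frame c ?e) = - det (frame c e)"
      proof -
        have "det (frame c ?e) = det (\<chi> k. if k = j then (-1) *s (e ! pos j) c else transpose (frame c e) $ k)"
        proof -
          have "((-1) *\<^sub>R e ! pos j + 0 *\<^sub>R e ! pos j) c = (-1) *s (e ! pos j) c"
            by (simp add: scaleR_fun_def scalar_mult_eq_scaleR)
          then show ?thesis unfolding j det_frame_update[OF e'(1)] by (simp only:)
        qed
        also have "\<dots> = - det (\<chi> k. if k = j then (e ! pos j) c else transpose (frame c e) $ k)"
          by (subst det_row_mul) simp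
        also have "(\<chi> k. if k = j then (e ! pos j) c else transpose (frame c e) $ k) = transpose (frame c e)"
          by (auto simp: vec_eq_iff transpose_def frame_def)
        finally show ?thesis unfolding det_transpose .
      qed
      ultimately show ?thesis using oriented[of ?e] False nz by (intro exI[of _ ?e] conjI) linarith+
    qed
  qed
qed

end

section \<open>Christoffel symbols of a Riemannian manifold\<close>

lemma bounded_bilinear_matrix_vector: "bounded_bilinear (\<lambda>(A :: real^'n^'m) v. A *v v)"
  unfolding bilinear_conv_bounded_bilinear[symmetric] bilinear_def
  by (auto intro!: linearI simp: matrix_vector_mult_add_rdistrib matrix_vector_right_distrib
      matrix_vector_mult_scaleR scaleR_matrix_vector_assoc[symmetric])

lemmas has_derivative_matrix_vector =
  bounded_bilinear.FDERIV[OF bounded_bilinear_matrix_vector]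

text \<open>The product rule for \<open>L y (w y)\<close> when \<open>L\<close> is known only through its values at fixed vectors; expansion
  of \<open>w y\<close> in the standard basis reduces it to sums of products.\<close>

lemma has_derivative_linear_family:
  fixes L :: "'a::real_normed_vector \<Rightarrow> real^'n \<Rightarrow> 'b::real_normed_vector"
  assumes w: "(w has_derivative w') (at x)" and L: "\<And>v. ((\<lambda>y. L y v) has_derivative L2 v) (at x)"
    and S: "open S" "x \<in> S" and lin: "\<And>y. y \<in> S \<Longrightarrow> linear (L y)"
  shows "((\<lambda>y. L y (w y)) has_derivative (\<lambda>h. L x (w' h) + L2 (w x) h)) (at x)"
proof -
  have expand: "L y v = (\<Sum>k\<in>UNIV. v $ k *\<^sub>R L y (axis k 1))" if "y \<in> S" for y v
  proof -
    have "L y v = L y (\<Sum>k\<in>UNIV. v $ k *\<^sub>R axis k 1)"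
      using basis_expansion[of v] by (simp add: scalar_mult_eq_scaleR)
    then show ?thesis by (simp add: linear_sum[OF lin[OF that]] linear_cmul[OF lin[OF that]])
  qed
  have L2: "L2 v h = (\<Sum>k\<in>UNIV. v $ k *\<^sub>R L2 (axis k 1) h)" for v h
  proof -
    have "((\<lambda>y. \<Sum>k\<in>UNIV. v $ k *\<^sub>R L y (axis k 1)) has_derivative (\<lambda>h. \<Sum>k\<in>UNIV. v $ k *\<^sub>R L2 (axis k 1) h)) (at x)"
      by (intro has_derivative_sum has_derivative_scaleR_right L)
    then have "((\<lambda>y. L y v) has_derivative (\<lambda>h. \<Sum>k\<in>UNIV. v $ k *\<^sub>R L2 (axis k 1) h)) (at x)"
      by (rule has_derivative_transform_within_open[OF _ S]) (rule expand[symmetric])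
    from has_derivative_unique[OF this L] show ?thesis by metis
  qed
  have wk: "((\<lambda>y. w y $ k) has_derivative (\<lambda>h. w' h $ k)) (at x)" for k
    by (rule bounded_linear.has_derivative[OF bounded_linear_vec_nth w])
  have "((\<lambda>y. \<Sum>k\<in>UNIV. w y $ k *\<^sub>R L y (axis k 1)) has_derivative
      (\<lambda>h. \<Sum>k\<in>UNIV. w x $ k *\<^sub>R L2 (axis k 1) h + w' h $ k *\<^sub>R L x (axis k 1))) (at x)"
    by (intro has_derivative_sum has_derivative_scaleR L wk)
  then have "((\<lambda>y. L y (w y)) has_derivative
      (\<lambda>h. \<Sum>k\<in>UNIV. w x $ k *\<^sub>R L2 (axis k 1) h + w' h $ k *\<^sub>R L x (axis k 1))) (at x)"
    by (rule has_derivative_transform_within_open[OF _ S]) (rule expand[symmetric])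
  then show ?thesis
    by (rule has_derivative_eq_rhs)
      (simp add: fun_eq_iff sum.distrib expand[OF S(2), of "w' _"] L2[of "w x"] add.commute)
qed

lemma Ck_on_linear_frechet:
  assumes "Ck_on (Suc k) S f" "x \<in> S" shows "linear (frechet_derivative f (at x))"
  using has_derivative_linear[OF Ck_on_SucD(1)[OF assms]] .

context riemannian
begin

abbreviation (input) "dmetric c x \<equiv> frechet_derivative (metric_matrix M c) (at x)"

lemma christoffel_gamma:
  "christoffel_map M c x = gamma (metric_matrix M c x) (\<lambda>i. dmetric c x (axis i 1))"
  by (simp add: fun_eq_iff christoffel_map_def christoffel_def gamma_def Let_def)

lemma metric_has_derivative:
  assumes "c \<in> charts_at M p"
  shows "(metric_matrix M c has_derivative dmetric c (snd c p)) (at (snd c p))"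
  using smooth_on_has_derivative[OF metric_smooth] charts_atD[OF assms] by simp

lemma dmetric_sum:
  assumes "c \<in> charts_at M p"
  shows "dmetric c (snd c p) w = (\<Sum>i\<in>UNIV. w $ i *\<^sub>R dmetric c (snd c p) (axis i 1))"
proof -
  note lin = has_derivative_linear[OF metric_has_derivative[OF assms]]
  have "dmetric c (snd c p) w = dmetric c (snd c p) (\<Sum>i\<in>UNIV. w $ i *\<^sub>R axis i 1)"
    using basis_expansion[of w] by (simp add: scalar_mult_eq_scaleR)
  then show ?thesis by (simp add: linear_sum[OF lin] linear_cmul[OF lin])
qed

lemma dmetric_symmetric:
  assumes "c \<in> charts_at M p"
  shows "transpose (dmetric c (snd c p) w) = dmetric c (snd c p) w"
proof -
  have "((\<lambda>x. transpose (metric_matrix M c x)) has_derivative (\<lambda>w. transpose (dmetric c (snd c p) w))) (at (snd c p))"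
    by (rule bounded_linear.has_derivative[OF bounded_linear_transpose metric_has_derivative[OF assms]])
  then have "(metric_matrix M c has_derivative (\<lambda>w. transpose (dmetric c (snd c p) w))) (at (snd c p))"
    by (rule has_derivative_transform_within_open[OF _ image_open[OF charts_atD(2)[OF assms]]])
      (use charts_atD[OF assms] in \<open>auto intro!: metric_matrix_symmetric simp: charts_at_iff\<close>)
  from has_derivative_unique[OF this metric_has_derivative[OF assms]] show ?thesis by metis
qed

lemma
  assumes c: "c \<in> charts_at M p"
  shows bilinear_christoffel: "bilinear (christoffel_map M c (snd c p))"
    and christoffel_sym: "christoffel_map M c (snd c p) u v = christoffel_map M c (snd c p) v u"
    and christoffel_metric: "y \<bullet> (dmetric c (snd c p) u *v v) =
      christoffel_map M c (snd c p) u y \<bullet> (metric_matrix M c (snd c p) *v v) +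
      y \<bullet> (metric_matrix M c (snd c p) *v christoffel_map M c (snd c p) u v)"
    and christoffel_unique: "(\<And>u v. T u v = T v u) \<Longrightarrow>
      (\<And>u v y. y \<bullet> (dmetric c (snd c p) u *v v) = T u y \<bullet> (metric_matrix M c (snd c p) *v v) +
      y \<bullet> (metric_matrix M c (snd c p) *v T u v)) \<Longrightarrow> T u v = christoffel_map M c (snd c p) u v"
  unfolding christoffel_gamma
  by (rule bilinear_gamma gamma_sym gamma_metric gamma_unique metric_matrix_nz metric_matrix_symmetric
      dmetric_symmetric dmetric_sum c | assumption)+

lemma sqrt_det_has_derivative:
  assumes c: "c \<in> charts_at M p"
  shows "((\<lambda>x. sqrt (det (metric_matrix M c x))) has_derivative
    (\<lambda>w. sqrt (det (metric_matrix M c (snd c p))) * (\<Sum>a\<in>UNIV. christoffel_map M c (snd c p) w (axis a 1) $ a)))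
    (at (snd c p))"
proof -
  let ?g = "det (metric_matrix M c (snd c p))"
  have g: "?g > 0" by (rule metric_matrix_det_pos[OF c])
  have "((\<lambda>x. sqrt (det (metric_matrix M c x))) has_derivative
    (\<lambda>w. ddet (metric_matrix M c (snd c p)) (dmetric c (snd c p) w) * (inverse (sqrt ?g) / 2))) (at (snd c p))"
    by (rule has_derivative_real_sqrt[OF g has_derivative_det_comp[OF metric_has_derivative[OF c]]])
  then show ?thesis
  proof (rule has_derivative_eq_rhs, intro ext)
    fix w
    have "ddet (metric_matrix M c (snd c p)) (dmetric c (snd c p) w) = 2 * ?g * (\<Sum>a\<in>UNIV. christoffel_map M c (snd c p) w (axis a 1) $ a)"
      unfolding christoffel_gamma
      by (rule gamma_trace metric_matrix_nz metric_matrix_symmetric dmetric_symmetric dmetric_sum c)+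
    moreover have "?g * inverse (sqrt ?g) = sqrt ?g" using g by (simp add: real_div_sqrt field_simps flip: divide_inverse)
    ultimately show "ddet (metric_matrix M c (snd c p)) (dmetric c (snd c p) w) * (inverse (sqrt ?g) / 2) =
      sqrt ?g * (\<Sum>a\<in>UNIV. christoffel_map M c (snd c p) w (axis a 1) $ a)"
      by (simp add: mult_ac)
  qed
qed

lemma transition_Ck: "c \<in> atlas M \<Longrightarrow> c' \<in> atlas M \<Longrightarrow> Ck_on k (snd c ` (fst c \<inter> fst c')) (transition c c')"
  using transition_smooth by (simp add: smooth_on_def)

lemma transition_second_derivative:
  assumes "c \<in> charts_at M p" "c' \<in> charts_at M p"
  shows "((\<lambda>y. frechet_derivative (transition c c') (at y) u) has_derivative
    frechet_derivative (\<lambda>y. frechet_derivative (transition c c') (at y) u) (at (snd c p))) (at (snd c p))"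
  using Ck_on_SucD(1)[OF Ck_on_SucD(2)[OF transition_Ck]] charts_atD[OF assms(1)] charts_atD[OF assms(2)] by blast

text \<open>
  Transport the connection of the chart \<open>c'\<close> to \<open>c\<close> and add the second derivative of the transition.  The result is
  symmetric, and differentiating the relation between the two metric matrices shows that it is metric.  By
  Koszul's formula it is the connection of \<open>c\<close>.
\<close>

lemma christoffel_transform:
  assumes c: "c \<in> charts_at M p" and c': "c' \<in> charts_at M p"
  defines "T \<equiv> \<lambda>y. frechet_derivative (transition c c') (at y)"
  shows "T (snd c p) (christoffel_map M c (snd c p) u w) =
    christoffel_map M c' (snd c' p) (T (snd c p) u) (T (snd c p) w) +
    frechet_derivative (\<lambda>y. T y w) (at (snd c p)) u"
proof -
  let ?x = "snd c p" and ?x' = "snd c' p"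
  let ?G = "metric_matrix M c" and ?G' = "metric_matrix M c'"
  let ?\<Gamma>' = "christoffel_map M c' ?x'"
  define S where "S = frechet_derivative (transition c' c) (at ?x')"
  define T2 where "T2 w = frechet_derivative (\<lambda>y. T y w) (at ?x)" for w
  have a: "c \<in> atlas M" "p \<in> fst c" "c' \<in> atlas M" "p \<in> fst c'" using charts_atD[OF c] charts_atD[OF c'] by auto
  let ?S = "snd c ` (fst c \<inter> fst c')"
  have x: "?x \<in> ?S" "open ?S" using a overlap_open by auto
  have TS: "T ?x (S v) = v" and ST: "S (T ?x v) = v" for v
    using transition_cocycle[OF c' c c'] transition_cocycle[OF c c' c] transition_self[OF c] transition_self[OF c']
    by (simp_all add: S_def T_def)
  have linT: "linear (T ?x)" unfolding T_def by (rule linear_transition[OF c c'])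
  have T2sym: "T2 w u = T2 u w" for u w
    unfolding T2_def T_def by (rule symmetric_frechet_derivative[OF x(2) transition_Ck x(1)]) (use a in auto)
  have dT: "((\<lambda>y. T y w) has_derivative T2 w) (at ?x)" for w
    unfolding T2_def T_def by (rule transition_second_derivative[OF c c'])
  have rel: "u \<bullet> (?G y *v w) = T y u \<bullet> (?G' (transition c c' y) *v T y w)" if "y \<in> ?S" for y u w
  proof -
    from that obtain q where q: "q \<in> fst c" "q \<in> fst c'" "y = snd c q" by blast
    then have cq: "c \<in> charts_at M q" "c' \<in> charts_at M q" using a by (auto simp: charts_at_iff)
    have coord: "coord_vec M c q v c' = T y v" for v using cq by (simp add: coord_vec_def T_def q)
    have "u \<bullet> (?G y *v w) = metric M q (coord_vec M c q u) (coord_vec M c q w)"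
      using metric_coords[OF cq(1) coord_vec_tangent[OF cq(1)] coord_vec_tangent[OF cq(1)], of u w] cq by (simp add: q)
    also have "\<dots> = T y u \<bullet> (?G' (transition c c' y) *v T y w)"
      using metric_coords[OF cq(2) coord_vec_tangent[OF cq(1)] coord_vec_tangent[OF cq(1)], of u w] a q by (simp add: coord)
    finally show ?thesis .
  qed
  have point: "transition c c' ?x = ?x'" using a by simp
  have deriv: "u \<bullet> (dmetric c ?x h *v w) =
      T ?x u \<bullet> (?G' ?x' *v T2 w h + dmetric c' ?x' (T ?x h) *v T ?x w) + T2 u h \<bullet> (?G' ?x' *v T ?x w)" for u w h
  proof -
    have bl: "bounded_linear (\<lambda>A. u \<bullet> (A *v w))" for u w :: "'n rvec"
      by (intro bounded_linear_intros bounded_bilinear.bounded_linear_left[OF bounded_bilinear_matrix_vector]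
          bounded_linear_compose[OF bounded_linear_inner_right])
    have 1: "((\<lambda>y. u \<bullet> (?G y *v w)) has_derivative (\<lambda>h. u \<bullet> (dmetric c ?x h *v w))) (at ?x)"
      by (rule bounded_linear.has_derivative[OF bl metric_has_derivative[OF c]])
    have dG': "((\<lambda>y. ?G' (transition c c' y)) has_derivative (\<lambda>h. dmetric c' ?x' (T ?x h))) (at ?x)"
      using has_derivative_compose[OF transition_has_derivative[OF c c'], of ?G'] metric_has_derivative[OF c'] point
      by (simp add: T_def)
    have "((\<lambda>y. T y u \<bullet> (?G' (transition c c' y) *v T y w)) has_derivative
      (\<lambda>h. T ?x u \<bullet> (?G' ?x' *v T2 w h + dmetric c' ?x' (T ?x h) *v T ?x w) + T2 u h \<bullet> (?G' ?x' *v T ?x w))) (at ?x)"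
      using has_derivative_inner[OF dT has_derivative_matrix_vector[OF dG' dT], of u w] by (simp add: point)
    then have 2: "((\<lambda>y. u \<bullet> (?G y *v w)) has_derivative
      (\<lambda>h. T ?x u \<bullet> (?G' ?x' *v T2 w h + dmetric c' ?x' (T ?x h) *v T ?x w) + T2 u h \<bullet> (?G' ?x' *v T ?x w))) (at ?x)"
      by (rule has_derivative_transform_within_open[OF _ x(2,1)]) (rule rel[symmetric])
    from has_derivative_unique[OF 1 2] show ?thesis by (rule fun_cong)
  qed
  have "S (?\<Gamma>' (T ?x u) (T ?x w) + T2 w u) = christoffel_map M c ?x u w"
  proof (rule christoffel_unique[OF c])
    fix u w
    show "S (?\<Gamma>' (T ?x u) (T ?x w) + T2 w u) = S (?\<Gamma>' (T ?x w) (T ?x u) + T2 u w)"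
      using christoffel_sym[OF c'] T2sym by metis
  next
    fix u w y
    let ?C = "\<lambda>u w. S (?\<Gamma>' (T ?x u) (T ?x w) + T2 w u)"
    have G: "a \<bullet> (?G ?x *v b) = T ?x a \<bullet> (?G' ?x' *v T ?x b)" for a b using rel[OF x(1)] point by simp
    show "y \<bullet> (dmetric c ?x u *v w) = ?C u y \<bullet> (?G ?x *v w) + y \<bullet> (?G ?x *v ?C u w)"
      unfolding G TS deriv
      using christoffel_metric[OF c', of "T ?x y" "T ?x u" "T ?x w"]
      by (simp add: inner_add_left inner_add_right matrix_vector_right_distrib)
  qed
  then have "T ?x (christoffel_map M c ?x u w) = T ?x (S (?\<Gamma>' (T ?x u) (T ?x w) + T2 w u))" by simp
  then show ?thesis unfolding TS T2_def .
qed

end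

section \<open>Differentials and connections along a map\<close>

locale riemannian_map = M: riemannian M + N: riemannian N
  for M :: "('a, 'n::{finite,linorder}) manifold" and N :: "('b, 'n) manifold" +
  fixes f :: "'a \<Rightarrow> 'b"
  assumes map: "Ck_map 2 M N f"
begin

abbreviation (input) "jac c c' x \<equiv> frechet_derivative (local_rep c c' f) (at x)"

definition "chart_domain c c' = {q \<in> fst c. f q \<in> fst c'}"

lemma map_continuous: "continuous_map (mtop M) (mtop N) f"
  using map by (simp add: Ck_map_def)

lemma map_points: "p \<in> points M \<Longrightarrow> f p \<in> points N"
  using map_continuous by (auto simp: continuous_map_def)

lemma map_Ck: "c \<in> atlas M \<Longrightarrow> c' \<in> atlas N \<Longrightarrow> Ck_on (Suc (Suc 0)) (snd c ` chart_domain c c') (local_rep c c' f)"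
  using map by (simp add: Ck_map_def chart_domain_def numeral_2_eq_2)

lemma openin_chart_domain: assumes "c \<in> atlas M" "c' \<in> atlas N" shows "openin (mtop M) (chart_domain c c')"
proof -
  have "chart_domain c c' = fst c \<inter> {q \<in> points M. f q \<in> fst c'}"
    using M.chart_subset[OF assms(1)] unfolding chart_domain_def by blast
  then show ?thesis
    using openin_Int[OF M.chart_open[OF assms(1)]
        openin_continuous_map_preimage[OF map_continuous N.chart_open[OF assms(2)]]] by simp
qed

lemma open_chart_domain: assumes "c \<in> atlas M" "c' \<in> atlas N" shows "open (snd c ` chart_domain c c')"
proof -
  have "fst c \<inter> chart_domain c c' = chart_domain c c'" by (auto simp: chart_domain_def)
  then show ?thesis using M.chart_image_open[OF assms(1) openin_chart_domain[OF assms]] by simp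
qed

lemma local_rep_point [simp]: "c \<in> atlas M \<Longrightarrow> q \<in> fst c \<Longrightarrow> local_rep c c' f (snd c q) = snd c' (f q)"
  by (simp add: local_rep_def)

context
  fixes p c c' assumes c: "c \<in> charts_at M p" and c': "c' \<in> charts_at N (f p)"
begin

lemma point_in_chart_domain: "snd c p \<in> snd c ` chart_domain c c'"
  using M.charts_atD[OF c] N.charts_atD[OF c'] by (auto simp: chart_domain_def)

lemma jac_has_derivative: "(local_rep c c' f has_derivative jac c c' (snd c p)) (at (snd c p))"
  using Ck_on_SucD(1)[OF map_Ck point_in_chart_domain] M.charts_atD[OF c] N.charts_atD[OF c'] by blast

lemma linear_jac: "linear (jac c c' (snd c p))"
  using has_derivative_linear[OF jac_has_derivative] .

end

lemma jac_change:
  assumes c: "c \<in> charts_at M p" "c2 \<in> charts_at M p" and c': "c' \<in> charts_at N (f p)" "c2' \<in> charts_at N (f p)"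
  shows "jac c2 c2' (snd c2 p) (frechet_derivative (transition c c2) (at (snd c p)) v) =
    frechet_derivative (transition c' c2') (at (snd c' (f p))) (jac c c' (snd c p) v)"
proof -
  let ?T = "frechet_derivative (transition c c2) (at (snd c p))"
  let ?T' = "frechet_derivative (transition c' c2') (at (snd c' (f p)))"
  have a: "c \<in> atlas M" "p \<in> fst c" "c2 \<in> atlas M" "p \<in> fst c2" "c' \<in> atlas N" "f p \<in> fst c'" "c2' \<in> atlas N" "f p \<in> fst c2'"
    using M.charts_atD[OF c(1)] M.charts_atD[OF c(2)] N.charts_atD[OF c'(1)] N.charts_atD[OF c'(2)] by auto
  let ?S = "snd c ` (fst c \<inter> (chart_domain c c' \<inter> chart_domain c2 c2'))"
  have S: "open ?S" by (intro M.chart_image_open openin_Int openin_chart_domain a)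
  have "snd c p \<in> ?S" using a by (auto simp: chart_domain_def)
  note S = S this
  have 1: "((\<lambda>x. local_rep c2 c2' f (transition c c2 x)) has_derivative (\<lambda>v. jac c2 c2' (snd c2 p) (?T v))) (at (snd c p))"
    using has_derivative_compose[OF M.transition_has_derivative[OF c], of "local_rep c2 c2' f"]
      jac_has_derivative[OF c(2) c'(2)] a by simp
  have 2: "((\<lambda>x. transition c' c2' (local_rep c c' f x)) has_derivative (\<lambda>v. ?T' (jac c c' (snd c p) v))) (at (snd c p))"
    using has_derivative_compose[OF jac_has_derivative[OF c(1) c'(1)], of "transition c' c2'"]
      N.transition_has_derivative[OF c'] a by simp
  have eq: "transition c' c2' (local_rep c c' f x) = local_rep c2 c2' f (transition c c2 x)" if "x \<in> ?S" for x
    using that a by (auto simp: chart_domain_def)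
  have "((\<lambda>x. local_rep c2 c2' f (transition c c2 x)) has_derivative (\<lambda>v. ?T' (jac c c' (snd c p) v))) (at (snd c p))"
    by (rule has_derivative_transform_within_open[OF 2 S]) (rule eq)
  from has_derivative_unique[OF 1 this] show ?thesis by (rule fun_cong)
qed

lemma differential_coords:
  assumes c: "c \<in> charts_at M p" and c': "c' \<in> charts_at N (f p)" and v: "v \<in> tangent_space M p"
  shows "differential M N f p v \<in> tangent_space N (f p)"
    and "differential M N f p v c' = jac c c' (snd c p) (v c)"
proof -
  let ?w = "coord_vec N c' (f p) (jac c c' (snd c p) (v c))"
  have w: "?w \<in> tangent_space N (f p)" by (rule N.coord_vec_tangent[OF c'])
  have "differential M N f p v = ?w"
    unfolding differential_def
  proof (rule the_equality, intro conjI ballI)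
    fix c2 c2' assume c2: "c2 \<in> charts_at M p" and c2': "c2' \<in> charts_at N (f p)"
    have "?w c2' = frechet_derivative (transition c' c2') (at (snd c' (f p))) (jac c c' (snd c p) (v c))"
      using c2' by (simp add: coord_vec_def)
    also have "\<dots> = jac c2 c2' (snd c2 p) (v c2)"
      using jac_change[OF c c2 c' c2'] M.tangentD[OF v c c2] by simp
    finally show "?w c2' = jac c2 c2' (snd c2 p) (v c2)" .
  next
    fix w assume "w \<in> tangent_space N (f p) \<and> (\<forall>c\<in>charts_at M p. \<forall>c'\<in>charts_at N (f p). w c' = jac c c' (snd c p) (v c))"
    then show "w = ?w" using N.tangent_ext[OF _ w c'] c c' by simp
  qed (rule w)
  then show "differential M N f p v \<in> tangent_space N (f p)" "differential M N f p v c' = jac c c' (snd c p) (v c)"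
    using w c' by auto
qed

text \<open>
  In another pair of charts, the coordinates of \<open>\<xi>\<close> are multiplied by the derivative of a transition.  The second
  derivative of the transition that the product rule produces is cancelled by the inhomogeneous term of
  \<open>christoffel_transform\<close>.  So the formulas for all pairs of charts define one tangent vector.
\<close>

lemma pullback_conn_coords:
  assumes c: "c \<in> charts_at M p" and c': "c' \<in> charts_at N (f p)" and u: "u \<in> tangent_space M p"
    and U: "openin (mtop M) U" "p \<in> U" and \<xi>: "\<forall>q\<in>U. \<xi> q \<in> tangent_space N (f q)"
    and d: "((\<lambda>x. \<xi> (chart_inv c x) c') has_derivative \<xi>') (at (snd c p))"
  shows "pullback_conn M N f \<xi> p u \<in> tangent_space N (f p)"
    and "pullback_conn M N f \<xi> p u c' =
      \<xi>' (u c) + christoffel_map N c' (snd c' (f p)) (jac c c' (snd c p) (u c)) (\<xi> p c')"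
proof -
  let ?val = "\<xi>' (u c) + christoffel_map N c' (snd c' (f p)) (jac c c' (snd c p) (u c)) (\<xi> p c')"
  let ?w = "coord_vec N c' (f p) ?val"
  note \<xi> = bspec[OF \<xi>]
  have a: "c \<in> atlas M" "p \<in> fst c" "c' \<in> atlas N" "f p \<in> fst c'"
    using M.charts_atD[OF c] N.charts_atD[OF c'] by auto
  have w: "?w \<in> tangent_space N (f p)" by (rule N.coord_vec_tangent[OF c'])
  have formula: "?w c2' = frechet_derivative (\<lambda>x. \<xi> (chart_inv c2 x) c2') (at (snd c2 p)) (u c2) +
         christoffel_map N c2' (snd c2' (f p)) (differential M N f p u c2') (\<xi> p c2')"
    if c2: "c2 \<in> charts_at M p" and c2': "c2' \<in> charts_at N (f p)" for c2 c2'
  proof -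
    have a2: "c2 \<in> atlas M" "p \<in> fst c2" "c2' \<in> atlas N" "f p \<in> fst c2'"
      using M.charts_atD[OF c2] N.charts_atD[OF c2'] by auto
    let ?T = "frechet_derivative (transition c2 c) (at (snd c2 p))"
    let ?L = "\<lambda>y. frechet_derivative (transition c' c2') (at y)"
    let ?y = "snd c' (f p)"
    let ?L2 = "\<lambda>v. frechet_derivative (\<lambda>y. ?L y v) (at ?y)"
    let ?F = "\<lambda>x. snd c' (f (chart_inv c2 x))"
    have F: "(?F has_derivative (\<lambda>h. jac c c' (snd c p) (?T h))) (at (snd c2 p))"
    proof -
      have "(local_rep c2 c' f has_derivative jac c2 c' (snd c2 p)) (at (snd c2 p))"
        by (rule jac_has_derivative[OF c2 c'])
      moreover have "jac c2 c' (snd c2 p) = (\<lambda>h. jac c c' (snd c p) (?T h))"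
        using jac_change[OF c2 c c' c'] N.transition_self[OF c'] by (simp add: fun_eq_iff)
      moreover have "local_rep c2 c' f = ?F" by (simp add: local_rep_def fun_eq_iff)
      ultimately show ?thesis by metis
    qed
    let ?S = "snd c2 ` (fst c2 \<inter> (U \<inter> chart_domain c c' \<inter> chart_domain c2 c2'))"
    have S: "open ?S" by (intro M.chart_image_open openin_Int openin_chart_domain a a2 U)
    have "snd c2 p \<in> ?S" using a a2 U by (auto simp: chart_domain_def)
    note S = S this
    have d2: "((\<lambda>x. \<xi> (chart_inv c2 x) c') has_derivative (\<lambda>h. \<xi>' (?T h))) (at (snd c2 p))"
    proof -
      have "((\<lambda>x. \<xi> (chart_inv c (transition c2 c x)) c') has_derivative (\<lambda>h. \<xi>' (?T h))) (at (snd c2 p))"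
        using has_derivative_compose[OF M.transition_has_derivative[OF c2 c], of "\<lambda>x. \<xi> (chart_inv c x) c'" \<xi>'] d a2 by simp
      then show ?thesis
        by (rule has_derivative_transform_within_open[OF _ S]) (use a a2 in \<open>auto simp: chart_domain_def\<close>)
    qed
    have "((\<lambda>x. ?L (?F x) (\<xi> (chart_inv c2 x) c')) has_derivative
      (\<lambda>h. ?L (?F (snd c2 p)) (\<xi>' (?T h)) + ?L2 (\<xi> (chart_inv c2 (snd c2 p)) c') (jac c c' (snd c p) (?T h)))) (at (snd c2 p))"
    proof (rule has_derivative_linear_family[OF d2 _ S])
      fix v
      show "((\<lambda>x. ?L (?F x) v) has_derivative (\<lambda>h. ?L2 v (jac c c' (snd c p) (?T h)))) (at (snd c2 p))"
        using has_derivative_compose[OF F, of "\<lambda>y. ?L y v" "?L2 v"] N.transition_second_derivative[OF c' c2'] a2 by simp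
    next
      fix x assume "x \<in> ?S"
      then obtain q where "x = snd c2 q" "q \<in> fst c2" "f q \<in> fst c'" "f q \<in> fst c2'" by (auto simp: chart_domain_def)
      then show "linear (?L (?F x))" using N.linear_transition[of c' "f q" c2'] a a2 by (simp add: N.charts_at_iff)
    qed
    then have "((\<lambda>x. \<xi> (chart_inv c2 x) c2') has_derivative
      (\<lambda>h. ?L (?F (snd c2 p)) (\<xi>' (?T h)) + ?L2 (\<xi> (chart_inv c2 (snd c2 p)) c') (jac c c' (snd c p) (?T h)))) (at (snd c2 p))"
    proof (rule has_derivative_transform_within_open[OF _ S])
      fix x assume "x \<in> ?S"
      then obtain q where q: "x = snd c2 q" "q \<in> fst c2" "f q \<in> fst c'" "f q \<in> fst c2'" "q \<in> U" by (auto simp: chart_domain_def)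
      then show "?L (?F x) (\<xi> (chart_inv c2 x) c') = \<xi> (chart_inv c2 x) c2'"
        using N.tangentD[OF \<xi>[OF q(5)], of c' c2'] a a2 by (simp add: N.charts_at_iff)
    qed
    from frechet_derivative_at[OF this, symmetric]
    have fd: "frechet_derivative (\<lambda>x. \<xi> (chart_inv c2 x) c2') (at (snd c2 p)) =
       (\<lambda>h. ?L ?y (\<xi>' (?T h)) + ?L2 (\<xi> p c') (jac c c' (snd c p) (?T h)))"
      by (simp only: M.chart_inv_left[OF a2(1,2)])
    have Tu: "?T (u c2) = u c" using M.tangentD[OF u c2 c] by simp
    have df: "differential M N f p u c2' = ?L ?y (jac c c' (snd c p) (u c))"
      using differential_coords[OF c c' u] N.tangentD[OF _ c' c2'] by metis
    have \<xi>p: "\<xi> p c2' = ?L ?y (\<xi> p c')" using N.tangentD[OF \<xi>[OF U(2)] c' c2'] .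
    have "?w c2' = ?L ?y ?val" using c2' by (simp add: coord_vec_def)
    also have "\<dots> = ?L ?y (\<xi>' (u c)) + ?L ?y (christoffel_map N c' ?y (jac c c' (snd c p) (u c)) (\<xi> p c'))"
      by (rule linear_add[OF N.linear_transition[OF c' c2']])
    also have "?L ?y (christoffel_map N c' ?y (jac c c' (snd c p) (u c)) (\<xi> p c')) =
      christoffel_map N c2' (snd c2' (f p)) (differential M N f p u c2') (\<xi> p c2') + ?L2 (\<xi> p c') (jac c c' (snd c p) (u c))"
      unfolding N.christoffel_transform[OF c' c2'] df \<xi>p ..
    finally show ?thesis unfolding fd Tu by simp
  qed
  have "pullback_conn M N f \<xi> p u = ?w"
    unfolding pullback_conn_def
  proof (rule the_equality, intro conjI ballI)
    fix w assume "w \<in> tangent_space N (f p) \<and> (\<forall>c\<in>charts_at M p. \<forall>c'\<in>charts_at N (f p).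
       w c' = frechet_derivative (\<lambda>x. \<xi> (chart_inv c x) c') (at (snd c p)) (u c) +
         christoffel_map N c' (snd c' (f p)) (differential M N f p u c') (\<xi> p c'))"
    then show "w = ?w" using N.tangent_ext[OF _ w c'] formula[OF c c'] c c' by simp
  qed (use w formula in auto)
  then show "pullback_conn M N f \<xi> p u \<in> tangent_space N (f p)"
    "pullback_conn M N f \<xi> p u c' =
      \<xi>' (u c) + christoffel_map N c' (snd c' (f p)) (jac c c' (snd c p) (u c)) (\<xi> p c')"
    using w c' by auto
qed

end

section \<open>The pointwise Piola identity\<close>

lemma bounded_bilinear_matrix_mult: "bounded_bilinear (\<lambda>(A :: real^'n^'n) (B :: real^'n^'n). A ** B)"
  unfolding bilinear_conv_bounded_bilinear[symmetric] bilinear_def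
  by (intro conjI allI bounded_linear.linear bounded_linear_matrix_left bounded_linear_matrix_right)

lemmas has_derivative_matrix_mult = bounded_bilinear.FDERIV[OF bounded_bilinear_matrix_mult]

lemma continuous_on_frechet_apply:
  fixes g :: "real^'n \<Rightarrow> 'b::real_normed_vector"
  assumes g: "Ck_on (Suc 0) S g" and t: "continuous_on T t" "t ` T \<subseteq> S" and w: "continuous_on T w"
  shows "continuous_on T (\<lambda>x. frechet_derivative g (at (t x)) (w x))"
proof -
  have expand: "frechet_derivative g (at (t x)) (w x) = (\<Sum>k\<in>UNIV. w x $ k *\<^sub>R frechet_derivative g (at (t x)) (axis k 1))"
    if "x \<in> T" for x
  proof -
    have lin: "linear (frechet_derivative g (at (t x)))" using Ck_on_linear_frechet[OF g] t that by blast
    have "frechet_derivative g (at (t x)) (w x) = frechet_derivative g (at (t x)) (\<Sum>k\<in>UNIV. w x $ k *\<^sub>R axis k 1)"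
      using basis_expansion[of "w x"] by (simp add: scalar_mult_eq_scaleR)
    then show ?thesis by (simp add: linear_sum[OF lin] linear_cmul[OF lin])
  qed
  have "continuous_on S (\<lambda>y. frechet_derivative g (at y) v)" for v using Ck_on_SucD(2)[OF g] by simp
  then have c: "continuous_on T (\<lambda>x. frechet_derivative g (at (t x)) v)" for v
    using continuous_on_compose2[OF _ t] by blast
  have "continuous_on T (\<lambda>x. \<Sum>k\<in>UNIV. w x $ k *\<^sub>R frechet_derivative g (at (t x)) (axis k 1))"
    by (intro continuous_on_sum continuous_on_scaleR continuous_on_component c w)
  then show ?thesis by (rule continuous_on_eq) (simp add: expand)
qed

context riemannian
begin

lemma identity_map: "riemannian_map M M (\<lambda>q. q)"
proof
  have "local_rep c c' (\<lambda>q. q) = transition c c'" for c c' :: "('a, 'n) chart"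
    by (simp add: local_rep_def transition_def fun_eq_iff)
  moreover have "{q \<in> fst c. q \<in> fst c'} = fst c \<inter> fst c'" for c c' :: "('a, 'n) chart" by blast
  ultimately show "Ck_map 2 M M (\<lambda>q. q)"
    using transition_Ck[of _ _ 2] by (simp add: Ck_map_def)
qed

lemma levi_civita_coords:
  assumes c: "c \<in> charts_at M p" and u: "u \<in> tangent_space M p"
    and U: "openin (mtop M) U" "p \<in> U" and X: "\<forall>q\<in>U. X q \<in> tangent_space M q"
    and d: "((\<lambda>x. X (chart_inv c x) c) has_derivative X') (at (snd c p))"
  shows "levi_civita M X p u \<in> tangent_space M p"
    and "levi_civita M X p u c = X' (u c) + christoffel_map M c (snd c p) (u c) (X p c)"
proof -
  interpret I: riemannian_map M M "\<lambda>q. q" by (rule identity_map)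
  have "local_rep c c (\<lambda>q. q) = transition c c"
    by (simp add: local_rep_def transition_def fun_eq_iff)
  then show "levi_civita M X p u \<in> tangent_space M p"
    "levi_civita M X p u c = X' (u c) + christoffel_map M c (snd c p) (u c) (X p c)"
    using I.pullback_conn_coords[OF c c u U, of X X'] X d transition_self[OF c, of "u c"]
    by (simp_all add: levi_civita_def)
qed

lemma orthonormal_trace:
  assumes c: "c \<in> charts_at M p" and e: "orthonormal_basis (tangent M p) e"
  shows "(\<Sum>i<CARD('n). (e ! i) c $ a * (metric_matrix M c (snd c p) *v (e ! i) c) $ b) = (if a = b then 1 else 0)"
proof -
  let ?E = "frame c e" and ?G = "metric_matrix M c (snd c p)"
  have "(?G ** ?E) ** transpose ?E = mat 1"
    using frame_gram[OF c e] matrix_left_right_inverse by blast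
  then have "((?G ** ?E) ** transpose ?E) $ b $ a = (if a = b then 1 else 0)" by (simp add: mat_def)
  moreover have "((?G ** ?E) ** transpose ?E) $ b $ a = (\<Sum>j\<in>UNIV. (e ! pos j) c $ a * (?G *v (e ! pos j) c) $ b)"
    by (simp add: matrix_matrix_mult_def transpose_def frame_def matrix_vector_mult_def mult.commute)
  ultimately show ?thesis by (simp add: sum_pos)
qed

lemma vdim_tangent: "p \<in> points M \<Longrightarrow> vdim (tangent M p) = CARD('n)"
  using chart_at_exists dim_tangent by (fastforce simp: vdim_def tangent_def)

lemma sqrt_det_pos: "c \<in> charts_at M p \<Longrightarrow> sqrt (det (metric_matrix M c (snd c p))) > 0"
  using metric_matrix_det_pos by simp

end

context riemannian_map
begin

abbreviation (input) "jacm c c' x \<equiv> matrix (jac c c' x)"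
abbreviation (input) "sM c x \<equiv> sqrt (det (metric_matrix M c x))"
abbreviation (input) "sN c' y \<equiv> sqrt (det (metric_matrix N c' y))"

definition "cof_lowered c c' x =
  (sN c' (local_rep c c' f x) / sM c x) *\<^sub>R cofm (jacm c c' x)"

definition "cof_matrix c c' x =
  matrix_inv (metric_matrix N c' (local_rep c c' f x)) ** (cof_lowered c c' x ** metric_matrix M c x)"

lemma metric_cof_matrix:
  assumes c: "c \<in> charts_at M p" and c': "c' \<in> charts_at N (f p)"
  shows "metric_matrix N c' (snd c' (f p)) ** cof_matrix c c' (snd c p) =
    cof_lowered c c' (snd c p) ** metric_matrix M c (snd c p)"
  using matrix_inv_right_det[OF N.metric_matrix_nz[OF c']] M.charts_atD[OF c]
  by (simp add: cof_matrix_def matrix_mul_assoc)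

lemma jacm_apply:
  assumes "c \<in> charts_at M p" "c' \<in> charts_at N (f p)"
  shows "jacm c c' (snd c p) *v v = jac c c' (snd c p) v"
  by (rule matrix_linear[OF linear_jac[OF assms]])

lemma differential_linear:
  assumes p: "p \<in> points M" and u: "u \<in> tangent_space M p" and v: "v \<in> tangent_space M p"
  shows "differential M N f p (a *\<^sub>R u + b *\<^sub>R v) = a *\<^sub>R differential M N f p u + b *\<^sub>R differential M N f p v"
proof -
  obtain c where c: "c \<in> charts_at M p" using M.chart_at_exists[OF p] by blast
  obtain c' where c': "c' \<in> charts_at N (f p)" using N.chart_at_exists[OF map_points[OF p]] by blast
  have w: "a *\<^sub>R u + b *\<^sub>R v \<in> tangent_space M p"
    using M.subspace_tangent[OF c] u v by (simp add: subspace_add subspace_scale)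
  show ?thesis
  proof (rule N.tangent_ext[OF differential_coords(1)[OF c c' w] _ c'])
    show "a *\<^sub>R differential M N f p u + b *\<^sub>R differential M N f p v \<in> tangent_space N (f p)"
      using N.subspace_tangent[OF c'] differential_coords(1)[OF c c'] u v by (simp add: subspace_add subspace_scale)
    show "differential M N f p (a *\<^sub>R u + b *\<^sub>R v) c' = (a *\<^sub>R differential M N f p u + b *\<^sub>R differential M N f p v) c'"
    proof -
      have app: "(a *\<^sub>R g + b *\<^sub>R h) i = a *\<^sub>R g i + b *\<^sub>R h i" for g h :: "'i \<Rightarrow> 'n rvec" and i
        by (simp add: scaleR_fun_def)
      show ?thesis
        unfolding differential_coords(2)[OF c c' w] app differential_coords(2)[OF c c' u] differential_coords(2)[OF c c' v]
          linear_add[OF linear_jac[OF c c']] linear_cmul[OF linear_jac[OF c c']] ..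
    qed
  qed
qed

text \<open>
  With \<open>E\<close> the matrix of a positive orthonormal basis, \<open>cof_characterization\<close> expresses \<open>\<langle>Cof A v, z\<rangle>\<close> by the
  derivative of the determinant at \<open>A E\<close> in a direction that is a multiple of \<open>E\<close>.  Multiplicativity of the determinant
  splits off \<open>det E = 1 / sqrt (det G)\<close>, also where \<open>A\<close> is singular.
\<close>

lemma cof_df_coords:
  assumes c: "c \<in> charts_at M p" and c': "c' \<in> charts_at N (f p)" and v: "v \<in> tangent_space M p"
  shows "cof_df M N f p v \<in> tangent_space N (f p)"
    and "cof_df M N f p v c' = cof_matrix c c' (snd c p) *v v c"
proof -
  let ?V = "tangent M p" and ?W = "tangent N (f p)" and ?A = "differential M N f p"
  let ?G = "metric_matrix M c (snd c p)" and ?H = "metric_matrix N c' (snd c' (f p))" and ?a = "jacm c c' (snd c p)"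
  have p: "p \<in> points M" "f p \<in> points N" using M.charts_atD[OF c] N.charts_atD[OF c'] by auto
  have cV: "carrier ?V = tangent_space M p" "ip ?V = metric M p" and cW: "carrier ?W = tangent_space N (f p)" "ip ?W = metric N (f p)"
    by (auto simp: tangent_def)
  interpret V: oriented_space ?V "M.vol c p" by (rule M.tangent_oriented_space[OF c])
  interpret W: oriented_space ?W "N.vol c' (f p)" by (rule N.tangent_oriented_space[OF c'])
  obtain e where e: "orthonormal_basis ?V e" "pos_oriented ?V e" using V.ex_basis by blast
  have d: "vdim ?V = CARD('n)" "vdim ?W = CARD('n)" using M.vdim_tangent N.vdim_tangent p by auto
  have le: "length e = CARD('n)" using V.length_basis[OF e(1)] d by simp
  have eT: "e ! M.pos j \<in> tangent_space M p" for j using V.basis_in[OF e(1)] d cV by simp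
  note char = cof_characterization[OF V.oriented_space_axioms W.oriented_space_axioms, of ?A e v]
  have A: "?A (a *\<^sub>R u + b *\<^sub>R w) = a *\<^sub>R ?A u + b *\<^sub>R ?A w" "?A u \<in> carrier ?W" if "u \<in> carrier ?V" "w \<in> carrier ?V" for a b u w
    using differential_linear[OF p(1)] differential_coords(1)[OF c c'] that unfolding cV cW by auto
  show in_T: "cof_df M N f p v \<in> tangent_space N (f p)"
    unfolding cof_df_def using char(1) A e v d unfolding cV cW by auto
  have E: "sM c (snd c p) * det (M.frame c e) = 1"
    using V.vol_basis[OF e] by (simp add: M.vol_def)
  have "z \<bullet> (?H *v cof_df M N f p v c') = z \<bullet> (cof_lowered c c' (snd c p) *v (?G *v v c))" for z
  proof -
    let ?Z = "coord_vec N c' (f p) z"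
    have Z: "?Z \<in> tangent_space N (f p)" "?Z c' = z" using N.coord_vec_tangent[OF c'] c' by auto
    define Zm where "Zm = (\<chi> k. (?G *v v c) $ k *s z)"
    have sG: "transpose ?G = ?G" by (rule M.metric_matrix_symmetric[OF c])
    have "z \<bullet> (?H *v cof_df M N f p v c') = metric N (f p) (cof_df M N f p v) ?Z"
      unfolding N.metric_coords[OF c' in_T Z(1)] Z(2)
      by (rule symmetric_matrix_inner[OF N.metric_matrix_symmetric[OF c']])
    also have "\<dots> = (\<Sum>j<CARD('n). metric M p v (e ! j) * N.vol c' (f p) ((map ?A e)[j := ?Z]))"
      unfolding cof_df_def using char(2)[of ?Z] A e v d Z(1) unfolding cV cW by auto
    also have "\<dots> = (\<Sum>j\<in>UNIV. metric M p v (e ! M.pos j) * N.vol c' (f p) ((map ?A e)[M.pos j := ?Z]))"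
      by (rule M.sum_pos)
    also have "\<dots> = (\<Sum>j\<in>UNIV. sN c' (snd c' (f p)) * det (\<chi> k. if k = j then (transpose (M.frame c e) ** Zm) $ j else (transpose (M.frame c e) ** transpose ?a) $ k))"
    proof (rule sum.cong)
      fix j :: 'n
      have fr: "N.frame c' (map ?A e) = ?a ** M.frame c e"
      proof -
        have "N.frame c' (map ?A e) $ i $ k = (?a ** M.frame c e) $ i $ k" for i k
        proof -
          have "(map ?A e ! M.pos k) c' = ?a *v (e ! M.pos k) c"
            using differential_coords(2)[OF c c' eT] jacm_apply[OF c c'] le by simp
          then show ?thesis
            by (simp add: N.frame_def M.frame_def matrix_matrix_mult_def matrix_vector_mult_def)
        qed
        then show ?thesis by (simp add: vec_eq_iff)
      qed
      have row: "(transpose (M.frame c e) ** Zm) $ j = metric M p v (e ! M.pos j) *s z"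
      proof -
        have "metric M p v (e ! M.pos j) = (e ! M.pos j) c \<bullet> (?G *v v c)"
          unfolding M.metric_coords[OF c v eT] by (rule symmetric_matrix_inner[OF sG])
        then show ?thesis
          by (simp add: vec_eq_iff matrix_matrix_mult_def transpose_def M.frame_def Zm_def inner_vec_def sum_distrib_right mult.assoc)
      qed
      have "det (\<chi> k. if k = j then metric M p v (e ! M.pos j) *s z else (transpose (M.frame c e) ** transpose ?a) $ k) =
         metric M p v (e ! M.pos j) * det (\<chi> k. if k = j then z else (transpose (M.frame c e) ** transpose ?a) $ k)"
        by (rule det_row_mul)
      moreover have "N.vol c' (f p) ((map ?A e)[M.pos j := ?Z]) =
        sN c' (snd c' (f p)) * det (\<chi> k. if k = j then z else (transpose (M.frame c e) ** transpose ?a) $ k)"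
        using N.det_frame_update[of "map ?A e" c' j ?Z] le
        unfolding N.vol_def fr matrix_transpose_mul Z(2) by simp
      ultimately show "metric M p v (e ! M.pos j) * N.vol c' (f p) ((map ?A e)[M.pos j := ?Z]) =
        sN c' (snd c' (f p)) * det (\<chi> k. if k = j then (transpose (M.frame c e) ** Zm) $ j else (transpose (M.frame c e) ** transpose ?a) $ k)"
        unfolding row by simp
    qed simp
    also have "\<dots> = sN c' (snd c' (f p)) * ddet (transpose (M.frame c e) ** transpose ?a) (transpose (M.frame c e) ** Zm)"
      unfolding ddet_def sum_distrib_left ..
    also have "\<dots> = sN c' (snd c' (f p)) * (det (M.frame c e) * ddet (transpose ?a) (transpose (transpose Zm)))"
      unfolding ddet_mult_left det_transpose transpose_transpose ..
    also have "\<dots> = sN c' (snd c' (f p)) * (det (M.frame c e) * ddet ?a (transpose Zm))"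
      unfolding ddet_transpose ..
    also have "ddet ?a (transpose Zm) = z \<bullet> (cofm ?a *v (?G *v v c))"
      unfolding ddet_cofm
      by (simp add: Zm_def transpose_def inner_vec_def matrix_vector_mult_def[of "cofm ?a"] sum_distrib_left mult_ac)
    also have "det (M.frame c e) = 1 / sM c (snd c p)"
      using E M.sqrt_det_pos[OF c] by (simp add: field_simps)
    finally show ?thesis
      using M.charts_atD[OF c] by (simp add: cof_lowered_def scaleR_matrix_vector_assoc[symmetric])
  qed
  then have eq: "?H *v cof_df M N f p v c' = cof_lowered c c' (snd c p) *v (?G *v v c)"
    using vector_eq_ldot by blast
  also have "\<dots> = ?H *v (cof_matrix c c' (snd c p) *v v c)"
    by (simp add: matrix_vector_mul_assoc metric_cof_matrix[OF c c'])
  finally have "?H *v (cof_df M N f p v c' - cof_matrix c c' (snd c p) *v v c) = 0"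
    by (simp add: matrix_vector_mult_diff_distrib)
  from matrix_kernel_det[OF N.metric_matrix_nz[OF c'] this]
  show "cof_df M N f p v c' = cof_matrix c c' (snd c p) *v v c" by simp
qed

definition "djacm c c' x h = (\<chi> i j. frechet_derivative (\<lambda>y. jac c c' y (axis j 1)) (at x) h $ i)"

context
  fixes p c c' assumes c: "c \<in> charts_at M p" and c': "c' \<in> charts_at N (f p)"
begin

lemma point: "c \<in> atlas M" "p \<in> fst c" "c' \<in> atlas N" "f p \<in> fst c'" "local_rep c c' f (snd c p) = snd c' (f p)"
  using M.charts_atD[OF c] N.charts_atD[OF c'] by auto

lemma jacm_has_derivative: "(jacm c c' has_derivative djacm c c' (snd c p)) (at (snd c p))"
proof (intro has_derivative_vecI)
  fix i j
  have "((\<lambda>y. jac c c' y (axis j 1)) has_derivative frechet_derivative (\<lambda>y. jac c c' y (axis j 1)) (at (snd c p))) (at (snd c p))"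
    using Ck_on_SucD(1)[OF Ck_on_SucD(2)[OF map_Ck[OF point(1,3)]] point_in_chart_domain[OF c c']] .
  from bounded_linear.has_derivative[OF bounded_linear_vec_nth this]
  show "((\<lambda>x. jacm c c' x $ i $ j) has_derivative (\<lambda>h. djacm c c' (snd c p) h $ i $ j)) (at (snd c p))"
    by (simp add: matrix_def djacm_def)
qed

lemma djacm_symmetric: "djacm c c' (snd c p) (axis j 1) $ i $ k = djacm c c' (snd c p) (axis k 1) $ i $ j"
  using symmetric_frechet_derivative[OF open_chart_domain[OF point(1,3)] _ point_in_chart_domain[OF c c'], of "local_rep c c' f" "axis k 1" "axis j 1"]
    map_Ck[OF point(1,3)] by (simp add: djacm_def numeral_2_eq_2)

lemma metric_N_has_derivative:
  "((\<lambda>x. metric_matrix N c' (local_rep c c' f x)) has_derivative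
     (\<lambda>h. N.dmetric c' (snd c' (f p)) (jac c c' (snd c p) h))) (at (snd c p))"
  using has_derivative_compose[OF jac_has_derivative[OF c c'], of "metric_matrix N c'"]
    N.metric_has_derivative[OF c'] point by simp

lemma sN_has_derivative:
  "((\<lambda>x. sN c' (local_rep c c' f x)) has_derivative
     (\<lambda>h. sN c' (snd c' (f p)) * (\<Sum>a\<in>UNIV. christoffel_map N c' (snd c' (f p)) (jac c c' (snd c p) h) (axis a 1) $ a))) (at (snd c p))"
  using has_derivative_compose[OF jac_has_derivative[OF c c'], of "sN c'"]
    N.sqrt_det_has_derivative[OF c'] point by simp

text \<open>The value of this derivative is not computed here: \<open>divergence_cof_zero\<close> reads it off from the identity
  \<open>sqrt (det G) R = sqrt (det H) (cofm A)\<close>.\<close>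

lemma cof_lowered_differentiable: "\<exists>R'. (cof_lowered c c' has_derivative R') (at (snd c p))"
proof -
  have "sM c (snd c p) \<noteq> 0" using M.sqrt_det_pos[OF c] by simp
  then show ?thesis
    using has_derivative_scaleR[OF has_derivative_divide'[OF sN_has_derivative M.sqrt_det_has_derivative[OF c]]
        has_derivative_cofm[OF jacm_has_derivative]]
    unfolding cof_lowered_def[abs_def] by blast
qed

lemma metric_inv_differentiable:
  "\<exists>H'. ((\<lambda>x. matrix_inv (metric_matrix N c' (local_rep c c' f x))) has_derivative H') (at (snd c p))"
proof -
  let ?H = "\<lambda>x. metric_matrix N c' (local_rep c c' f x)"
  have nz: "det (?H (snd c p)) \<noteq> 0" using N.metric_matrix_nz[OF c'] point by simp
  from has_derivative_scaleR[OF has_derivative_divide'[OF has_derivative_const[of 1] has_derivative_det_comp[OF metric_N_has_derivative] nz]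
      bounded_linear.has_derivative[OF bounded_linear_transpose has_derivative_cofm[OF metric_N_has_derivative]]]
  obtain H' where "((\<lambda>x. (1 / det (?H x)) *\<^sub>R transpose (cofm (?H x))) has_derivative H') (at (snd c p))" by blast
  then have "((\<lambda>x. matrix_inv (?H x)) has_derivative H') (at (snd c p))"
  proof (rule has_derivative_transform_within_open[OF _ open_chart_domain[OF point(1,3)] point_in_chart_domain[OF c c']])
    fix x assume "x \<in> snd c ` chart_domain c c'"
    then obtain q where "x = snd c q" "q \<in> fst c" "f q \<in> fst c'" by (auto simp: chart_domain_def)
    then have "det (?H x) \<noteq> 0" using N.metric_matrix_nz[of c' "f q"] point by (simp add: N.charts_at_iff)
    then show "(1 / det (?H x)) *\<^sub>R transpose (cofm (?H x)) = matrix_inv (?H x)" by (rule matrix_inv_cofm[symmetric])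
  qed
  then show ?thesis by blast
qed

lemma cof_matrix_differentiable: "\<exists>C'. (cof_matrix c c' has_derivative C') (at (snd c p))"
proof -
  obtain R' H' where "(cof_lowered c c' has_derivative R') (at (snd c p))"
    "((\<lambda>x. matrix_inv (metric_matrix N c' (local_rep c c' f x))) has_derivative H') (at (snd c p))"
    using cof_lowered_differentiable metric_inv_differentiable by blast
  from has_derivative_matrix_mult[OF this(2) has_derivative_matrix_mult[OF this(1) M.metric_has_derivative[OF c]]]
  show ?thesis unfolding cof_matrix_def[abs_def] by blast
qed

lemma pointwise_at:
  assumes e: "orthonormal_basis (tangent M p) e"
  shows "piola_at_point (metric_matrix M c (snd c p)) (metric_matrix N c' (snd c' (f p))) (jacm c c' (snd c p))
    (cof_matrix c c' (snd c p)) (cof_lowered c c' (snd c p)) (cofm (jacm c c' (snd c p)))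
    (M.dmetric c (snd c p)) (N.dmetric c' (snd c' (f p))) (\<lambda>h. dcofm (jacm c c' (snd c p)) (djacm c c' (snd c p) h))
    (christoffel_map M c (snd c p)) (christoffel_map N c' (snd c' (f p))) (sM c (snd c p)) (sN c' (snd c' (f p)))
    (det (jacm c c' (snd c p))) (\<lambda>i. (e ! i) c) CARD('n)"
proof
  show "sM c (snd c p) *\<^sub>R cof_lowered c c' (snd c p) = sN c' (snd c' (f p)) *\<^sub>R cofm (jacm c c' (snd c p))"
    using M.sqrt_det_pos[OF c] point by (simp add: cof_lowered_def)
  show "sM c (snd c p) \<noteq> 0" using M.sqrt_det_pos[OF c] by simp
  show "(\<Sum>j\<in>UNIV. dcofm (jacm c c' (snd c p)) (djacm c c' (snd c p) (axis j 1)) $ m $ j) = 0" for m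
    by (rule piola_euclidean[OF djacm_symmetric])
qed (rule M.bilinear_christoffel[OF c] N.bilinear_christoffel[OF c'] M.christoffel_sym[OF c] N.christoffel_sym[OF c']
    M.christoffel_metric[OF c] N.christoffel_metric[OF c'] N.metric_matrix_symmetric[OF c'] N.metric_matrix_nz[OF c']
    metric_cof_matrix[OF c c'] cofm_row M.orthonormal_trace[OF c e])+

text \<open>In the Leibniz rule the derivative of the extending field \<open>X\<close> cancels, which gives independence of \<open>X\<close>.  An
  extension is provided by the field with constant coordinates in the chart \<open>c\<close>.\<close>

lemma hom_conn_coords:
  assumes C': "(cof_matrix c c' has_derivative C') (at (snd c p))"
    and u: "u \<in> tangent_space M p" and v: "v \<in> tangent_space M p"
  shows "hom_conn M N f (cof_df M N f) p u v \<in> tangent_space N (f p)"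
    and "hom_conn M N f (cof_df M N f) p u v c' =
      C' (u c) *v v c + christoffel_map N c' (snd c' (f p)) (jac c c' (snd c p) (u c)) (cof_matrix c c' (snd c p) *v v c)
      - cof_matrix c c' (snd c p) *v christoffel_map M c (snd c p) (u c) (v c)"
proof -
  let ?val = "C' (u c) *v v c + christoffel_map N c' (snd c' (f p)) (jac c c' (snd c p) (u c)) (cof_matrix c c' (snd c p) *v v c)
      - cof_matrix c c' (snd c p) *v christoffel_map M c (snd c p) (u c) (v c)"
  let ?w = "coord_vec N c' (f p) ?val" and ?\<omega> = "cof_df M N f"
  have w: "?w \<in> tangent_space N (f p)" by (rule N.coord_vec_tangent[OF c'])
  \<comment> \<open>every admissible local extension yields the same vector\<close>
  have indep: "?w = pullback_conn M N f (\<lambda>q. ?\<omega> q (X q)) p u - ?\<omega> p (levi_civita M X p u)"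
    if U: "openin (mtop M) U" "p \<in> U" and X: "Ck_section 1 M M (\<lambda>q. q) U X" "X p = v" for U X
  proof -
    have XT: "\<forall>q\<in>U. X q \<in> tangent_space M q" using X by (simp add: Ck_section_def)
    have "Ck_on (Suc 0) (snd c ` {q \<in> fst c \<inter> U. q \<in> fst c}) (\<lambda>x. X (chart_inv c x) c)"
      using X point(1) by (simp add: Ck_section_def)
    moreover have "snd c p \<in> snd c ` {q \<in> fst c \<inter> U. q \<in> fst c}" using point U by auto
    ultimately obtain X' where X': "((\<lambda>x. X (chart_inv c x) c) has_derivative X') (at (snd c p))"
      using Ck_on_SucD(1) by blast
    let ?S = "snd c ` (fst c \<inter> (U \<inter> chart_domain c c'))"
    have S: "open ?S" by (intro M.chart_image_open openin_Int openin_chart_domain point U)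
    have xS: "snd c p \<in> ?S" using point U by (auto simp: chart_domain_def)
    have "((\<lambda>x. cof_matrix c c' x *v X (chart_inv c x) c) has_derivative
       (\<lambda>h. cof_matrix c c' (snd c p) *v X' h + C' h *v X (chart_inv c (snd c p)) c)) (at (snd c p))"
      by (rule has_derivative_matrix_vector[OF C' X'])
    then have d: "((\<lambda>x. ?\<omega> (chart_inv c x) (X (chart_inv c x)) c') has_derivative
       (\<lambda>h. cof_matrix c c' (snd c p) *v X' h + C' h *v X (chart_inv c (snd c p)) c)) (at (snd c p))"
    proof (rule has_derivative_transform_within_open[OF _ S xS])
      fix x assume "x \<in> ?S"
      then obtain q where q: "x = snd c q" "q \<in> fst c" "f q \<in> fst c'" "q \<in> U" by (auto simp: chart_domain_def)
      then have "c \<in> charts_at M q" "c' \<in> charts_at N (f q)" using point by (auto simp: M.charts_at_iff N.charts_at_iff)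
      from cof_df_coords(2)[OF this bspec[OF XT q(4)]]
      show "cof_matrix c c' x *v X (chart_inv c x) c = ?\<omega> (chart_inv c x) (X (chart_inv c x)) c'"
        using q point by simp
    qed
    have \<omega>T: "\<forall>q\<in>U. ?\<omega> q (X q) \<in> tangent_space N (f q)"
    proof
      fix q assume that: "q \<in> U"
      have q: "q \<in> points M" using openin_subset[OF U(1)] that by blast
      obtain c2 c2' where "c2 \<in> charts_at M q" "c2' \<in> charts_at N (f q)"
        using M.chart_at_exists[OF q] N.chart_at_exists[OF map_points[OF q]] by blast
      from cof_df_coords(1)[OF this bspec[OF XT that]] show "?\<omega> q (X q) \<in> tangent_space N (f q)" .
    qed
    note pc = pullback_conn_coords[OF c c' u U \<omega>T d]
    note lc = M.levi_civita_coords[OF c u U XT X']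
    note \<omega>lc = cof_df_coords[OF c c' lc(1)]
    have Xv: "X (chart_inv c (snd c p)) = v" using X(2) point by simp
    show ?thesis
    proof (rule N.tangent_ext[OF w _ c'])
      show "pullback_conn M N f (\<lambda>q. ?\<omega> q (X q)) p u - ?\<omega> p (levi_civita M X p u) \<in> tangent_space N (f p)"
        using N.subspace_tangent[OF c'] pc(1) \<omega>lc(1) by (rule subspace_diff)
      show "?w c' = (pullback_conn M N f (\<lambda>q. ?\<omega> q (X q)) p u - ?\<omega> p (levi_civita M X p u)) c'"
        unfolding minus_apply pc(2) \<omega>lc(2) lc(2) Xv N.coord_vec_self[OF c'] X(2) cof_df_coords(2)[OF c c' v]
        by (simp add: matrix_vector_right_distrib algebra_simps)
    qed
  qed
  \<comment> \<open>an admissible local extension exists, so that the description is not vacuous\<close>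
  have ex: "\<exists>U X. openin (mtop M) U \<and> p \<in> U \<and> Ck_section 1 M M (\<lambda>q. q) U X \<and> X p = v"
  proof (intro exI conjI)
    let ?X = "\<lambda>q. coord_vec M c q (v c)"
    show "openin (mtop M) (fst c)" "p \<in> fst c" using point M.chart_open by auto
    show "?X p = v" by (rule M.coord_vec_coords[OF c v])
    show "Ck_section 1 M M (\<lambda>q. q) (fst c) ?X"
      unfolding Ck_section_def
    proof (intro conjI ballI)
      fix q assume "q \<in> fst c"
      then show "?X q \<in> tangent_space M q" using M.coord_vec_tangent[of c q] point by (simp add: M.charts_at_iff)
    next
      fix c1 c2 assume a: "c1 \<in> atlas M" "c2 \<in> atlas M"
      let ?T = "snd c1 ` {q \<in> fst c1 \<inter> fst c. q \<in> fst c2}"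
      have T: "?T = snd c1 ` (fst c1 \<inter> (fst c \<inter> fst c2))" by (rule arg_cong[of _ _ "(`) (snd c1)"]) blast
      have To: "open ?T" unfolding T by (intro M.chart_image_open openin_Int M.chart_open a point)
      define L where "L y w = frechet_derivative (transition c c2) (at y) w" for y w
      have 2: "Ck_on (Suc (Suc 0)) (snd c ` (fst c \<inter> fst c2)) (transition c c2)" by (rule M.transition_Ck[OF point(1) a(2)])
      have eq: "?X (chart_inv c1 x) c2 = L (transition c1 c x) (v c)" if "x \<in> ?T" for x
        using that a point by (auto simp: coord_vec_def L_def M.charts_at_iff)
      have inS: "transition c1 c x \<in> snd c ` (fst c \<inter> fst c2)" "x \<in> snd c1 ` (fst c1 \<inter> fst c)" if "x \<in> ?T" for x
        using that a by auto
      have dT: "(transition c1 c has_derivative frechet_derivative (transition c1 c) (at x)) (at x)" if "x \<in> ?T" for x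
        using Ck_on_SucD(1)[OF M.transition_Ck inS(2)[OF that]] a point by blast
      have dL: "((\<lambda>y. L y (v c)) has_derivative frechet_derivative (\<lambda>y. L y (v c)) (at y)) (at y)"
        if "y \<in> snd c ` (fst c \<inter> fst c2)" for y
        unfolding L_def by (rule Ck_on_SucD(1)[OF Ck_on_SucD(2)[OF 2] that])
      have D: "((\<lambda>x. ?X (chart_inv c1 x) c2) has_derivative
        (\<lambda>h. frechet_derivative (\<lambda>y. L y (v c)) (at (transition c1 c x)) (frechet_derivative (transition c1 c) (at x) h))) (at x)"
        if "x \<in> ?T" for x
        by (rule has_derivative_transform_within_open[OF has_derivative_compose[OF dT[OF that] dL[OF inS(1)[OF that]]] To that])
          (rule eq[symmetric])
      show "Ck_on 1 ?T (\<lambda>x. ?X (chart_inv c1 x) c2)"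
        unfolding One_nat_def Ck_on.simps
      proof (intro conjI ballI allI)
        fix x assume "x \<in> ?T" then show "(\<lambda>x. ?X (chart_inv c1 x) c2) differentiable at x"
          using D differentiable_def by blast
      next
        fix h
        have "continuous_on ?T (\<lambda>x. frechet_derivative (\<lambda>y. L y (v c)) (at (transition c1 c x)) (frechet_derivative (transition c1 c) (at x) h))"
        proof (rule continuous_on_frechet_apply)
          show "Ck_on (Suc 0) (snd c ` (fst c \<inter> fst c2)) (\<lambda>y. L y (v c))" unfolding L_def by (rule Ck_on_SucD(2)[OF 2])
          show "continuous_on ?T (transition c1 c)"
            using has_derivative_continuous[OF dT] by (auto simp: continuous_on_eq_continuous_within intro: continuous_at_imp_continuous_at_within)
          show "transition c1 c ` ?T \<subseteq> snd c ` (fst c \<inter> fst c2)" using inS by blast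
          have "Ck_on 0 (snd c1 ` (fst c1 \<inter> fst c)) (\<lambda>x. frechet_derivative (transition c1 c) (at x) h)"
            by (rule Ck_on_SucD(2)[OF M.transition_Ck[OF a(1) point(1)]])
          then show "continuous_on ?T (\<lambda>x. frechet_derivative (transition c1 c) (at x) h)"
            using inS(2) by (auto intro: continuous_on_subset)
        qed
        moreover have "frechet_derivative (\<lambda>x. ?X (chart_inv c1 x) c2) (at x) h =
          frechet_derivative (\<lambda>y. L y (v c)) (at (transition c1 c x)) (frechet_derivative (transition c1 c) (at x) h)" if "x \<in> ?T" for x
          using fun_cong[OF frechet_derivative_at[OF D[OF that]], of h] by (rule sym)
        ultimately show "continuous_on ?T (\<lambda>x. frechet_derivative (\<lambda>x. ?X (chart_inv c1 x) c2) (at x) h)"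
          by (subst continuous_on_cong[OF refl]) auto
      qed
    qed
  qed
  have "hom_conn M N f ?\<omega> p u v = ?w"
    unfolding hom_conn_def
  proof (rule the_equality, intro allI impI)
    fix U X assume "openin (mtop M) U \<and> p \<in> U \<and> Ck_section 1 M M (\<lambda>q. q) U X \<and> X p = v"
    then show "?w = pullback_conn M N f (\<lambda>q. ?\<omega> q (X q)) p u - ?\<omega> p (levi_civita M X p u)" using indep by blast
  next
    fix w assume w: "\<forall>U X. openin (mtop M) U \<and> p \<in> U \<and> Ck_section 1 M M (\<lambda>q. q) U X \<and> X p = v \<longrightarrow>
      w = pullback_conn M N f (\<lambda>q. ?\<omega> q (X q)) p u - ?\<omega> p (levi_civita M X p u)"
    obtain U X where UX: "openin (mtop M) U \<and> p \<in> U \<and> Ck_section 1 M M (\<lambda>q. q) U X \<and> X p = v" using ex by blast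
    then have "w = pullback_conn M N f (\<lambda>q. ?\<omega> q (X q)) p u - ?\<omega> p (levi_civita M X p u)" using w by blast
    also have "\<dots> = ?w" by (rule sym, rule indep) (use UX in blast)+
    finally show "w = ?w" .
  qed
  then show "hom_conn M N f ?\<omega> p u v \<in> tangent_space N (f p)" "hom_conn M N f ?\<omega> p u v c' = ?val"
    using w N.coord_vec_self[OF c'] by simp_all
qed

lemma divergence_cof_zero:
  assumes e: "orthonormal_basis (tangent M p) e"
  shows "(\<Sum>i<CARD('n). hom_conn M N f (cof_df M N f) p (e ! i) (e ! i)) = 0"
proof -
  interpret P: piola_at_point "metric_matrix M c (snd c p)" "metric_matrix N c' (snd c' (f p))" "jacm c c' (snd c p)"
    "cof_matrix c c' (snd c p)" "cof_lowered c c' (snd c p)" "cofm (jacm c c' (snd c p))"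
    "M.dmetric c (snd c p)" "N.dmetric c' (snd c' (f p))" "\<lambda>h. dcofm (jacm c c' (snd c p)) (djacm c c' (snd c p) h)"
    "christoffel_map M c (snd c p)" "christoffel_map N c' (snd c' (f p))" "sM c (snd c p)" "sN c' (snd c' (f p))"
    "det (jacm c c' (snd c p))" "\<lambda>i. (e ! i) c" "CARD('n)"
    by (rule pointwise_at[OF e])
  obtain C' where C': "(cof_matrix c c' has_derivative C') (at (snd c p))" using cof_matrix_differentiable by blast
  obtain R' where R': "(cof_lowered c c' has_derivative R') (at (snd c p))" using cof_lowered_differentiable by blast
  have eT: "e ! i \<in> tangent_space M p" if "i < CARD('n)" for i
    using e that M.vdim_tangent[OF M.charts_atD(1)[OF c]] by (auto simp: orthonormal_basis_def tangent_def)
  have near: "\<exists>q. x = snd c q \<and> c \<in> charts_at M q \<and> c' \<in> charts_at N (f q)" if "x \<in> snd c ` chart_domain c c'" for x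
    using that point by (auto simp: chart_domain_def M.charts_at_iff N.charts_at_iff)
  note S = open_chart_domain[OF point(1,3)] point_in_chart_domain[OF c c']
  have z: "(\<Sum>i<CARD('n). C' ((e ! i) c) *v (e ! i) c + christoffel_map N c' (snd c' (f p)) (jacm c c' (snd c p) *v (e ! i) c) (cof_matrix c c' (snd c p) *v (e ! i) c)
      - cof_matrix c c' (snd c p) *v christoffel_map M c (snd c p) ((e ! i) c) ((e ! i) c)) = 0"
  proof (rule P.divergence_zero)
    show "linear R'" by (rule has_derivative_linear[OF R'])
    have 1: "((\<lambda>x. metric_matrix N c' (local_rep c c' f x) ** cof_matrix c c' x) has_derivative
      (\<lambda>h. metric_matrix N c' (snd c' (f p)) ** C' h + N.dmetric c' (snd c' (f p)) (jac c c' (snd c p) h) ** cof_matrix c c' (snd c p))) (at (snd c p))"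
      using has_derivative_matrix_mult[OF metric_N_has_derivative C'] point by simp
    have 2: "((\<lambda>x. cof_lowered c c' x ** metric_matrix M c x) has_derivative
      (\<lambda>h. cof_lowered c c' (snd c p) ** M.dmetric c (snd c p) h + R' h ** metric_matrix M c (snd c p))) (at (snd c p))"
      by (rule has_derivative_matrix_mult[OF R' M.metric_has_derivative[OF c]])
    have "((\<lambda>x. cof_lowered c c' x ** metric_matrix M c x) has_derivative
      (\<lambda>h. metric_matrix N c' (snd c' (f p)) ** C' h + N.dmetric c' (snd c' (f p)) (jac c c' (snd c p) h) ** cof_matrix c c' (snd c p))) (at (snd c p))"
    proof (rule has_derivative_transform_within_open[OF 1 S])
      fix x assume "x \<in> snd c ` chart_domain c c'"
      then obtain q where q: "x = snd c q" "c \<in> charts_at M q" "c' \<in> charts_at N (f q)" using near by blast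
      have "local_rep c c' f x = snd c' (f q)" using M.charts_atD[OF q(2)] by (simp add: q(1))
      then show "metric_matrix N c' (local_rep c c' f x) ** cof_matrix c c' x = cof_lowered c c' x ** metric_matrix M c x"
        using metric_cof_matrix[OF q(2,3)] by (simp add: q(1))
    qed
    from fun_cong[OF has_derivative_unique[OF this 2]]
    show "N.dmetric c' (snd c' (f p)) (jacm c c' (snd c p) *v u) ** cof_matrix c c' (snd c p) + metric_matrix N c' (snd c' (f p)) ** C' u =
      R' u ** metric_matrix M c (snd c p) + cof_lowered c c' (snd c p) ** M.dmetric c (snd c p) u" for u
      unfolding jacm_apply[OF c c'] by (simp add: add.commute)
    have 3: "((\<lambda>x. sM c x *\<^sub>R cof_lowered c c' x) has_derivative
      (\<lambda>h. sM c (snd c p) *\<^sub>R R' h + (sM c (snd c p) * P.trM h) *\<^sub>R cof_lowered c c' (snd c p))) (at (snd c p))"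
      unfolding P.trM_def by (rule has_derivative_scaleR[OF M.sqrt_det_has_derivative[OF c] R'])
    have 4: "((\<lambda>x. sN c' (local_rep c c' f x) *\<^sub>R cofm (jacm c c' x)) has_derivative
      (\<lambda>h. sN c' (snd c' (f p)) *\<^sub>R dcofm (jacm c c' (snd c p)) (djacm c c' (snd c p) h) +
        (sN c' (snd c' (f p)) * P.trN (jac c c' (snd c p) h)) *\<^sub>R cofm (jacm c c' (snd c p)))) (at (snd c p))"
      unfolding P.trN_def
      using has_derivative_scaleR[OF sN_has_derivative has_derivative_cofm[OF jacm_has_derivative]] point by simp
    have "((\<lambda>x. sN c' (local_rep c c' f x) *\<^sub>R cofm (jacm c c' x)) has_derivative
      (\<lambda>h. sM c (snd c p) *\<^sub>R R' h + (sM c (snd c p) * P.trM h) *\<^sub>R cof_lowered c c' (snd c p))) (at (snd c p))"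
    proof (rule has_derivative_transform_within_open[OF 3 S])
      fix x assume "x \<in> snd c ` chart_domain c c'"
      then obtain q where "x = snd c q" "c \<in> charts_at M q" using near by blast
      then show "sM c x *\<^sub>R cof_lowered c c' x = sN c' (local_rep c c' f x) *\<^sub>R cofm (jacm c c' x)"
        using M.sqrt_det_pos[of c q] by (simp add: cof_lowered_def)
    qed
    from fun_cong[OF has_derivative_unique[OF this 4]]
    show "(sM c (snd c p) * P.trM u) *\<^sub>R cof_lowered c c' (snd c p) + sM c (snd c p) *\<^sub>R R' u =
      (sN c' (snd c' (f p)) * P.trN (jacm c c' (snd c p) *v u)) *\<^sub>R cofm (jacm c c' (snd c p)) +
       sN c' (snd c' (f p)) *\<^sub>R dcofm (jacm c c' (snd c p)) (djacm c c' (snd c p) u)" for u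
      unfolding jacm_apply[OF c c'] by (simp add: add.commute)
  qed
  let ?h = "\<lambda>i. hom_conn M N f (cof_df M N f) p (e ! i) (e ! i)"
  note sub = N.subspace_tangent[OF c']
  show ?thesis
  proof (rule N.tangent_ext[OF _ _ c'])
    show "(\<Sum>i<CARD('n). ?h i) \<in> tangent_space N (f p)"
      by (rule subspace_sum[OF sub]) (use hom_conn_coords(1)[OF C'] eT in auto)
    show "0 \<in> tangent_space N (f p)" by (rule subspace_0[OF sub])
    show "(\<Sum>i<CARD('n). ?h i) c' = 0 c'"
      using z hom_conn_coords(2)[OF C' eT eT] unfolding jacm_apply[OF c c'] sum_fun_apply zero_fun_apply by simp
  qed
qed

text \<open>
  \<open>weighted_integrand\<close> gives the same value for every orthonormal basis, so the inner product of homomorphisms is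
  defined; the value is recognized as the divergence of \<open>V\<close> by the product rule.
\<close>

lemma integrand_divergence:
  assumes U: "openin (mtop M) U" "p \<in> U" and \<xi>: "\<forall>q\<in>U. \<xi> q \<in> tangent_space N (f q)"
    and d: "((\<lambda>x. \<xi> (chart_inv c x) c') has_derivative \<xi>') (at (snd c p))"
  defines "V \<equiv> \<lambda>x. sN c' (local_rep c c' f x) *\<^sub>R (transpose (cofm (jacm c c' x)) *v \<xi> (chart_inv c x) c')"
  shows "\<exists>V'. (V has_derivative V') (at (snd c p)) \<and>
    sM c (snd c p) * hom_ip (tangent M p) (tangent N (f p)) (cof_df M N f p) (pullback_conn M N f \<xi> p) =
    (\<Sum>j\<in>UNIV. V' (axis j 1) $ j)"
proof -
  let ?x = "snd c p" and ?y = "snd c' (f p)" and ?\<kappa> = "cofm (jacm c c' (snd c p))"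
  let ?\<kappa>' = "\<lambda>h. dcofm (jacm c c' (snd c p)) (djacm c c' (snd c p) h)"
  let ?\<Gamma> = "christoffel_map N c' ?y"
  define tr where "tr w = (\<Sum>a\<in>UNIV. ?\<Gamma> w (axis a 1) $ a)" for w
  let ?D = "\<lambda>j. (sN c' ?y * tr (jacm c c' ?x *v axis j 1)) * (\<xi> p c' \<bullet> (?\<kappa> *v axis j 1)) + sN c' ?y * (\<xi> p c' \<bullet> (?\<kappa>' (axis j 1) *v axis j 1)) +
      sN c' ?y * (\<xi>' (axis j 1) \<bullet> (?\<kappa> *v axis j 1))"
  have p: "p \<in> points M" "f p \<in> points N" using M.charts_atD[OF c] N.charts_atD[OF c'] by auto
  have vd: "vdim (tangent M p) = CARD('n)" using M.vdim_tangent p by simp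
  have sum_e: "sM c ?x * (\<Sum>i<CARD('n). metric N (f p) (cof_df M N f p (e ! i)) (pullback_conn M N f \<xi> p (e ! i))) = (\<Sum>j\<in>UNIV. ?D j)"
    if e: "orthonormal_basis (tangent M p) e" for e
  proof -
    interpret P: piola_at_point "metric_matrix M c (snd c p)" "metric_matrix N c' (snd c' (f p))" "jacm c c' (snd c p)"
      "cof_matrix c c' (snd c p)" "cof_lowered c c' (snd c p)" "cofm (jacm c c' (snd c p))"
      "M.dmetric c (snd c p)" "N.dmetric c' (snd c' (f p))" "\<lambda>h. dcofm (jacm c c' (snd c p)) (djacm c c' (snd c p) h)"
      "christoffel_map M c (snd c p)" "christoffel_map N c' (snd c' (f p))" "sM c (snd c p)" "sN c' (snd c' (f p))"
      "det (jacm c c' (snd c p))" "\<lambda>i. (e ! i) c" "CARD('n)"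
      by (rule pointwise_at[OF e])
    have eT: "e ! i \<in> tangent_space M p" if "i < CARD('n)" for i
      using e that vd by (auto simp: orthonormal_basis_def tangent_def)
    have "metric N (f p) (cof_df M N f p (e ! i)) (pullback_conn M N f \<xi> p (e ! i)) =
      (cof_matrix c c' ?x *v (e ! i) c) \<bullet> (metric_matrix N c' ?y *v (\<xi>' ((e ! i) c) + ?\<Gamma> (jacm c c' ?x *v (e ! i) c) (\<xi> p c')))"
      if "i < CARD('n)" for i
      using N.metric_coords[OF c' cof_df_coords(1)[OF c c' eT[OF that]] pullback_conn_coords(1)[OF c c' eT[OF that] U \<xi> d]]
      unfolding cof_df_coords(2)[OF c c' eT[OF that]] pullback_conn_coords(2)[OF c c' eT[OF that] U \<xi> d] jacm_apply[OF c c'] .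
    then have "(\<Sum>i<CARD('n). metric N (f p) (cof_df M N f p (e ! i)) (pullback_conn M N f \<xi> p (e ! i))) =
      (\<Sum>i<CARD('n). (cof_matrix c c' ?x *v (e ! i) c) \<bullet> (metric_matrix N c' ?y *v (\<xi>' ((e ! i) c) + ?\<Gamma> (jacm c c' ?x *v (e ! i) c) (\<xi> p c'))))"
      by (intro sum.cong) auto
    then show ?thesis using P.weighted_integrand[OF has_derivative_linear[OF d], of "\<xi> p c'"] by (simp add: P.trN_def tr_def)
  qed
  obtain e where e: "orthonormal_basis (tangent M p) e" using M.tangent_orthonormal_exists[OF p(1)] by blast
  have s: "sM c ?x > 0" by (rule M.sqrt_det_pos[OF c])
  have ip: "hom_ip (tangent M p) (tangent N (f p)) (cof_df M N f p) (pullback_conn M N f \<xi> p) = (\<Sum>j\<in>UNIV. ?D j) / sM c ?x"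
    unfolding hom_ip_def vd
  proof (rule the_equality, intro allI impI)
    fix e assume "orthonormal_basis (tangent M p) e"
    from sum_e[OF this] s show "(\<Sum>j\<in>UNIV. ?D j) / sM c ?x = (\<Sum>i<CARD('n). ip (tangent N (f p)) (cof_df M N f p (e ! i)) (pullback_conn M N f \<xi> p (e ! i)))"
      by (simp add: field_simps tangent_def)
  next
    fix r assume "\<forall>e. orthonormal_basis (tangent M p) e \<longrightarrow> r = (\<Sum>i<CARD('n). ip (tangent N (f p)) (cof_df M N f p (e ! i)) (pullback_conn M N f \<xi> p (e ! i)))"
    then have "r = (\<Sum>i<CARD('n). ip (tangent N (f p)) (cof_df M N f p (e ! i)) (pullback_conn M N f \<xi> p (e ! i)))" using e by blast
    with sum_e[OF e] s show "r = (\<Sum>j\<in>UNIV. ?D j) / sM c ?x" by (simp add: field_simps tangent_def)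
  qed
  let ?V' = "\<lambda>h. sN c' ?y *\<^sub>R (transpose ?\<kappa> *v \<xi>' h + transpose (?\<kappa>' h) *v \<xi> p c') + (sN c' ?y * tr (jac c c' ?x h)) *\<^sub>R (transpose ?\<kappa> *v \<xi> p c')"
  have "(V has_derivative ?V') (at ?x)"
    using has_derivative_scaleR[OF sN_has_derivative has_derivative_matrix_vector[OF bounded_linear.has_derivative[OF bounded_linear_transpose has_derivative_cofm[OF jacm_has_derivative]] d]] point
    by (simp add: V_def tr_def)
  moreover have "?V' (axis j 1) $ j = ?D j" for j
  proof -
    have "(transpose A *v w) $ j = w \<bullet> (A *v axis j 1)" for A :: "'n rmat" and w
      by (simp add: inner_axis_1 inner_transpose flip: transpose_matrix_vector)
    then show ?thesis by (simp add: jacm_apply[OF c c'] algebra_simps del: transpose_matrix_vector)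
  qed
  ultimately show ?thesis using ip s by (intro exI[of _ ?V'] conjI) auto
qed

end

lemma coderivative_cof_zero:
  assumes p: "p \<in> points M"
  shows "coderivative M N f (cof_df M N f) p = 0"
proof -
  obtain c where c: "c \<in> charts_at M p" using M.chart_at_exists[OF p] by blast
  obtain c' where c': "c' \<in> charts_at N (f p)" using N.chart_at_exists[OF map_points[OF p]] by blast
  obtain e where "orthonormal_basis (tangent M p) e" using M.tangent_orthonormal_exists[OF p] by blast
  then show ?thesis
    unfolding coderivative_def M.vdim_tangent[OF p]
    using divergence_cof_zero[OF c c'] by (intro the_equality) auto
qed

end

section \<open>Continuously differentiable functions\<close>

lemma Ck_1_I:
  assumes "\<And>x. x \<in> S \<Longrightarrow> (f has_derivative f' x) (at x)" "\<And>v. continuous_on S (\<lambda>x. f' x v)"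
  shows "Ck_on (Suc 0) S f"
  unfolding Ck_on.simps
proof (intro conjI ballI allI)
  fix x assume "x \<in> S" then show "f differentiable at x" using assms(1) differentiable_def by blast
next
  fix v
  show "continuous_on S (\<lambda>x. frechet_derivative f (at x) v)"
    using assms(2)[of v] by (rule continuous_on_eq) (use frechet_derivative_at[OF assms(1)] in metis)
qed

lemma Ck_1_E:
  assumes "Ck_on (Suc 0) S f"
  obtains f' where "\<And>x. x \<in> S \<Longrightarrow> (f has_derivative f' x) (at x)" "\<And>v. continuous_on S (\<lambda>x. f' x v)"
  using assms that[of "\<lambda>x. frechet_derivative f (at x)"] by (auto simp: frechet_derivative_works)

lemma Ck_1_continuous: "Ck_on (Suc 0) S f \<Longrightarrow> continuous_on S f"
  using Ck_1_E by (metis has_derivative_at_withinI has_derivative_continuous_on)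

lemma Ck_1_subset: "Ck_on (Suc 0) S f \<Longrightarrow> T \<subseteq> S \<Longrightarrow> Ck_on (Suc 0) T f"
  by (auto intro: continuous_on_subset)

lemma Ck_1_cong:
  assumes "Ck_on (Suc 0) S f" "open S" "\<And>x. x \<in> S \<Longrightarrow> f x = g x"
  shows "Ck_on (Suc 0) S g"
proof -
  obtain f' where "\<And>x. x \<in> S \<Longrightarrow> (f has_derivative f' x) (at x)" "\<And>v. continuous_on S (\<lambda>x. f' x v)"
    using Ck_1_E[OF assms(1)] by blast
  then show ?thesis
    by (intro Ck_1_I[of S g f'] has_derivative_transform_within_open[OF _ assms(2) _ assms(3)])
qed

lemma Ck_1_local:
  assumes "\<And>x. x \<in> S \<Longrightarrow> \<exists>T. open T \<and> x \<in> T \<and> Ck_on (Suc 0) T f"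
  shows "Ck_on (Suc 0) S f"
  unfolding Ck_on.simps
proof (intro conjI ballI allI)
  fix x assume "x \<in> S" then show "f differentiable at x" using assms by fastforce
next
  fix v
  show "continuous_on S (\<lambda>x. frechet_derivative f (at x) v)"
    unfolding continuous_on_eq_continuous_within
  proof
    fix x assume "x \<in> S"
    then obtain T where "open T" "x \<in> T" "Ck_on (Suc 0) T f" using assms by blast
    then have "continuous (at x) (\<lambda>x. frechet_derivative f (at x) v)"
      by (simp add: continuous_on_eq_continuous_at)
    then show "continuous (at x within S) (\<lambda>x. frechet_derivative f (at x) v)"
      by (rule continuous_at_imp_continuous_at_within)
  qed
qed

lemma Ck_1_const: "Ck_on (Suc 0) S (\<lambda>x. c)"
  by (rule Ck_1_I[of _ _ "\<lambda>x h. 0"]) auto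

lemma Ck_1_bounded_linear:
  assumes "bounded_linear L" "Ck_on (Suc 0) S f" shows "Ck_on (Suc 0) S (\<lambda>x. L (f x))"
proof -
  obtain f' where f': "\<And>x. x \<in> S \<Longrightarrow> (f has_derivative f' x) (at x)" "\<And>v. continuous_on S (\<lambda>x. f' x v)"
    using Ck_1_E[OF assms(2)] by blast
  show ?thesis
    by (rule Ck_1_I[of _ _ "\<lambda>x h. L (f' x h)"])
      (intro bounded_linear.has_derivative[OF assms(1)] bounded_linear.continuous_on[OF assms(1)] f' | assumption)+
qed

lemma Ck_1_add:
  assumes "Ck_on (Suc 0) S f" "Ck_on (Suc 0) S g" shows "Ck_on (Suc 0) S (\<lambda>x. f x + g x)"
proof -
  obtain f' where f': "\<And>x. x \<in> S \<Longrightarrow> (f has_derivative f' x) (at x)" "\<And>v. continuous_on S (\<lambda>x. f' x v)"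
    using Ck_1_E[OF assms(1)] by blast
  obtain g' where g': "\<And>x. x \<in> S \<Longrightarrow> (g has_derivative g' x) (at x)" "\<And>v. continuous_on S (\<lambda>x. g' x v)"
    using Ck_1_E[OF assms(2)] by blast
  show ?thesis
    by (rule Ck_1_I[of S _ "\<lambda>x h. f' x h + g' x h"])
      (intro has_derivative_add continuous_on_add f' g' | assumption)+
qed

lemma Ck_1_scaleR:
  fixes f :: "'a::real_normed_vector \<Rightarrow> real"
  assumes "Ck_on (Suc 0) S f" "Ck_on (Suc 0) S g" shows "Ck_on (Suc 0) S (\<lambda>x. f x *\<^sub>R g x)"
proof -
  obtain f' where f': "\<And>x. x \<in> S \<Longrightarrow> (f has_derivative f' x) (at x)" "\<And>v. continuous_on S (\<lambda>x. f' x v)"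
    using Ck_1_E[OF assms(1)] by blast
  obtain g' where g': "\<And>x. x \<in> S \<Longrightarrow> (g has_derivative g' x) (at x)" "\<And>v. continuous_on S (\<lambda>x. g' x v)"
    using Ck_1_E[OF assms(2)] by blast
  show ?thesis
    by (rule Ck_1_I[of S _ "\<lambda>x h. f x *\<^sub>R g' x h + f' x h *\<^sub>R g x"])
      (intro has_derivative_scaleR continuous_on_add continuous_on_scaleR Ck_1_continuous f' g' assms | assumption)+
qed

lemma Ck_1_mult:
  fixes f g :: "'a::real_normed_vector \<Rightarrow> real"
  assumes "Ck_on (Suc 0) S f" "Ck_on (Suc 0) S g" shows "Ck_on (Suc 0) S (\<lambda>x. f x * g x)"
  using Ck_1_scaleR[OF assms] by simp

lemma Ck_1_sum:
  "(\<And>i. i \<in> I \<Longrightarrow> Ck_on (Suc 0) S (f i)) \<Longrightarrow> Ck_on (Suc 0) S (\<lambda>x. \<Sum>i\<in>I. f i x)"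
  by (induction I rule: infinite_finite_induct) (auto intro!: Ck_1_add Ck_1_const simp del: Ck_on.simps)

lemma Ck_1_prod:
  fixes f :: "'i \<Rightarrow> 'a::real_normed_vector \<Rightarrow> real"
  shows "(\<And>i. i \<in> I \<Longrightarrow> Ck_on (Suc 0) S (f i)) \<Longrightarrow> Ck_on (Suc 0) S (\<lambda>x. \<Prod>i\<in>I. f i x)"
  by (induction I rule: infinite_finite_induct) (auto intro!: Ck_1_mult Ck_1_const simp del: Ck_on.simps)

lemma Ck_1_det:
  fixes B :: "'a::real_normed_vector \<Rightarrow> real^'n^'n"
  assumes "\<And>i j. Ck_on (Suc 0) S (\<lambda>x. B x $ i $ j)" shows "Ck_on (Suc 0) S (\<lambda>x. det (B x))"
  unfolding det_def by (intro Ck_1_sum Ck_1_mult Ck_1_const Ck_1_prod assms)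

lemma Ck_1_compose:
  fixes g :: "'b::euclidean_space \<Rightarrow> 'c::real_normed_vector"
  assumes f: "Ck_on (Suc 0) S f" and g: "Ck_on (Suc 0) T g" and sub: "f ` S \<subseteq> T"
  shows "Ck_on (Suc 0) S (\<lambda>x. g (f x))"
proof -
  obtain f' where f': "\<And>x. x \<in> S \<Longrightarrow> (f has_derivative f' x) (at x)" "\<And>v. continuous_on S (\<lambda>x. f' x v)"
    using Ck_1_E[OF f] by blast
  obtain g' where g': "\<And>x. x \<in> T \<Longrightarrow> (g has_derivative g' x) (at x)" "\<And>v. continuous_on T (\<lambda>x. g' x v)"
    using Ck_1_E[OF g] by blast
  show ?thesis
  proof (rule Ck_1_I)
    fix x assume x: "x \<in> S"
    show "((\<lambda>x. g (f x)) has_derivative (\<lambda>h. g' (f x) (f' x h))) (at x)"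
      using has_derivative_compose[OF f'(1)[OF x] g'(1)] sub x by blast
  next
    fix v
    have c: "continuous_on S (\<lambda>x. g' (f x) b)" for b
      using continuous_on_compose2[OF g'(2) Ck_1_continuous[OF f] sub] .
    have "continuous_on S (\<lambda>x. \<Sum>b\<in>Basis. (f' x v \<bullet> b) *\<^sub>R g' (f x) b)"
      by (intro continuous_on_sum continuous_on_scaleR continuous_on_inner f' c continuous_on_const)
    then show "continuous_on S (\<lambda>x. g' (f x) (f' x v))"
    proof (rule continuous_on_eq)
      fix x assume "x \<in> S"
      then have lin: "linear (g' (f x))" using has_derivative_linear[OF g'(1)] sub by blast
      have "g' (f x) (f' x v) = g' (f x) (\<Sum>b\<in>Basis. (f' x v \<bullet> b) *\<^sub>R b)" by (simp add: euclidean_representation)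
      then show "(\<Sum>b\<in>Basis. (f' x v \<bullet> b) *\<^sub>R g' (f x) b) = g' (f x) (f' x v)"
        by (simp add: linear_sum[OF lin] linear_cmul[OF lin])
    qed
  qed
qed

lemma Ck_1_real:
  fixes g :: "real \<Rightarrow> real"
  assumes "\<And>x. x \<in> S \<Longrightarrow> (g has_real_derivative g' x) (at x)" "continuous_on S g'"
  shows "Ck_on (Suc 0) S g"
  by (rule Ck_1_I[of S g "\<lambda>x h. g' x * h"])
    (use assms in \<open>auto intro!: continuous_on_mult_right simp: has_field_derivative_def\<close>)

lemma Ck_1_sqrt: "Ck_on (Suc 0) {0<..} sqrt"
  by (rule Ck_1_real[OF DERIV_real_sqrt]) (auto intro!: continuous_intros)

section \<open>A plateau function\<close>

text \<open>The square makes \<open>max 0\<close> continuously differentiable, which is all the smoothness required of a cutoff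
  here.\<close>

definition ramp :: "real \<Rightarrow> real" where "ramp t = (max 0 t)\<^sup>2"

lemma ramp_has_derivative: "(ramp has_real_derivative 2 * max 0 t) (at t)"
proof (cases t "0::real" rule: linorder_cases)
  case less
  have "((\<lambda>t. 0) has_real_derivative 0) (at t)" by simp
  then show ?thesis
    by (rule has_field_derivative_transform_within_open[of _ _ _ "{..<0}", THEN DERIV_cong]) (use less in \<open>auto simp: ramp_def\<close>)
next
  case greater
  have "((\<lambda>t. t\<^sup>2) has_real_derivative 2 * t) (at t)" by (auto intro!: derivative_eq_intros)
  then show ?thesis
    by (rule has_field_derivative_transform_within_open[of _ _ _ "{0<..}", THEN DERIV_cong]) (use greater in \<open>auto simp: ramp_def\<close>)
next
  case equal
  have "((\<lambda>h. max 0 h * max 0 h / h) \<longlongrightarrow> 0) (at (0::real))"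
  proof (rule Lim_null_comparison)
    show "\<forall>\<^sub>F h in at (0::real). norm (max 0 h * max 0 h / h) \<le> \<bar>h\<bar>"
      by (auto simp: eventually_at_filter max_def)
    show "((\<lambda>h::real. \<bar>h\<bar>) \<longlongrightarrow> 0) (at 0)" by (auto intro!: tendsto_eq_intros)
  qed
  then show ?thesis using equal by (simp add: DERIV_def ramp_def power2_eq_square)
qed

text \<open>The inner ramp is at least \<open>1/4\<close> on the ball of squared radius \<open>1/2\<close>, and so 4 times it is at least 1 there and the
  outer ramp is 0.  Outside the unit ball the inner ramp is 0 and the outer one is 1.\<close>

definition plateau :: "'a::real_inner \<Rightarrow> real"
  where "plateau y = 1 - ramp (1 - 4 * ramp (1 - y \<bullet> y))"

lemma plateau_one: "y \<bullet> y \<le> 1/2 \<Longrightarrow> plateau y = 1"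
proof -
  assume "y \<bullet> y \<le> 1/2"
  then have "(1/2)\<^sup>2 \<le> (1 - y \<bullet> y)\<^sup>2" by (intro power_mono) auto
  then have "ramp (1 - y \<bullet> y) \<ge> 1/4" using \<open>y \<bullet> y \<le> 1/2\<close> by (simp add: ramp_def power2_eq_square)
  then show ?thesis by (simp add: plateau_def ramp_def[of "1 - 4 * _"])
qed

lemma plateau_zero: "y \<bullet> y \<ge> 1 \<Longrightarrow> plateau y = 0"
  by (simp add: plateau_def ramp_def)

lemma Ck_1_ramp: "Ck_on (Suc 0) UNIV ramp"
  by (rule Ck_1_real[OF ramp_has_derivative]) (intro continuous_intros)

lemma Ck_1_plateau: "Ck_on (Suc 0) UNIV (plateau :: 'a::euclidean_space \<Rightarrow> real)"
proof -
  have inner: "Ck_on (Suc 0) UNIV (\<lambda>y::'a. y \<bullet> y)"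
    by (rule Ck_1_I[of _ _ "\<lambda>y h. y \<bullet> h + h \<bullet> y"]) (intro has_derivative_inner has_derivative_ident continuous_intros)+
  have aff: "Ck_on (Suc 0) UNIV (\<lambda>y::'a. 1 + (-a) * g y)" if "Ck_on (Suc 0) UNIV g" for a :: real and g
    using that by (intro Ck_1_add Ck_1_mult Ck_1_const)
  have "Ck_on (Suc 0) UNIV (\<lambda>y::'a. 1 + (-1) * ramp (1 + (-4) * ramp (1 + (-1) * (y \<bullet> y))))"
    by (intro aff Ck_1_compose[OF _ Ck_1_ramp] inner) auto
  then show ?thesis by (simp add: plateau_def[abs_def] del: Ck_on.simps)
qed

section \<open>The divergence theorem for compactly supported fields\<close>

text \<open>Translation invariance: the difference quotients in the direction \<open>e\<close> integrate to 0.  They converge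
  dominatedly to the directional derivative, being bounded by the mean value theorem and supported in a ball.\<close>

lemma integral_directional_derivative_zero:
  fixes h :: "'a::euclidean_space \<Rightarrow> real"
  assumes h: "\<And>x. (h has_derivative h' x) (at x)" and cont: "continuous_on UNIV (\<lambda>x. h' x e)"
    and K: "compact K" "\<And>x. x \<notin> K \<Longrightarrow> h x = 0"
  shows "has_bochner_integral lborel (\<lambda>x. h' x e) 0"
proof -
  let ?g = "\<lambda>x. h' x e"
  have g0: "?g x = 0" if "x \<notin> K" for x
  proof -
    have "((\<lambda>x. 0) has_derivative (\<lambda>h. 0)) (at x)" by simp
    then have "(h has_derivative (\<lambda>h. 0)) (at x)"
      by (rule has_derivative_transform_within_open[of _ _ _ _ "- K"]) (use that K in \<open>auto simp: open_Compl compact_imp_closed\<close>)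
    from has_derivative_unique[OF this h] show ?thesis by metis
  qed
  obtain B where B: "\<And>x. \<bar>?g x\<bar> \<le> B" "B \<ge> 0"
  proof -
    have "bounded (?g ` K)" by (intro compact_imp_bounded compact_continuous_image continuous_on_subset[OF cont] K) auto
    then obtain B where "\<And>x. x \<in> K \<Longrightarrow> \<bar>?g x\<bar> \<le> B" "B > 0" by (auto simp: bounded_pos)
    then show ?thesis using that[of B] g0 by (metis abs_zero less_imp_le)
  qed
  obtain r where "\<forall>x\<in>K. norm x \<le> r" using compact_imp_bounded[OF K(1)] unfolding bounded_iff by blast
  then have r: "K \<subseteq> cball 0 r" by auto
  have hc: "continuous_on UNIV h" using h by (meson has_derivative_at_withinI has_derivative_continuous_on)
  have hm: "h \<in> borel_measurable borel" using hc by (rule borel_measurable_continuous_onI)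
  have int_h: "integrable lborel h"
  proof -
    have "integrable lborel (\<lambda>x. indicator K x *\<^sub>R h x)"
      by (rule borel_integrable_compact[OF K(1) continuous_on_subset[OF hc]]) simp
    then show ?thesis
      by (rule Bochner_Integration.integrable_cong[THEN iffD1, rotated -1]) (use K(2) in \<open>auto simp: indicator_def\<close>)
  qed
  define t where "t n = 1 / real (Suc n)" for n
  have t: "0 < t n" "t n \<le> 1" for n by (auto simp: t_def)
  define q where "q n x = (h (t n *\<^sub>R e + x) - h x) / t n" for n x
  have shift: "integrable lborel (\<lambda>x. h (c + x))" "(\<integral>x. h (c + x) \<partial>lborel) = (\<integral>x. h x \<partial>lborel)" for c
  proof -
    have d: "distr lborel borel ((+) c) = lborel" by (rule lborel_distr_plus)
    have m: "(+) c \<in> measurable lborel borel" by simp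
    show "integrable lborel (\<lambda>x. h (c + x))"
      using integrable_distr_eq[OF m hm] int_h unfolding d by simp
    show "(\<integral>x. h (c + x) \<partial>lborel) = (\<integral>x. h x \<partial>lborel)"
      using integral_distr[OF m hm] unfolding d by simp
  qed
  have q0: "(\<integral>x. q n x \<partial>lborel) = 0" for n
    unfolding q_def using shift[of "t n *\<^sub>R e"] int_h by simp
  have lim: "(\<lambda>n. q n x) \<longlonglongrightarrow> ?g x" for x
  proof -
    have "((\<lambda>s. x + s *\<^sub>R e) has_derivative (\<lambda>s. s *\<^sub>R e)) (at 0)" by (auto intro!: derivative_eq_intros)
    from has_derivative_compose[OF this, of h "h' x"]
    have "((\<lambda>s. h (x + s *\<^sub>R e)) has_derivative (\<lambda>s. h' x (s *\<^sub>R e))) (at 0)" using h by simp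
    then have "((\<lambda>s. h (x + s *\<^sub>R e)) has_real_derivative ?g x) (at 0)"
      unfolding has_field_derivative_def
      by (rule has_derivative_eq_rhs) (simp add: fun_eq_iff linear_cmul[OF has_derivative_linear[OF h]])
    then have "((\<lambda>s. (h (x + s *\<^sub>R e) - h x) / s) \<longlongrightarrow> ?g x) (at 0)" by (simp add: DERIV_def)
    moreover have "filterlim t (at 0) sequentially"
      unfolding filterlim_at t_def using LIMSEQ_Suc[OF lim_1_over_n[where ?'a = real]] by auto
    ultimately have "(\<lambda>n. (h (x + t n *\<^sub>R e) - h x) / t n) \<longlonglongrightarrow> ?g x" by (rule filterlim_compose)
    then show ?thesis unfolding q_def by (simp add: add.commute)
  qed
  have bound: "norm (q n x) \<le> B * indicator (cball 0 (r + norm e)) x" for n x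
  proof (cases "x \<in> cball 0 (r + norm e)")
    case True
    have "\<exists>s. 0 < s \<and> s < t n \<and> h (x + t n *\<^sub>R e) - h (x + 0 *\<^sub>R e) = (t n - 0) * ?g (x + s *\<^sub>R e)"
    proof (rule MVT2[of 0 "t n" "\<lambda>s. h (x + s *\<^sub>R e)" "\<lambda>s. ?g (x + s *\<^sub>R e)", OF t(1)])
      fix s
      have "((\<lambda>s. x + s *\<^sub>R e) has_derivative (\<lambda>s. s *\<^sub>R e)) (at s)" by (auto intro!: derivative_eq_intros)
      from has_derivative_compose[OF this h]
      show "((\<lambda>s. h (x + s *\<^sub>R e)) has_real_derivative ?g (x + s *\<^sub>R e)) (at s)"
        unfolding has_field_derivative_def
        by (rule has_derivative_eq_rhs) (simp add: fun_eq_iff linear_cmul[OF has_derivative_linear[OF h]])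
    qed
    then obtain s where "h (x + t n *\<^sub>R e) - h x = t n * ?g (x + s *\<^sub>R e)" by auto
    then have "q n x = ?g (x + s *\<^sub>R e)" using t(1)[of n] by (simp add: q_def add.commute)
    then show ?thesis using True B by simp
  next
    case False
    have "x \<notin> K" using False r by (auto simp: subset_iff) (smt (verit) norm_ge_zero)
    moreover have "t n *\<^sub>R e + x \<notin> K"
    proof
      assume "t n *\<^sub>R e + x \<in> K"
      then have "norm (t n *\<^sub>R e + x) \<le> r" using r by auto
      moreover have "norm (t n *\<^sub>R e) \<le> norm e" using t[of n] by (simp add: mult_left_le_one_le)
      ultimately have "norm x \<le> r + norm e" using norm_triangle_ineq4[of "t n *\<^sub>R e + x" "t n *\<^sub>R e"] by simp
      then show False using False by simp
    qed
    ultimately show ?thesis using K(2) False by (simp add: q_def)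
  qed
  have w: "integrable lborel (\<lambda>x::'a. B * indicator (cball 0 (r + norm e)) x)"
    using emeasure_bounded_finite[OF bounded_cball, of "0 :: 'a" "r + norm e"]
    by (intro integrable_mult_right integrable_real_indicator) auto
  have qm: "q n \<in> borel_measurable lborel" for n
    unfolding q_def using hm by measurable
  have gm: "?g \<in> borel_measurable lborel" using borel_measurable_continuous_onI[OF cont] by simp
  have "integrable lborel ?g"
    by (rule integrable_dominated_convergence[where s = q, OF gm qm w]) (use lim bound in auto)
  moreover have "(\<lambda>n. \<integral>x. q n x \<partial>lborel) \<longlonglongrightarrow> (\<integral>x. ?g x \<partial>lborel)"
    by (rule integral_dominated_convergence[where s = q, OF gm qm w]) (use lim bound in auto)
  then have "(\<integral>x. ?g x \<partial>lborel) = 0" unfolding q0 by (simp add: LIMSEQ_const_iff)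
  ultimately show ?thesis by (simp add: has_bochner_integral_iff)
qed

section \<open>Change of variables for nonnegative functions\<close>

text \<open>
  The change of variables theorem \<open>has_absolute_integral_change_of_variables\<close> is stated for wellordered index types.  A finite linear
  order is a wellorder; a copy of the index type carries this as a class instance.
\<close>

typedef 'n indices = "UNIV :: 'n set" by simp

instantiation indices :: (linorder) linorder
begin
definition "less_eq_indices i j \<longleftrightarrow> Rep_indices i \<le> Rep_indices j"
definition "less_indices i j \<longleftrightarrow> Rep_indices i < Rep_indices j"
instance
proof
  fix x y z :: "'a indices"
  show "x < y \<longleftrightarrow> x \<le> y \<and> \<not> y \<le> x" unfolding less_eq_indices_def less_indices_def by (rule less_le_not_le)
  show "x \<le> x" "x \<le> y \<or> y \<le> x" unfolding less_eq_indices_def by auto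
  show "x \<le> y \<Longrightarrow> y \<le> z \<Longrightarrow> x \<le> z" unfolding less_eq_indices_def by (rule order_trans)
  show "x \<le> y \<Longrightarrow> y \<le> x \<Longrightarrow> x = y"
    unfolding less_eq_indices_def by (simp add: order_antisym flip: Rep_indices_inject)
qed
end

lemma bij_Rep_indices: "bij Rep_indices"
  by (metis bij_def injI Rep_indices_inject surj_def Abs_indices_inverse UNIV_I)

instance indices :: (finite) finite
  by standard (metis (mono_tags) bij_Rep_indices bij_betw_finite finite_code)

instance indices :: ("{finite, linorder}") wellorder
proof
  fix P :: "'a indices \<Rightarrow> bool" and a
  assume step: "\<And>x. (\<And>y. y < x \<Longrightarrow> P y) \<Longrightarrow> P x"
  show "P a"
  proof (induction "card {y. y < a}" arbitrary: a rule: less_induct)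
    case less
    show ?case
    proof (rule step)
      fix y assume "y < a"
      then have "card {z. z < y} < card {z. z < a}" by (intro psubset_card_mono) auto
      then show "P y" by (rule less)
    qed
  qed
qed

definition reindex :: "'n::{finite,linorder} rvec \<Rightarrow> 'n indices rvec"
  where "reindex x = (\<chi> i. x $ Rep_indices i)"

definition unindex :: "'n::{finite,linorder} indices rvec \<Rightarrow> 'n rvec"
  where "unindex x = (\<chi> i. x $ Abs_indices i)"

lemma reindex_inverse [simp]: "unindex (reindex x) = x" "reindex (unindex y) = y"
  by (auto simp: reindex_def unindex_def vec_eq_iff Rep_indices_inverse Abs_indices_inverse)

lemma bounded_linear_reindex: "bounded_linear reindex" "bounded_linear unindex"
  unfolding linear_conv_bounded_linear[symmetric]
  by (auto intro!: linearI simp: reindex_def unindex_def vec_eq_iff)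

lemma measurable_reindex [measurable]: "reindex \<in> borel_measurable borel" "unindex \<in> borel_measurable borel"
  using bounded_linear_reindex by (auto intro!: borel_measurable_continuous_onI linear_continuous_on)

lemma lborel_reindex: "distr lborel borel (unindex :: 'n::{finite,linorder} indices rvec \<Rightarrow> 'n rvec) = lborel"
proof (rule lborel_eqI[symmetric])
  fix l u :: "'n rvec" assume lu: "\<And>b. b \<in> Basis \<Longrightarrow> l \<bullet> b \<le> u \<bullet> b"
  have vimage: "unindex -` box l u = box (reindex l) (reindex u)"
  proof -
    have "(\<forall>i. l $ i < x $ Abs_indices i \<and> x $ Abs_indices i < u $ i) \<longleftrightarrow>
      (\<forall>i. l $ Rep_indices i < x $ i \<and> x $ i < u $ Rep_indices i)" for x :: "'n indices rvec"
      by (metis Abs_indices_inverse Rep_indices_inverse UNIV_I)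
    then show ?thesis by (auto simp: mem_box_cart unindex_def reindex_def)
  qed
  have pi: "prod ((\<bullet>) y) Basis = (\<Prod>i\<in>UNIV. y $ i)" for y :: "real^'m::finite"
  proof -
    have basis: "Basis = range (\<lambda>i::'m. axis i (1::real))" by (auto simp: Basis_vec_def)
    have "inj (\<lambda>i::'m. axis i (1::real))" by (simp add: inj_on_def axis_eq_axis)
    then show ?thesis unfolding basis by (simp add: prod.reindex inner_axis o_def)
  qed
  have "emeasure (distr lborel borel unindex) (box l u) = emeasure lborel (box (reindex l) (reindex u))"
    by (subst emeasure_distr) (auto simp: vimage)
  also have "\<dots> = ennreal (prod ((\<bullet>) (reindex u - reindex l)) Basis)"
  proof (rule emeasure_lborel_box)
    fix b :: "'n indices rvec" assume "b \<in> Basis"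
    then obtain i where "b = axis i 1" by (auto simp: Basis_vec_def)
    then show "reindex l \<bullet> b \<le> reindex u \<bullet> b"
      using lu[of "axis (Rep_indices i) 1"] by (simp add: inner_axis reindex_def axis_in_Basis_iff)
  qed
  also have "prod ((\<bullet>) (reindex u - reindex l)) Basis = prod ((\<bullet>) (u - l)) Basis"
    unfolding pi using prod.reindex_bij_betw[OF bij_Rep_indices, of "\<lambda>i. u $ i - l $ i"] by (simp add: reindex_def)
  finally show "emeasure (distr lborel borel unindex) (box l u) = ennreal (prod ((\<bullet>) (u - l)) Basis)" .
qed simp


text \<open>Finite values suffice to compare nonnegative integrals, and for them the Lebesgue and the Henstock--Kurzweil
  integrals agree.\<close>

lemma nonneg_integral_iff:
  fixes u :: "'a::euclidean_space \<Rightarrow> real"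
  assumes m: "(\<lambda>x. indicator A x * u x) \<in> borel_measurable borel" and pos: "\<And>x. x \<in> A \<Longrightarrow> 0 \<le> u x" and r: "0 \<le> r"
  shows "(\<integral>\<^sup>+x. ennreal (indicator A x * u x) \<partial>lborel) = ennreal r \<longleftrightarrow>
    u absolutely_integrable_on A \<and> integral A u = r"
proof -
  have pos': "0 \<le> indicator A x * u x" for x using pos by (auto simp: indicator_def)
  have restrict: "(\<lambda>x. if x \<in> A then u x else 0) = (\<lambda>x. indicator A x * u x)" by (auto simp: fun_eq_iff)
  have "(\<integral>\<^sup>+x. ennreal (indicator A x * u x) \<partial>lborel) = ennreal r \<longleftrightarrow> ((\<lambda>x. indicator A x * u x) has_integral r) UNIV"
    using nn_integral_has_integral[OF m pos' _ r] nn_integral_has_integral_lborel[OF m pos'] by blast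
  also have "\<dots> \<longleftrightarrow> (u has_integral r) A"
    using has_integral_restrict_UNIV[of A u r] by (simp only: restrict)
  also have "\<dots> \<longleftrightarrow> u absolutely_integrable_on A \<and> integral A u = r"
    using nonnegative_absolutely_integrable_1[of u A] pos
    by (auto simp: has_integral_iff dest: absolutely_integrable_on_def[THEN iffD1])
  finally show ?thesis .
qed

text \<open>Conjugation with a bijection of the index types matches the permutations and preserves their signs.\<close>

lemma det_reindex:
  assumes "A = (\<chi> i j. B $ Rep_indices i $ Rep_indices j)" shows "det A = det (B :: real^'n::finite^'n)"
proof -
  have c: "Abs_indices (Rep_indices i) = i" "Rep_indices (Abs_indices k) = k" for i k
    by (simp_all add: Rep_indices_inverse Abs_indices_inverse)
  have inv: "inv Rep_indices = (Abs_indices :: 'n \<Rightarrow> _)"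
    using c by (intro inv_unique_comp) (auto simp: fun_eq_iff)
  have bij: "bij_betw (\<lambda>p i. Rep_indices (p (Abs_indices i))) {p. p permutes (UNIV :: 'n indices set)} {p. p permutes (UNIV :: 'n set)}"
    using bij_betw_permutations[OF bij_Rep_indices[where ?'a = 'n]] by (simp add: inv)
  have sign: "sign (\<lambda>i. Rep_indices (p (Abs_indices i))) = sign p" if "p permutes UNIV" for p :: "'n indices \<Rightarrow> 'n indices"
  proof -
    have "map_permutation UNIV Rep_indices p = (\<lambda>i. Rep_indices (p (Abs_indices i)))"
      using bij_Rep_indices[where ?'a = 'n] by (auto simp: map_permutation_def restrict_id_def fun_eq_iff bij_def inv)
    then show ?thesis
      using sign_map_permutation[of Rep_indices UNIV p] bij_Rep_indices[where ?'a = 'n] that by (simp add: bij_def)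
  qed
  have "det B = (\<Sum>p | p permutes (UNIV :: 'n indices set). of_int (sign (\<lambda>i. Rep_indices (p (Abs_indices i)))) *
      (\<Prod>i\<in>UNIV. B $ i $ Rep_indices (p (Abs_indices i))))"
    unfolding det_def by (rule sum.reindex_bij_betw[OF bij, symmetric])
  also have "\<dots> = det A"
    unfolding det_def
  proof (rule sum.cong)
    fix p :: "'n indices \<Rightarrow> 'n indices" assume "p \<in> {p. p permutes UNIV}"
    moreover have "(\<Prod>i\<in>UNIV. B $ i $ Rep_indices (p (Abs_indices i))) = (\<Prod>i\<in>UNIV. A $ i $ p i)"
      using prod.reindex_bij_betw[OF bij_Rep_indices[where ?'a = 'n], of "\<lambda>i. B $ i $ Rep_indices (p (Abs_indices i))"] by (simp add: assms c)
    ultimately show "of_int (sign (\<lambda>i. Rep_indices (p (Abs_indices i)))) * (\<Prod>i\<in>UNIV. B $ i $ Rep_indices (p (Abs_indices i))) =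
      of_int (sign p) * (\<Prod>i\<in>UNIV. A $ i $ p i)" by (simp add: sign)
  qed simp
  finally show ?thesis by simp
qed

lemma nn_integral_change_of_variables_wellorder:
  fixes f :: "'m::{finite,wellorder} rvec \<Rightarrow> real" and g :: "'m rvec \<Rightarrow> 'm rvec"
  assumes S: "S \<in> sets borel"
    and g: "\<And>x. x \<in> S \<Longrightarrow> (g has_derivative g' x) (at x within S)" "inj_on g S"
    and m: "(\<lambda>y. indicator (g ` S) y * f y) \<in> borel_measurable borel"
      "(\<lambda>x. indicator S x * (\<bar>det (matrix (g' x))\<bar> * f (g x))) \<in> borel_measurable borel"
    and pos: "\<And>y. y \<in> g ` S \<Longrightarrow> 0 \<le> f y"
  shows "(\<integral>\<^sup>+y. ennreal (indicator (g ` S) y * f y) \<partial>lborel) =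
    (\<integral>\<^sup>+x. ennreal (indicator S x * (\<bar>det (matrix (g' x))\<bar> * f (g x))) \<partial>lborel)" (is "?l = ?r")
proof -
  have "S \<in> sets lebesgue" using S by auto
  from has_absolute_integral_change_of_variables[OF this g, of "\<lambda>y. vec (f y) :: real^1" "vec b" for b]
  have cv: "(\<lambda>x. \<bar>det (matrix (g' x))\<bar> * f (g x)) absolutely_integrable_on S \<and> integral S (\<lambda>x. \<bar>det (matrix (g' x))\<bar> * f (g x)) = b \<longleftrightarrow>
    f absolutely_integrable_on (g ` S) \<and> integral (g ` S) f = b" for b
    by (simp add: absolutely_integrable_on_1_iff integral_on_1_eq vec_eq_iff)
  have iff: "?l = ennreal b \<longleftrightarrow> ?r = ennreal b" if "0 \<le> b" for b
    using nonneg_integral_iff[OF m(1) pos that] nonneg_integral_iff[OF m(2) _ that] cv[of b] pos by auto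
  have "l = r" if "\<And>b. 0 \<le> b \<Longrightarrow> l = ennreal b \<longleftrightarrow> r = ennreal b" for l r
  proof (cases l)
    case (real b)
    then show ?thesis using that[of b] by simp
  next
    case l: top
    show ?thesis
    proof (cases r)
      case (real b)
      then show ?thesis using that[of b] by simp
    qed (use l in simp)
  qed
  from this[of ?l ?r] iff show ?thesis by blast
qed

text \<open>Both sides are transported along the isometry \<^const>\<open>unindex\<close>.\<close>

lemma nn_integral_change_of_variables:
  fixes f :: "'n::{finite,linorder} rvec \<Rightarrow> real" and g :: "'n rvec \<Rightarrow> 'n rvec"
  assumes S: "S \<in> sets borel"
    and g: "\<And>x. x \<in> S \<Longrightarrow> (g has_derivative g' x) (at x)" "inj_on g S"
    and m: "(\<lambda>y. indicator (g ` S) y * f y) \<in> borel_measurable borel"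
      "(\<lambda>x. indicator S x * (\<bar>det (matrix (g' x))\<bar> * f (g x))) \<in> borel_measurable borel"
    and pos: "\<And>y. y \<in> g ` S \<Longrightarrow> 0 \<le> f y"
  shows "(\<integral>\<^sup>+y. ennreal (indicator (g ` S) y * f y) \<partial>lborel) =
    (\<integral>\<^sup>+x. ennreal (indicator S x * (\<bar>det (matrix (g' x))\<bar> * f (g x))) \<partial>lborel)"
proof -
  let ?S = "unindex -` S" and ?g = "\<lambda>x. reindex (g (unindex x))" and ?f = "\<lambda>y. f (unindex y)"
  let ?g' = "\<lambda>x h. reindex (g' (unindex x) (unindex h))"
  have transport: "(\<integral>\<^sup>+y. u y \<partial>lborel) = (\<integral>\<^sup>+y. u (unindex y) \<partial>lborel)" if "u \<in> borel_measurable borel" for u :: "'n rvec \<Rightarrow> ennreal"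
    unfolding lborel_reindex[symmetric, where ?'n = 'n] using that by (subst nn_integral_distr) (auto simp: lborel_reindex)
  have im: "?g ` ?S = unindex -` (g ` S)"
  proof (intro equalityI subsetI)
    fix y assume "y \<in> unindex -` (g ` S)"
    then obtain x where "x \<in> S" "unindex y = g x" by auto
    then have "y = ?g (reindex x)" "reindex x \<in> ?S" by (metis reindex_inverse, simp)
    then show "y \<in> ?g ` ?S" by blast
  qed auto
  have det: "det (matrix (?g' x)) = det (matrix (g' (unindex x)))" if "x \<in> ?S" for x
  proof -
    have "matrix (?g' x) $ i $ j = matrix (g' (unindex x)) $ Rep_indices i $ Rep_indices j" for i j
    proof -
      have "unindex (axis j 1) = axis (Rep_indices j) 1"
        by (auto simp: vec_eq_iff unindex_def axis_def) (metis Abs_indices_inverse Rep_indices_inverse UNIV_I)+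
      then show ?thesis by (simp add: matrix_def reindex_def)
    qed
    then show ?thesis
      by (intro det_reindex) (simp add: vec_eq_iff)
  qed
  have "(\<integral>\<^sup>+y. ennreal (indicator (?g ` ?S) y * ?f y) \<partial>lborel) =
    (\<integral>\<^sup>+x. ennreal (indicator ?S x * (\<bar>det (matrix (?g' x))\<bar> * ?f (?g x))) \<partial>lborel)"
  proof (rule nn_integral_change_of_variables_wellorder)
    show "?S \<in> sets borel" using measurable_sets[OF measurable_reindex(2) S] by simp
    show "(?g has_derivative ?g' x) (at x within ?S)" if "x \<in> ?S" for x
    proof -
      have u: "(unindex has_derivative unindex) (at x)"
        using bounded_linear.has_derivative[OF bounded_linear_reindex(2) has_derivative_ident] .
      have "((\<lambda>x. g (unindex x)) has_derivative (\<lambda>h. g' (unindex x) (unindex h))) (at x)"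
        using has_derivative_compose[OF u g(1)] that by simp
      from bounded_linear.has_derivative[OF bounded_linear_reindex(1) this]
      show ?thesis by (rule has_derivative_at_withinI)
    qed
    show "inj_on ?g ?S" using g(2) unfolding inj_on_def by (metis reindex_inverse vimageE)
    have "(\<lambda>y. indicator (g ` S) (unindex y) * f (unindex y)) \<in> borel_measurable borel"
      using measurable_compose[OF measurable_reindex(2) m(1)] by simp
    then show "(\<lambda>y. indicator (?g ` ?S) y * ?f y) \<in> borel_measurable borel"
      unfolding im by (simp add: indicator_vimage)
    have "(\<lambda>x. indicator S (unindex x) * (\<bar>det (matrix (g' (unindex x)))\<bar> * f (g (unindex x)))) \<in> borel_measurable borel"
      using measurable_compose[OF measurable_reindex(2) m(2)] by simp
    moreover have "indicator ?S x * (\<bar>det (matrix (?g' x))\<bar> * ?f (?g x)) =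
       indicator S (unindex x) * (\<bar>det (matrix (g' (unindex x)))\<bar> * f (g (unindex x)))" for x
      using det[of x] by (auto simp: indicator_def)
    ultimately show "(\<lambda>x. indicator ?S x * (\<bar>det (matrix (?g' x))\<bar> * ?f (?g x))) \<in> borel_measurable borel" by (simp only:)
    show "0 \<le> ?f y" if "y \<in> ?g ` ?S" for y using that pos by auto
  qed
  also have "(\<integral>\<^sup>+y. ennreal (indicator (?g ` ?S) y * ?f y) \<partial>lborel) = (\<integral>\<^sup>+y. ennreal (indicator (g ` S) y * f y) \<partial>lborel)"
    unfolding im using transport[of "\<lambda>y. ennreal (indicator (g ` S) y * f y)"] m(1) by (simp add: indicator_vimage)
  also have "(\<integral>\<^sup>+x. ennreal (indicator ?S x * (\<bar>det (matrix (?g' x))\<bar> * ?f (?g x))) \<partial>lborel) =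
    (\<integral>\<^sup>+x. ennreal (indicator S x * (\<bar>det (matrix (g' x))\<bar> * f (g x))) \<partial>lborel)"
  proof -
    have "(\<integral>\<^sup>+x. ennreal (indicator S x * (\<bar>det (matrix (g' x))\<bar> * f (g x))) \<partial>lborel) =
      (\<integral>\<^sup>+x. ennreal (indicator S (unindex x) * (\<bar>det (matrix (g' (unindex x)))\<bar> * f (g (unindex x)))) \<partial>lborel)"
      using m(2) by (intro transport) simp
    also have "\<dots> = (\<integral>\<^sup>+x. ennreal (indicator ?S x * (\<bar>det (matrix (?g' x))\<bar> * ?f (?g x))) \<partial>lborel)"
    proof (rule nn_integral_cong)
      fix x :: "'n indices rvec"
      show "ennreal (indicator S (unindex x) * (\<bar>det (matrix (g' (unindex x)))\<bar> * f (g (unindex x)))) =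
        ennreal (indicator ?S x * (\<bar>det (matrix (?g' x))\<bar> * ?f (?g x)))"
        using det[of x] by (cases "x \<in> ?S") auto
    qed
    finally show ?thesis ..
  qed
  finally show ?thesis .
qed

section \<open>The Riemannian volume\<close>

context riemannian
begin

definition "borel_sets = sigma (points M) {U. openin (mtop M) U}"

lemma openin_Pow: "{U. openin (mtop M) U} \<subseteq> Pow (points M)"
  using openin_subset by blast

lemma space_borel_sets [simp]: "space borel_sets = points M"
  and sets_borel_sets: "sets borel_sets = sigma_sets (points M) {U. openin (mtop M) U}"
  unfolding borel_sets_def using openin_Pow by (auto simp: space_measure_of sets_measure_of)

lemma openin_borel: "openin (mtop M) U \<Longrightarrow> U \<in> sets borel_sets"
  unfolding sets_borel_sets by blast

lemma image_borel [simp]: "c \<in> atlas M \<Longrightarrow> snd c ` fst c \<in> sets borel"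
  using image_open by simp

lemma chart_inv_measurable:
  assumes c: "c \<in> atlas M"
  shows "chart_inv c \<in> measurable (restrict_space borel (snd c ` fst c)) borel_sets"
  unfolding borel_sets_def
proof (rule measurable_measure_of[OF openin_Pow])
  show "chart_inv c \<in> space (restrict_space borel (snd c ` fst c)) \<rightarrow> points M"
    using c by (auto simp: space_restrict_space intro: subsetD[OF chart_subset[OF c]])
  fix U assume "U \<in> {U. openin (mtop M) U}"
  then have "open (snd c ` (fst c \<inter> U))" by (intro chart_image_open[OF c]) simp
  moreover have "chart_inv c -` U \<inter> snd c ` fst c = snd c ` (fst c \<inter> U)" using c by auto
  ultimately show "chart_inv c -` U \<inter> space (restrict_space borel (snd c ` fst c)) \<in> sets (restrict_space borel (snd c ` fst c))"
    using c by (auto simp: space_restrict_space sets_restrict_space_iff)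
qed

lemma chart_image_borel:
  assumes "c \<in> atlas M" "B \<in> sets borel_sets" "B \<subseteq> fst c"
  shows "snd c ` B \<in> sets borel"
proof -
  have "chart_inv c -` B \<inter> snd c ` fst c \<in> sets (restrict_space borel (snd c ` fst c))"
    using measurable_sets[OF chart_inv_measurable[OF assms(1)] assms(2)] by (simp add: space_restrict_space)
  moreover have "chart_inv c -` B \<inter> snd c ` fst c = snd c ` B"
    using assms(1,3) by (auto intro: image_eqI[rotated])
  ultimately show ?thesis using assms(1) by (simp add: sets_restrict_space_iff)
qed

lemma chart_measurable:
  assumes c: "c \<in> atlas M"
  shows "snd c \<in> measurable (restrict_space borel_sets (fst c)) (restrict_space borel (snd c ` fst c))"
proof (rule measurable_restrict_space2)
  show "snd c \<in> space (restrict_space borel_sets (fst c)) \<rightarrow> snd c ` fst c"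
    by (auto simp: space_restrict_space)
  show "snd c \<in> borel_measurable (restrict_space borel_sets (fst c))"
  proof (rule borel_measurableI)
    fix S :: "'n rvec set" assume "open S"
    have "{q \<in> fst c. snd c q \<in> S} = snd c -` S \<inter> fst c" by auto
    then have "snd c -` S \<inter> fst c \<in> sets borel_sets"
      using openin_borel[OF chart_preimage_open[OF c \<open>open S\<close>]] by simp
    then show "snd c -` S \<inter> space (restrict_space borel_sets (fst c)) \<in> sets (restrict_space borel_sets (fst c))"
      using openin_borel[OF chart_open[OF c]] chart_subset[OF c]
      by (auto simp: space_restrict_space sets_restrict_space_iff Int_absorb2)
  qed
qed

abbreviation (input) "dens c x \<equiv> sqrt (det (metric_matrix M c x))"

lemma Ck_1_metric: "c \<in> atlas M \<Longrightarrow> Ck_on (Suc 0) (snd c ` fst c) (metric_matrix M c)"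
  using metric_smooth unfolding smooth_on_def by blast

lemma image_det_pos:
  assumes "c \<in> atlas M" "x \<in> snd c ` fst c" shows "det (metric_matrix M c x) > 0"
proof -
  obtain q where "q \<in> fst c" "x = snd c q" using assms(2) by blast
  then show ?thesis using metric_matrix_det_pos[of c q] assms(1) by (simp add: charts_at_iff)
qed

lemma Ck_1_dens:
  assumes c: "c \<in> atlas M" shows "Ck_on (Suc 0) (snd c ` fst c) (dens c)"
proof (rule Ck_1_compose[OF Ck_1_det Ck_1_sqrt])
  show "Ck_on (Suc 0) (snd c ` fst c) (\<lambda>x. metric_matrix M c x $ i $ j)" for i j
    by (rule Ck_1_bounded_linear[OF bounded_linear_vec_nth Ck_1_bounded_linear[OF bounded_linear_vec_nth Ck_1_metric[OF c]]])
qed (use image_det_pos[OF c] in auto)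

lemma dens_measurable:
  assumes "c \<in> atlas M"
  shows "(\<lambda>x. indicator (snd c ` fst c) x * dens c x) \<in> borel_measurable borel"
  using borel_measurable_continuous_on_indicator[OF _ Ck_1_continuous[OF Ck_1_dens[OF assms]]] assms by simp

text \<open>For an orthonormal basis, both densities are inverse to the determinants of the coordinates.\<close>

lemma dens_transition:
  assumes c: "c \<in> charts_at M q" and c': "c' \<in> charts_at M q"
  shows "\<bar>det (matrix (frechet_derivative (transition c c') (at (snd c q))))\<bar> * dens c' (snd c' q) = dens c (snd c q)"
proof -
  let ?T = "det (matrix (frechet_derivative (transition c c') (at (snd c q))))"
  let ?g = "det (metric_matrix M c (snd c q))" and ?g' = "det (metric_matrix M c' (snd c' q))"
  have q: "q \<in> points M" using charts_atD[OF c] by simp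
  obtain e where e: "orthonormal_basis (tangent M q) e" using tangent_orthonormal_exists[OF q] by blast
  have e': "set e \<subseteq> tangent_space M q" "length e = CARD('n)"
    using e vdim_tangent[OF q] by (auto simp: orthonormal_basis_def tangent_def)
  let ?f = "det (frame c e)"
  have 1: "?f * ?f * ?g = 1" by (rule det_frame[OF c e])
  have "(?T * ?f) * (?T * ?f) * ?g' = 1" using det_frame[OF c' e] frame_change[OF c c' e'] by simp
  then have "(?f * ?f) * (?T * ?T * ?g') = (?f * ?f) * ?g" using 1 by (simp add: mult_ac)
  moreover have "?f * ?f \<noteq> 0" using 1 by auto
  ultimately have "?g = ?T\<^sup>2 * ?g'" by (simp add: power2_eq_square)
  then show ?thesis by (simp add: real_sqrt_mult)
qed

definition chart_volume :: "('a, 'n) chart \<Rightarrow> 'a measure"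
  where "chart_volume c = distr (restrict_space (density lborel (\<lambda>x. ennreal (indicator (snd c ` fst c) x * dens c x)))
    (snd c ` fst c)) borel_sets (chart_inv c)"

lemma sets_chart_volume: "sets (chart_volume c) = sets borel_sets"
  by (simp add: chart_volume_def)

lemma chart_inv_measurable':
  assumes "c \<in> atlas M"
  shows "chart_inv c \<in> measurable (restrict_space (density lborel (\<lambda>x. ennreal (indicator (snd c ` fst c) x * dens c x)))
    (snd c ` fst c)) borel_sets"
proof -
  have "sets (restrict_space (density lborel (\<lambda>x. ennreal (indicator (snd c ` fst c) x * dens c x))) (snd c ` fst c)) =
    sets (restrict_space borel (snd c ` fst c))"
    by (intro sets_restrict_space_cong) simp
  then show ?thesis using chart_inv_measurable[OF assms] measurable_cong_sets by blast
qed

lemma emeasure_chart_volume: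
  assumes c: "c \<in> atlas M" and B: "B \<in> sets borel_sets"
  shows "emeasure (chart_volume c) B = (\<integral>\<^sup>+x\<in>snd c ` (B \<inter> fst c). ennreal (dens c x) \<partial>lborel)"
proof -
  let ?I = "snd c ` fst c" and ?A = "snd c ` (B \<inter> fst c)"
  let ?D = "density lborel (\<lambda>x. ennreal (indicator ?I x * dens c x))"
  have pre: "chart_inv c -` B \<inter> ?I = ?A" using c by auto
  have A: "?A \<in> sets borel"
    using chart_image_borel[OF c, of "B \<inter> fst c"] B openin_borel[OF chart_open[OF c]] by simp
  have "emeasure (chart_volume c) B = emeasure (restrict_space ?D ?I) ?A"
    unfolding chart_volume_def using B pre
    by (subst emeasure_distr[OF chart_inv_measurable'[OF c]]) (simp_all add: space_restrict_space)
  also have "\<dots> = emeasure ?D ?A" using c by (intro emeasure_restrict_space) auto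
  also have "\<dots> = (\<integral>\<^sup>+x. ennreal (indicator ?I x * dens c x) * indicator ?A x \<partial>lborel)"
    using A dens_measurable[OF c] by (intro emeasure_density) auto
  also have "\<dots> = (\<integral>\<^sup>+x\<in>?A. ennreal (dens c x) \<partial>lborel)"
    by (intro nn_integral_cong) (auto split: split_indicator)
  finally show ?thesis .
qed

text \<open>The change of variables formula, with the transition as the map; \<open>dens_transition\<close> absorbs its Jacobian
  determinant into the density.\<close>

lemma chart_volume_compatible:
  assumes c: "c \<in> atlas M" and c': "c' \<in> atlas M" and B: "B \<in> sets borel_sets" "B \<subseteq> fst c" "B \<subseteq> fst c'"
  shows "emeasure (chart_volume c) B = emeasure (chart_volume c') B"
proof -
  let ?S = "snd c ` B" and ?T = "transition c c'"
  let ?T' = "\<lambda>x. frechet_derivative ?T (at x)"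
  have S: "?S \<in> sets borel" "snd c' ` B \<in> sets borel" using chart_image_borel c c' B by auto
  have im: "?T ` ?S = snd c' ` B" using c B(2) by (force simp: image_iff)
  have at: "c \<in> charts_at M q" "c' \<in> charts_at M q" if "q \<in> B" for q using that B c c' by (auto simp: charts_at_iff)
  have eq: "indicator ?S x * (\<bar>det (matrix (?T' x))\<bar> * dens c' (?T x)) = indicator ?S x * (indicator (snd c ` fst c) x * dens c x)" for x
  proof (cases "x \<in> ?S")
    case True
    then obtain q where q: "q \<in> B" "x = snd c q" by blast
    then show ?thesis using dens_transition[OF at[OF q(1)]] c B True by auto
  qed simp
  have "(\<integral>\<^sup>+y. ennreal (indicator (?T ` ?S) y * dens c' y) \<partial>lborel) =
    (\<integral>\<^sup>+x. ennreal (indicator ?S x * (\<bar>det (matrix (?T' x))\<bar> * dens c' (?T x))) \<partial>lborel)"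
  proof (rule nn_integral_change_of_variables[OF S(1)])
    fix x assume "x \<in> ?S"
    then obtain q where "q \<in> B" "x = snd c q" by blast
    then show "(?T has_derivative ?T' x) (at x)" using transition_has_derivative[OF at] by simp
  next
    show "inj_on ?T ?S"
    proof (rule inj_onI)
      fix x y assume "x \<in> ?S" "y \<in> ?S" and T: "?T x = ?T y"
      then obtain p q where pq: "p \<in> B" "q \<in> B" "x = snd c p" "y = snd c q" by blast
      then have "snd c' p = snd c' q" using T c B(2) by (auto simp: subset_iff)
      then show "x = y" using chart_inj[OF c'] B(3) pq by (auto dest: inj_onD)
    qed
    have "(\<lambda>y. indicator (snd c' ` B) y * (indicator (snd c' ` fst c') y * dens c' y)) \<in> borel_measurable borel"
      using S(2) dens_measurable[OF c'] by measurable
    moreover have "indicator (snd c' ` B) y * (indicator (snd c' ` fst c') y * dens c' y) = indicator (?T ` ?S) y * dens c' y" for y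
      unfolding im using B(3) by (auto split: split_indicator)
    ultimately show "(\<lambda>y. indicator (?T ` ?S) y * dens c' y) \<in> borel_measurable borel" by simp
    show "(\<lambda>x. indicator ?S x * (\<bar>det (matrix (?T' x))\<bar> * dens c' (?T x))) \<in> borel_measurable borel"
      unfolding eq using S(1) dens_measurable[OF c] by measurable
    show "0 \<le> dens c' y" if "y \<in> ?T ` ?S" for y
      using that B(3) image_det_pos[OF c', of y] unfolding im by auto
  qed
  then have "(\<integral>\<^sup>+y. ennreal (indicator (snd c' ` B) y * dens c' y) \<partial>lborel) =
    (\<integral>\<^sup>+x. ennreal (indicator ?S x * (indicator (snd c ` fst c) x * dens c x)) \<partial>lborel)"
    unfolding eq im .
  moreover have "(\<integral>\<^sup>+y. ennreal (indicator (snd c' ` B) y * dens c' y) \<partial>lborel) = emeasure (chart_volume c') B"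
    unfolding emeasure_chart_volume[OF c' B(1)] using B(3)
    by (intro nn_integral_cong) (auto simp: Int_absorb2 split: split_indicator)
  moreover have "(\<integral>\<^sup>+x. ennreal (indicator ?S x * (indicator (snd c ` fst c) x * dens c x)) \<partial>lborel) = emeasure (chart_volume c) B"
    unfolding emeasure_chart_volume[OF c B(1)] using B(2)
    by (intro nn_integral_cong) (auto simp: Int_absorb2 split: split_indicator)
  ultimately show ?thesis by simp
qed

lemma countable_atlas: "\<exists>C. countable C \<and> C \<subseteq> atlas M \<and> (\<Union>c\<in>C. fst c) = points M"
proof -
  have "Lindelof_space (mtop M)" by (rule second_countable_imp_Lindelof_space[OF second_countable])
  then obtain V where V: "countable V" "V \<subseteq> fst ` atlas M" "\<Union>V = points M"
    unfolding Lindelof_space_def using chart_open charts_cover by (metis (no_types, lifting) imageE)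
  then obtain C where "countable C" "C \<subseteq> atlas M" "V = fst ` C" using countable_subset_image by metis
  then show ?thesis using V(3) by blast
qed

lemma countable_disjoint_atlas:
  obtains C D where "countable C" "C \<subseteq> atlas M" "\<And>c. c \<in> C \<Longrightarrow> D c \<in> sets borel_sets" "\<And>c. D c \<subseteq> fst c"
    "disjoint_family_on D C" "(\<Union>c\<in>C. D c) = points M"
proof -
  obtain C where C: "countable C" "C \<subseteq> atlas M" "(\<Union>c\<in>C. fst c) = points M" using countable_atlas by blast
  let ?n = "to_nat_on C"
  \<comment> \<open>the domain of each chart without those of its predecessors in an enumeration of the charts\<close>
  define D where "D c = fst c - (\<Union>c'\<in>{c'\<in>C. ?n c' < ?n c}. fst c')" for c
  have fst: "fst c \<in> sets borel_sets" if "c \<in> C" for c using that C(2) openin_borel[OF chart_open, of c] by blast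
  have "D c \<in> sets borel_sets" if "c \<in> C" for c
  proof -
    have "(\<Union>c'\<in>{c'\<in>C. ?n c' < ?n c}. fst c') \<in> sets borel_sets"
      by (rule sets.countable_UN') (use fst in \<open>auto intro: countable_subset[OF _ C(1)]\<close>)
    then show ?thesis unfolding D_def using fst[OF that] by blast
  qed
  moreover have "disjoint_family_on D C"
    unfolding disjoint_family_on_def
  proof (intro ballI impI)
    fix c c' assume "c \<in> C" "c' \<in> C" "c \<noteq> c'"
    then have "?n c < ?n c' \<or> ?n c' < ?n c" using inj_onD[OF inj_on_to_nat_on[OF C(1)]] by (metis linorder_neqE_nat)
    then show "D c \<inter> D c' = {}" using \<open>c \<in> C\<close> \<open>c' \<in> C\<close> by (auto simp: D_def)
  qed
  moreover have "(\<Union>c\<in>C. D c) = points M"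
  proof (intro equalityI subsetI)
    fix q assume "q \<in> points M"
    then have "\<exists>n. \<exists>c\<in>C. ?n c = n \<and> q \<in> fst c" using C(3) by blast
    define n where "n = (LEAST n. \<exists>c\<in>C. ?n c = n \<and> q \<in> fst c)"
    have "\<exists>c\<in>C. ?n c = n \<and> q \<in> fst c" unfolding n_def by (rule LeastI_ex) fact
    then obtain c where c: "c \<in> C" "?n c = n" "q \<in> fst c" by blast
    have "q \<notin> fst c'" if "c' \<in> C" "?n c' < n" for c'
      using not_less_Least[of "?n c'" "\<lambda>n. \<exists>c\<in>C. ?n c = n \<and> q \<in> fst c"] that unfolding n_def by blast
    then show "q \<in> (\<Union>c\<in>C. D c)" using c by (auto simp: D_def)
  qed (use C(3) in \<open>auto simp: D_def\<close>)
  moreover have "D c \<subseteq> fst c" for c by (auto simp: D_def)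
  ultimately show ?thesis using C that by blast
qed

text \<open>Countably many charts cover the manifold.  Cut into disjoint Borel pieces, one in each of these charts, every
  Borel set has its volume determined by the chart densities, which gives uniqueness, and the sum over the pieces
  is a measure, which gives existence.\<close>

lemma riemannian_volume:
  "space (riemannian_volume M) = points M"
  "sets (riemannian_volume M) = sets borel_sets"
  "c \<in> atlas M \<Longrightarrow> B \<in> sets borel_sets \<Longrightarrow> B \<subseteq> fst c \<Longrightarrow> emeasure (riemannian_volume M) B = emeasure (chart_volume c) B"
proof -
  let ?P = "\<lambda>\<mu>. space \<mu> = points M \<and> sets \<mu> = sigma_sets (points M) {U. openin (mtop M) U} \<and>
    (\<forall>c\<in>atlas M. \<forall>B\<in>sets \<mu>. B \<subseteq> fst c \<longrightarrow>
       emeasure \<mu> B = (\<integral>\<^sup>+x\<in>snd c ` B. ennreal (dens c x) \<partial>lborel))"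
  have chart: "(\<integral>\<^sup>+x\<in>snd c ` B. ennreal (dens c x) \<partial>lborel) = emeasure (chart_volume c) B"
    if "c \<in> atlas M" "B \<in> sets borel_sets" "B \<subseteq> fst c" for c B
    using emeasure_chart_volume[OF that(1,2)] that(3) by (simp add: Int_absorb2)
  obtain C D where C: "countable C" "C \<subseteq> atlas M" and D: "\<And>c. c \<in> C \<Longrightarrow> D c \<in> sets borel_sets" "\<And>c. D c \<subseteq> fst c"
    "disjoint_family_on D C" "(\<Union>c\<in>C. D c) = points M"
    by (rule countable_disjoint_atlas) blast
  have split: "emeasure \<nu> B = (\<integral>\<^sup>+c. emeasure \<nu> (B \<inter> D c) \<partial>count_space C)"
    if "sets \<nu> = sets borel_sets" "B \<in> sets borel_sets" for \<nu> B
  proof -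
    have "B = (\<Union>c\<in>C. B \<inter> D c)" using D(4) sets.sets_into_space[OF that(2)] by auto
    then have "emeasure \<nu> B = emeasure \<nu> (\<Union>c\<in>C. B \<inter> D c)" by simp
    also have "\<dots> = (\<integral>\<^sup>+c. emeasure \<nu> (B \<inter> D c) \<partial>count_space C)"
    proof (rule emeasure_UN_countable)
      show "disjoint_family_on (\<lambda>c. B \<inter> D c) C" using D(3) unfolding disjoint_family_on_def by blast
    qed (use that D(1) C(1) in auto)
    finally show ?thesis .
  qed
  define m where "m B = (\<integral>\<^sup>+c. emeasure (chart_volume c) (B \<inter> D c) \<partial>count_space C)" for B
  define \<mu> where "\<mu> = measure_of (points M) (sets borel_sets) m"
  have alg: "sigma_algebra (points M) (sets borel_sets)" using sets.sigma_algebra_axioms[of borel_sets] by simp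
  have \<mu>_sets: "sets \<mu> = sets borel_sets" "space \<mu> = points M"
    unfolding \<mu>_def using sets.space_closed[of borel_sets]
    by (auto simp: space_measure_of sets_measure_of sigma_algebra.sigma_sets_eq[OF alg])
  have \<mu>: "emeasure \<mu> B = m B" if "B \<in> sets borel_sets" for B
    unfolding \<mu>_def
  proof (rule emeasure_measure_of_sigma[OF alg _ _ that])
    show "positive (sets borel_sets) m" by (simp add: positive_def m_def)
    show "countably_additive (sets borel_sets) m"
    proof (rule countably_additiveI)
      fix A :: "nat \<Rightarrow> 'a set" assume A: "range A \<subseteq> sets borel_sets" "disjoint_family A" "(\<Union>i. A i) \<in> sets borel_sets"
      have "(\<Sum>i. m (A i)) = (\<integral>\<^sup>+c. (\<Sum>i. emeasure (chart_volume c) (A i \<inter> D c)) \<partial>count_space C)"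
        unfolding m_def by (rule nn_integral_suminf[symmetric]) simp
      also have "\<dots> = m (\<Union>i. A i)"
        unfolding m_def
      proof (rule nn_integral_cong)
        fix c assume "c \<in> space (count_space C)"
        then have c: "c \<in> C" by simp
        have "(\<Sum>i. emeasure (chart_volume c) (A i \<inter> D c)) = emeasure (chart_volume c) (\<Union>i. A i \<inter> D c)"
          using A D(1)[OF c] by (intro suminf_emeasure) (auto simp: sets_chart_volume disjoint_family_on_def)
        then show "(\<Sum>i. emeasure (chart_volume c) (A i \<inter> D c)) = emeasure (chart_volume c) ((\<Union>i. A i) \<inter> D c)" by simp
      qed
      finally show "(\<Sum>i. m (A i)) = m (\<Union>i. A i)" .
    qed
  qed
  have \<mu>_chart: "emeasure \<mu> B = emeasure (chart_volume c0) B" if "c0 \<in> atlas M" "B \<in> sets borel_sets" "B \<subseteq> fst c0" for c0 B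
  proof -
    have "m B = (\<integral>\<^sup>+c. emeasure (chart_volume c0) (B \<inter> D c) \<partial>count_space C)"
      unfolding m_def
    proof (rule nn_integral_cong)
      fix c assume "c \<in> space (count_space C)"
      then have c: "c \<in> C" by simp
      show "emeasure (chart_volume c) (B \<inter> D c) = emeasure (chart_volume c0) (B \<inter> D c)"
        using that c C(2) D(1)[OF c] D(2)[of c] by (intro chart_volume_compatible) auto
    qed
    then show ?thesis using split[OF sets_chart_volume that(2)] \<mu>[OF that(2)] by simp
  qed
  have P: "?P \<mu>" using \<mu>_sets \<mu>_chart chart by (auto simp: sets_borel_sets)
  have "riemannian_volume M = \<mu>"
    unfolding riemannian_volume_def
  proof (rule the_equality[of ?P, OF P])
    fix \<nu> assume \<nu>: "?P \<nu>"
    have \<nu>_sets: "sets \<nu> = sets borel_sets" using \<nu> by (simp add: sets_borel_sets)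
    show "\<nu> = \<mu>"
    proof (rule measure_eqI)
      fix B assume "B \<in> sets \<nu>"
      then have B: "B \<in> sets borel_sets" using \<nu>_sets by simp
      have "emeasure \<nu> (B \<inter> D c) = emeasure \<mu> (B \<inter> D c)" if "c \<in> C" for c
      proof -
        have c: "c \<in> atlas M" "B \<inter> D c \<in> sets borel_sets" "B \<inter> D c \<subseteq> fst c"
          using that C(2) sets.Int[OF B D(1)[OF that]] D(2)[of c] by blast+
        have "emeasure \<nu> (B \<inter> D c) = (\<integral>\<^sup>+x\<in>snd c ` (B \<inter> D c). ennreal (dens c x) \<partial>lborel)"
          using \<nu> c \<nu>_sets by blast
        then show ?thesis using \<mu>_chart[OF c] chart[OF c] by simp
      qed
      then show "emeasure \<nu> B = emeasure \<mu> B"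
        unfolding split[OF \<nu>_sets B] split[OF \<mu>_sets(1) B] by (intro nn_integral_cong) simp
    qed (use \<nu>_sets \<mu>_sets in simp)
  qed
  then show "space (riemannian_volume M) = points M" "sets (riemannian_volume M) = sets borel_sets"
    "c \<in> atlas M \<Longrightarrow> B \<in> sets borel_sets \<Longrightarrow> B \<subseteq> fst c \<Longrightarrow> emeasure (riemannian_volume M) B = emeasure (chart_volume c) B"
    using \<mu>_sets \<mu>_chart by auto
qed

text \<open>On a chart domain the volume is the image of the measure with density \<open>sqrt (det G)\<close>.\<close>

lemma chart_integral:
  assumes c: "c \<in> atlas M" and \<Psi>: "continuous_on (snd c ` fst c) \<Psi>"
    and F: "\<And>q. q \<in> fst c \<Longrightarrow> F q = \<Psi> (snd c q)" "\<And>q. q \<in> points M - fst c \<Longrightarrow> F q = 0"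
    and I: "has_bochner_integral lborel (\<lambda>x. indicator (snd c ` fst c) x * (dens c x * \<Psi> x)) I"
  shows "has_bochner_integral (riemannian_volume M) F (I :: real)"
proof -
  let ?I = "snd c ` fst c" and ?\<mu> = "riemannian_volume M"
  let ?\<delta> = "\<lambda>x. indicator ?I x * dens c x"
  have U: "fst c \<in> sets borel_sets" by (rule openin_borel[OF chart_open[OF c]])
  have sub: "fst c \<subseteq> points M" by (rule chart_subset[OF c])
  have ind: "(indicator (fst c) :: 'a \<Rightarrow> real) \<in> borel_measurable ?\<mu>"
    by (rule borel_measurable_indicator) (simp add: riemannian_volume(2) U)
  have F_meas: "F \<in> borel_measurable borel_sets"
  proof -
    have "(\<lambda>q. \<Psi> (snd c q)) \<in> borel_measurable (restrict_space borel_sets (fst c))"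
      by (rule measurable_compose[OF chart_measurable[OF c] borel_measurable_continuous_on_restrict[OF \<Psi>]])
    then have "(\<lambda>q. indicator (fst c) q *\<^sub>R \<Psi> (snd c q)) \<in> borel_measurable borel_sets"
      using borel_measurable_restrict_space_iff[of "fst c" borel_sets "\<lambda>q. \<Psi> (snd c q)"] U sub by (simp add: Int_absorb2)
    then show ?thesis
      by (rule measurable_cong[THEN iffD1, rotated]) (use F in \<open>auto split: split_indicator\<close>)
  qed
  have dens_eq: "chart_volume c = density ?\<mu> (\<lambda>q. ennreal (indicator (fst c) q))"
  proof (rule measure_eqI)
    fix B assume "B \<in> sets (chart_volume c)"
    then have B: "B \<in> sets borel_sets" by (simp add: sets_chart_volume)
    have "emeasure (density ?\<mu> (\<lambda>q. ennreal (indicator (fst c) q))) B = (\<integral>\<^sup>+q. ennreal (indicator (fst c) q) * indicator B q \<partial>?\<mu>)"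
      using B ind by (intro emeasure_density) (simp_all add: riemannian_volume(2))
    also have "\<dots> = (\<integral>\<^sup>+q. indicator (B \<inter> fst c) q \<partial>?\<mu>)" by (intro nn_integral_cong) (auto split: split_indicator)
    also have "\<dots> = emeasure (chart_volume c) (B \<inter> fst c)"
      using B U riemannian_volume(3)[OF c, of "B \<inter> fst c"] by (simp add: riemannian_volume(2))
    also have "\<dots> = emeasure (chart_volume c) B"
      using B U by (simp add: emeasure_chart_volume[OF c] Int_assoc)
    finally show "emeasure (chart_volume c) B = emeasure (density ?\<mu> (\<lambda>q. ennreal (indicator (fst c) q))) B" ..
  qed (simp add: sets_chart_volume riemannian_volume(2))
  let ?D = "density lborel (\<lambda>x. ennreal (?\<delta> x))"
  have Fc_meas: "(\<lambda>x. indicator ?I x *\<^sub>R F (chart_inv c x)) \<in> borel_measurable borel"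
  proof -
    have "(\<lambda>x. indicator ?I x *\<^sub>R \<Psi> x) \<in> borel_measurable borel"
      using borel_measurable_continuous_on_indicator[OF _ \<Psi>] c by simp
    moreover have "indicator ?I x *\<^sub>R \<Psi> x = indicator ?I x *\<^sub>R F (chart_inv c x)" for x
      using F(1) c by (auto split: split_indicator)
    ultimately show ?thesis by (simp only:)
  qed
  have pos: "AE x in lborel. 0 \<le> ?\<delta> x" using image_det_pos[OF c] by (auto split: split_indicator intro!: less_imp_le)
  have eq: "?\<delta> x *\<^sub>R (indicator ?I x *\<^sub>R F (chart_inv c x)) = indicator ?I x * (dens c x * \<Psi> x)" for x
    using F(1) c by (auto split: split_indicator)
  have ID: "?I \<inter> space ?D \<in> sets ?D" using c by simp
  let ?u = "\<lambda>x. indicator ?I x *\<^sub>R F (chart_inv c x)"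
  have \<delta>_eq: "(\<lambda>x. ?\<delta> x *\<^sub>R ?u x) = (\<lambda>x. indicator ?I x * (dens c x * \<Psi> x))" by (rule ext) (rule eq)
  have u_meas: "?u \<in> borel_measurable lborel" "?\<delta> \<in> borel_measurable lborel"
    using Fc_meas dens_measurable[OF c] by simp_all
  have "integrable ?D ?u" "integral\<^sup>L ?D ?u = I"
    using I unfolding integrable_density[OF u_meas pos] integral_density[OF u_meas pos] \<delta>_eq has_bochner_integral_iff by blast+
  then have "integrable (restrict_space ?D ?I) (\<lambda>x. F (chart_inv c x))" "integral\<^sup>L (restrict_space ?D ?I) (\<lambda>x. F (chart_inv c x)) = I"
    unfolding integrable_restrict_space[OF ID] integral_restrict_space[OF ID] by blast+
  then have "integrable (chart_volume c) F" "integral\<^sup>L (chart_volume c) F = I"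
    unfolding chart_volume_def integrable_distr_eq[OF chart_inv_measurable'[OF c] F_meas]
      integral_distr[OF chart_inv_measurable'[OF c] F_meas] by blast+
  moreover have F_meas': "F \<in> borel_measurable ?\<mu>"
    using F_meas by (simp add: measurable_cong_sets[OF riemannian_volume(2) refl])
  have ind_pos: "AE q in ?\<mu>. 0 \<le> (indicator (fst c) q :: real)" by simp
  ultimately have "has_bochner_integral ?\<mu> (\<lambda>q. indicator (fst c) q *\<^sub>R F q) I"
    unfolding has_bochner_integral_iff dens_eq integrable_density[OF F_meas' ind ind_pos] integral_density[OF F_meas' ind ind_pos] by blast
  then show ?thesis
    by (rule has_bochner_integral_cong[THEN iffD1, rotated -1])
      (use F in \<open>auto simp: riemannian_volume(1) split: split_indicator\<close>)
qed

end

section \<open>The integrated Piola identity\<close>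

lemma Ck_1_of_2:
  assumes "Ck_on (Suc (Suc 0)) S f" shows "Ck_on (Suc 0) S f"
  by (rule Ck_1_I[OF Ck_on_SucD(1)[OF assms] Ck_1_continuous[OF Ck_on_SucD(2)[OF assms]]])

context riemannian
begin

lemma chart_image_compact:
  assumes c: "c \<in> atlas M" and K: "compactin (mtop M) K" "K \<subseteq> fst c" shows "compact (snd c ` K)"
proof -
  have "compactin (subtopology (mtop M) (fst c)) K" using K by (simp add: compactin_subtopology)
  from image_compactin[OF this homeomorphic_imp_continuous_map[OF chart_homeomorphic[OF c]]]
  show ?thesis by (simp add: compactin_subtopology)
qed

lemma chart_inv_compact:
  assumes c: "c \<in> atlas M" and K: "compact K" "K \<subseteq> snd c ` fst c" shows "compactin (mtop M) (chart_inv c ` K)"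
proof (rule image_compactin)
  show "compactin (top_of_set (snd c ` fst c)) K" using K by (simp add: compactin_subtopology)
  show "continuous_map (top_of_set (snd c ` fst c)) (mtop M) (chart_inv c)"
    unfolding continuous_map_def
  proof (intro conjI allI impI)
    show "chart_inv c \<in> topspace (top_of_set (snd c ` fst c)) \<rightarrow> points M"
      using c by (auto intro: subsetD[OF chart_subset[OF c]])
    fix U assume U: "openin (mtop M) U"
    have "{x \<in> topspace (top_of_set (snd c ` fst c)). chart_inv c x \<in> U} = snd c ` (fst c \<inter> U)" using c by auto
    then show "openin (top_of_set (snd c ` fst c)) {x \<in> topspace (top_of_set (snd c ` fst c)). chart_inv c x \<in> U}"
      using chart_image_open[OF c U] image_open[OF c] by (simp add: openin_open_eq image_mono)
  qed
qed

lemma compact_complement_open: "compactin (mtop M) K \<Longrightarrow> openin (mtop M) (points M - K)"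
  using compactin_imp_closedin[OF hausdorff] by blast

text \<open>A rescaled plateau in the chart \<open>c\<close>, extended by 0.  Near a point outside the domain of \<open>c\<close> it vanishes,
  because its support is compact and hence closed in the Hausdorff topology.\<close>

lemma bump_exists:
  assumes U: "openin (mtop M) U" "p \<in> U" "U \<subseteq> fst c" and c: "c \<in> atlas M"
  obtains K W \<theta> where "compactin (mtop M) K" "K \<subseteq> U" "openin (mtop M) W" "p \<in> W"
    "\<And>q. q \<in> W \<Longrightarrow> \<theta> q = (1::real)" "\<And>q. q \<in> points M - K \<Longrightarrow> \<theta> q = 0"
    "\<And>c'. c' \<in> atlas M \<Longrightarrow> Ck_on (Suc 0) (snd c' ` fst c') (\<lambda>x. \<theta> (chart_inv c' x))"
proof -
  let ?x = "snd c p"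
  have "fst c \<inter> U = U" using U by blast
  then have "open (snd c ` U)" using chart_image_open[OF c U(1)] by simp
  then obtain r where r: "r > 0" "cball ?x r \<subseteq> snd c ` U" using U(2) open_contains_cball by blast
  define K where "K = chart_inv c ` cball ?x r"
  define \<phi> where "\<phi> y = (1 / r) *\<^sub>R (y - ?x)" for y
  define \<theta> where "\<theta> q = (if q \<in> fst c then plateau (\<phi> (snd c q)) else 0)" for q
  define W where "W = {q \<in> fst c. snd c q \<in> ball ?x (r / 2)}"
  have \<phi>: "\<phi> y \<bullet> \<phi> y = (dist y ?x / r)\<^sup>2" for y
  proof -
    have "norm (\<phi> y) = dist y ?x / r" using r(1) by (simp add: \<phi>_def dist_norm)
    then show ?thesis by (simp flip: power2_norm_eq_inner)
  qed
  have K: "compactin (mtop M) K" unfolding K_def by (rule chart_inv_compact[OF c compact_cball]) (use r U in blast)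
  have KU: "K \<subseteq> U"
  proof
    fix q assume "q \<in> K"
    then obtain y where "y \<in> snd c ` U" "q = chart_inv c y" using r(2) unfolding K_def by blast
    then show "q \<in> U" using U(3) c by auto
  qed
  have K_iff: "q \<in> K" if "q \<in> fst c" "dist (snd c q) ?x \<le> r" for q
  proof -
    have "q = chart_inv c (snd c q)" using that c by simp
    then show ?thesis unfolding K_def using that(2) by (metis dist_commute image_eqI mem_cball)
  qed
  have zero: "\<theta> q = 0" if "q \<notin> K" for q
  proof (cases "q \<in> fst c")
    case True
    then have "dist (snd c q) ?x > r" using K_iff that by force
    then have "1 \<le> (dist (snd c q) ?x / r)\<^sup>2" using r(1) by (simp add: one_le_power)
    then show ?thesis using True plateau_zero[of "\<phi> (snd c q)"] by (simp add: \<theta>_def \<phi>)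
  qed (simp add: \<theta>_def)
  show ?thesis
  proof (rule that[OF K KU])
    show "openin (mtop M) W" unfolding W_def by (rule chart_preimage_open[OF c]) simp
    show "p \<in> W" using U r by (auto simp: W_def)
    show "\<theta> q = 1" if "q \<in> W" for q
    proof -
      have "dist (snd c q) ?x / r \<le> 1/2" using that r(1) by (simp add: W_def dist_commute field_simps)
      then have "(dist (snd c q) ?x / r)\<^sup>2 \<le> (1/2)\<^sup>2" using r(1) by (intro power_mono) auto
      also have "(1/2)\<^sup>2 \<le> (1/2 :: real)" by (simp add: power2_eq_square)
      finally have "\<phi> (snd c q) \<bullet> \<phi> (snd c q) \<le> 1/2" unfolding \<phi> .
      then show ?thesis using that plateau_one by (simp add: \<theta>_def W_def)
    qed
    show "\<theta> q = 0" if "q \<in> points M - K" for q using that zero by blast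
  next
    fix c' assume c': "c' \<in> atlas M"
    show "Ck_on (Suc 0) (snd c' ` fst c') (\<lambda>x. \<theta> (chart_inv c' x))"
    proof (rule Ck_1_local)
      fix x assume "x \<in> snd c' ` fst c'"
      then obtain q where q: "q \<in> fst c'" "x = snd c' q" by blast
      show "\<exists>T. open T \<and> x \<in> T \<and> Ck_on (Suc 0) T (\<lambda>x. \<theta> (chart_inv c' x))"
      proof (cases "q \<in> fst c")
        case True
        let ?T = "snd c' ` (fst c' \<inter> fst c)"
        have T: "open ?T" by (rule overlap_open[OF c' c])
        have tr: "Ck_on (Suc 0) ?T (transition c' c)" by (rule transition_Ck[OF c' c])
        have \<phi>1: "Ck_on (Suc 0) UNIV \<phi>"
          unfolding \<phi>_def by (rule Ck_1_I[of _ _ "\<lambda>x h. (1 / r) *\<^sub>R h"]) (auto intro!: derivative_eq_intros)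
        have "Ck_on (Suc 0) ?T (\<lambda>x. plateau (\<phi> (transition c' c x)))"
          by (rule Ck_1_compose[OF Ck_1_compose[OF tr \<phi>1] Ck_1_plateau]) auto
        then have "Ck_on (Suc 0) ?T (\<lambda>x. \<theta> (chart_inv c' x))"
          by (rule Ck_1_cong[OF _ T]) (use c' in \<open>auto simp: \<theta>_def\<close>)
        then show ?thesis using T q True by (intro exI[of _ ?T]) blast
      next
        case False
        let ?T = "snd c' ` (fst c' \<inter> (points M - K))"
        have T: "open ?T" by (rule chart_image_open[OF c' compact_complement_open[OF K]])
        have "Ck_on (Suc 0) ?T (\<lambda>x. 0 :: real)" by (rule Ck_1_const)
        then have "Ck_on (Suc 0) ?T (\<lambda>x. \<theta> (chart_inv c' x))"
          by (rule Ck_1_cong[OF _ T]) (use c' zero in auto)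
        moreover have "q \<in> points M - K" using q(1) chart_subset[OF c'] False KU U(3) by blast
        ultimately show ?thesis using T q by (intro exI[of _ ?T]) blast
      qed
    qed
  qed
qed

end

context riemannian_map
begin

abbreviation (input) "integrand \<xi> p \<equiv> hom_ip (tangent M p) (tangent N (f p)) (cof_df M N f p) (pullback_conn M N f \<xi> p)"

text \<open>The Euclidean field whose divergence is the weighted integrand.\<close>

definition "flux c c' \<xi> x =
  sN c' (local_rep c c' f x) *\<^sub>R (transpose (cofm (jacm c c' x)) *v \<xi> (chart_inv c x) c')"

lemma section_tangent: "Ck_section 1 M N f (points M) \<xi> \<Longrightarrow> \<forall>q\<in>points M. \<xi> q \<in> tangent_space N (f q)"
  by (simp add: Ck_section_def)

lemma section_coords:
  assumes "Ck_section 1 M N f (points M) \<xi>" "c \<in> atlas M" "c' \<in> atlas N"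
  shows "Ck_on (Suc 0) (snd c ` chart_domain c c') (\<lambda>x. \<xi> (chart_inv c x) c')"
proof -
  have "{q \<in> fst c \<inter> points M. f q \<in> fst c'} = chart_domain c c'"
    using M.chart_subset[OF assms(2)] unfolding chart_domain_def by blast
  moreover have "Ck_on (Suc 0) (snd c ` {q \<in> fst c \<inter> points M. f q \<in> fst c'}) (\<lambda>x. \<xi> (chart_inv c x) c')"
    using assms unfolding Ck_section_def One_nat_def by blast
  ultimately show ?thesis by (simp only:)
qed

lemma sectionI:
  assumes "\<And>q. q \<in> points M \<Longrightarrow> \<xi> q \<in> tangent_space N (f q)"
    "\<And>c c'. c \<in> atlas M \<Longrightarrow> c' \<in> atlas N \<Longrightarrow> Ck_on (Suc 0) (snd c ` chart_domain c c') (\<lambda>x. \<xi> (chart_inv c x) c')"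
  shows "Ck_section 1 M N f (points M) \<xi>"
proof -
  have eq: "{q \<in> fst c \<inter> points M. f q \<in> fst c'} = chart_domain c c'" if "c \<in> atlas M" for c c'
    using M.chart_subset[OF that] unfolding chart_domain_def by blast
  show ?thesis
    unfolding Ck_section_def One_nat_def
  proof (intro conjI ballI)
    fix c c' assume c: "c \<in> atlas M" "c' \<in> atlas N"
    show "Ck_on (Suc 0) (snd c ` {q \<in> fst c \<inter> points M. f q \<in> fst c'}) (\<lambda>x. \<xi> (chart_inv c x) c')"
      unfolding eq[OF c(1)] by (rule assms(2)[OF c])
  qed (rule assms(1))
qed

lemma section_scale:
  assumes \<xi>: "Ck_section 1 M N f (points M) \<xi>"
    and \<theta>: "\<And>c. c \<in> atlas M \<Longrightarrow> Ck_on (Suc 0) (snd c ` fst c) (\<lambda>x. \<theta> (chart_inv c x))"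
  shows "Ck_section 1 M N f (points M) (\<lambda>q. \<theta> q *\<^sub>R \<xi> q)"
proof (rule sectionI)
  fix q assume q: "q \<in> points M"
  obtain c' where "c' \<in> charts_at N (f q)" using N.chart_at_exists[OF map_points[OF q]] by blast
  then show "\<theta> q *\<^sub>R \<xi> q \<in> tangent_space N (f q)"
    using N.subspace_tangent section_tangent[OF \<xi>] q by (simp add: subspace_scale)
next
  fix c c' assume c: "c \<in> atlas M" "c' \<in> atlas N"
  have "Ck_on (Suc 0) (snd c ` chart_domain c c') (\<lambda>x. \<theta> (chart_inv c x))"
    by (rule Ck_1_subset[OF \<theta>[OF c(1)]]) (auto simp: chart_domain_def)
  from Ck_1_scaleR[OF this section_coords[OF \<xi> c]]
  show "Ck_on (Suc 0) (snd c ` chart_domain c c') (\<lambda>x. (\<theta> (chart_inv c x) *\<^sub>R \<xi> (chart_inv c x)) c')"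
    by (simp only: scaleR_fun_def)
qed

lemma integrand_flux:
  assumes \<xi>: "Ck_section 1 M N f (points M) \<xi>" and c: "c \<in> charts_at M p" and c': "c' \<in> charts_at N (f p)"
  shows "\<exists>V'. (flux c c' \<xi> has_derivative V') (at (snd c p)) \<and> sM c (snd c p) * integrand \<xi> p = (\<Sum>j\<in>UNIV. V' (axis j 1) $ j)"
proof -
  have "((\<lambda>x. \<xi> (chart_inv c x) c') has_derivative frechet_derivative (\<lambda>x. \<xi> (chart_inv c x) c') (at (snd c p))) (at (snd c p))"
    by (rule Ck_on_SucD(1)[OF section_coords[OF \<xi> point(1,3)[OF c c']] point_in_chart_domain[OF c c']])
  from integrand_divergence[OF c c' openin_topspace M.charts_atD(1)[OF c] section_tangent[OF \<xi>] this]
  show ?thesis unfolding flux_def[abs_def] .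
qed

lemma integrand_eq_flux:
  assumes \<xi>: "Ck_section 1 M N f (points M) \<xi>" and c: "c \<in> charts_at M p" and c': "c' \<in> charts_at N (f p)"
    and V: "(flux c c' \<xi> has_derivative V') (at (snd c p))"
  shows "sM c (snd c p) * integrand \<xi> p = (\<Sum>j\<in>UNIV. V' (axis j 1) $ j)"
proof -
  obtain V'' where V'': "(flux c c' \<xi> has_derivative V'') (at (snd c p))" "sM c (snd c p) * integrand \<xi> p = (\<Sum>j\<in>UNIV. V'' (axis j 1) $ j)"
    using integrand_flux[OF \<xi> c c'] by blast
  from has_derivative_unique[OF V''(1) V] V''(2) show ?thesis by simp
qed

text \<open>The flux is linear in the section, and the integrand is determined by its derivative.\<close>

lemma integrand_add:
  assumes \<xi>: "Ck_section 1 M N f (points M) \<xi>" and \<eta>: "Ck_section 1 M N f (points M) \<eta>"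
    and s: "Ck_section 1 M N f (points M) \<zeta>" "\<And>q. \<zeta> q = \<xi> q + \<eta> q" and p: "p \<in> points M"
  shows "integrand \<zeta> p = integrand \<xi> p + integrand \<eta> p"
proof -
  obtain c where c: "c \<in> charts_at M p" using M.chart_at_exists[OF p] by blast
  obtain c' where c': "c' \<in> charts_at N (f p)" using N.chart_at_exists[OF map_points[OF p]] by blast
  obtain V' where V': "(flux c c' \<xi> has_derivative V') (at (snd c p))" "sM c (snd c p) * integrand \<xi> p = (\<Sum>j\<in>UNIV. V' (axis j 1) $ j)"
    using integrand_flux[OF \<xi> c c'] by blast
  obtain W' where W': "(flux c c' \<eta> has_derivative W') (at (snd c p))" "sM c (snd c p) * integrand \<eta> p = (\<Sum>j\<in>UNIV. W' (axis j 1) $ j)"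
    using integrand_flux[OF \<eta> c c'] by blast
  have "flux c c' \<zeta> = (\<lambda>x. flux c c' \<xi> x + flux c c' \<eta> x)"
    by (simp add: fun_eq_iff flux_def s(2) matrix_vector_right_distrib scaleR_right_distrib del: transpose_matrix_vector)
  then have "(flux c c' \<zeta> has_derivative (\<lambda>h. V' h + W' h)) (at (snd c p))" using has_derivative_add[OF V'(1) W'(1)] by simp
  from integrand_eq_flux[OF s(1) c c' this] V'(2) W'(2)
  have "sM c (snd c p) * integrand \<zeta> p = sM c (snd c p) * (integrand \<xi> p + integrand \<eta> p)"
    by (simp add: sum.distrib distrib_left)
  then show ?thesis using M.sqrt_det_pos[OF c] by simp
qed

lemma integrand_zero:
  assumes \<xi>: "Ck_section 1 M N f (points M) \<xi>" and U: "openin (mtop M) U" "p \<in> U" "\<And>q. q \<in> U \<Longrightarrow> \<xi> q = 0"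
  shows "integrand \<xi> p = 0"
proof -
  have p: "p \<in> points M" using U openin_subset by blast
  obtain c where c: "c \<in> charts_at M p" using M.chart_at_exists[OF p] by blast
  obtain c' where c': "c' \<in> charts_at N (f p)" using N.chart_at_exists[OF map_points[OF p]] by blast
  let ?S = "snd c ` (fst c \<inter> U)"
  have S: "open ?S" "snd c p \<in> ?S" using M.chart_image_open[OF point(1)[OF c c'] U(1)] point[OF c c'] U by auto
  have "((\<lambda>x. 0) has_derivative (\<lambda>h. 0)) (at (snd c p))" by simp
  then have "(flux c c' \<xi> has_derivative (\<lambda>h. 0)) (at (snd c p))"
    by (rule has_derivative_transform_within_open[OF _ S]) (use U(3) point(1)[OF c c'] in \<open>auto simp: flux_def\<close>)
  from integrand_eq_flux[OF \<xi> c c' this] show ?thesis using M.sqrt_det_pos[OF c] by simp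
qed

lemma Ck_1_flux:
  assumes \<xi>: "Ck_section 1 M N f (points M) \<xi>" and c: "c \<in> atlas M" and c': "c' \<in> atlas N"
  shows "Ck_on (Suc 0) (snd c ` chart_domain c c') (\<lambda>x. flux c c' \<xi> x $ j)"
proof -
  let ?S = "snd c ` chart_domain c c'"
  have F: "Ck_on (Suc 0) ?S (local_rep c c' f)" by (rule Ck_1_of_2[OF map_Ck[OF c c']])
  have s: "Ck_on (Suc 0) ?S (\<lambda>x. sN c' (local_rep c c' f x))"
    by (rule Ck_1_compose[OF F N.Ck_1_dens[OF c']]) (use c in \<open>auto simp: chart_domain_def\<close>)
  have jac: "Ck_on (Suc 0) ?S (\<lambda>x. jacm c c' x $ a $ k)" for a k
    using Ck_1_bounded_linear[OF bounded_linear_vec_nth[of a] Ck_on_SucD(2)[OF map_Ck[OF c c'], of "axis k 1"]]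
    by (simp add: matrix_def del: Ck_on.simps)
  have \<kappa>: "Ck_on (Suc 0) ?S (\<lambda>x. cofm (jacm c c' x) $ m $ j)" for m
  proof -
    have "Ck_on (Suc 0) ?S (\<lambda>x. det (\<chi> a. if a = m then axis j 1 else jacm c c' x $ a))"
    proof (rule Ck_1_det)
      fix i k
      show "Ck_on (Suc 0) ?S (\<lambda>x. (\<chi> a. if a = m then axis j 1 else jacm c c' x $ a) $ i $ k)"
        using jac Ck_1_const by (cases "i = m") (simp_all del: Ck_on.simps)
    qed
    then show ?thesis by (simp add: cofm_def del: Ck_on.simps)
  qed
  have x: "Ck_on (Suc 0) ?S (\<lambda>x. \<xi> (chart_inv c x) c' $ m)" for m
    by (rule Ck_1_bounded_linear[OF bounded_linear_vec_nth section_coords[OF \<xi> c c']])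
  have "Ck_on (Suc 0) ?S (\<lambda>x. sN c' (local_rep c c' f x) * (\<Sum>m\<in>UNIV. cofm (jacm c c' x) $ m $ j * \<xi> (chart_inv c x) c' $ m))"
    by (intro Ck_1_mult s Ck_1_sum \<kappa> x)
  then show ?thesis
    by (simp add: flux_def matrix_vector_mult_def transpose_def del: Ck_on.simps transpose_matrix_vector)
qed

text \<open>Extended by 0, the flux is continuously differentiable on the whole coordinate space with compact support, so that its divergence
  integrates to 0.\<close>

lemma integral_zero_chart:
  assumes \<xi>: "Ck_section 1 M N f (points M) \<xi>" and c: "c \<in> atlas M" and c': "c' \<in> atlas N"
    and K: "compactin (mtop M) K" "K \<subseteq> chart_domain c c'" "\<And>q. q \<in> points M - K \<Longrightarrow> \<xi> q = 0"
  shows "has_bochner_integral (riemannian_volume M) (integrand \<xi>) 0"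
proof -
  let ?S = "snd c ` chart_domain c c'" and ?K = "snd c ` K" and ?I = "snd c ` fst c"
  have S: "open ?S" by (rule open_chart_domain[OF c c'])
  have sub: "K \<subseteq> fst c" using K(2) by (auto simp: chart_domain_def)
  have cK: "compact ?K" by (rule M.chart_image_compact[OF c K(1) sub])
  then have oK: "open (- ?K)" by (simp add: open_Compl compact_imp_closed)
  define V where "V j x = (if x \<in> ?S then flux c c' \<xi> x $ j else 0)" for j x
  have V0: "V j x = 0" if "x \<notin> ?K" for j x
  proof (cases "x \<in> ?S")
    case True
    then obtain q where q: "q \<in> chart_domain c c'" "x = snd c q" by blast
    then have "q \<in> points M - K" using that M.chart_subset[OF c] by (auto simp: chart_domain_def)
    then have "\<xi> (chart_inv c x) = 0" using K(3) q c by (simp add: chart_domain_def)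
    then show ?thesis by (simp add: V_def flux_def)
  qed (simp add: V_def)
  have "Ck_on (Suc 0) UNIV (V j)" for j
  proof (rule Ck_1_local)
    fix x
    show "\<exists>T. open T \<and> x \<in> T \<and> Ck_on (Suc 0) T (V j)"
    proof (cases "x \<in> ?S")
      case True
      have "Ck_on (Suc 0) ?S (V j)" by (rule Ck_1_cong[OF Ck_1_flux[OF \<xi> c c', of j] S]) (simp add: V_def)
      then show ?thesis using S True by blast
    next
      case False
      have "Ck_on (Suc 0) (- ?K) (V j)" by (rule Ck_1_cong[OF Ck_1_const[of _ 0] oK]) (simp add: V0)
      moreover have "x \<in> - ?K" using False K(2) by blast
      ultimately show ?thesis using oK by blast
    qed
  qed
  then have "\<exists>V'. (\<forall>x. (V j has_derivative V' x) (at x)) \<and> (\<forall>h. continuous_on UNIV (\<lambda>x. V' x h))" for j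
    using Ck_1_E[of UNIV "V j"] by (metis UNIV_I)
  then obtain V' where V': "\<And>j x. (V j has_derivative V' j x) (at x)" "\<And>j h. continuous_on UNIV (\<lambda>x. V' j x h)"
    by metis
  have V'0: "V' j x h = 0" if "x \<notin> ?K" for j x h
  proof -
    have "((\<lambda>x. 0) has_derivative (\<lambda>h. 0)) (at x)" by simp
    then have "(V j has_derivative (\<lambda>h. 0)) (at x)"
      by (rule has_derivative_transform_within_open[OF _ oK]) (use that V0 in auto)
    from fun_cong[OF has_derivative_unique[OF this V'(1)], of h] show ?thesis by simp
  qed
  define divg where "divg x = (\<Sum>j\<in>UNIV. V' j x (axis j 1))" for x
  have divg0: "divg x = 0" if "x \<notin> ?K" for x using V'0[OF that] by (simp add: divg_def)
  have divg_int: "has_bochner_integral lborel divg 0"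
  proof -
    have "has_bochner_integral lborel (\<lambda>x. \<Sum>j\<in>UNIV. V' j x (axis j 1)) (\<Sum>j\<in>(UNIV :: 'n set). 0)"
    proof (rule has_bochner_integral_sum)
      fix j :: 'n
      show "has_bochner_integral lborel (\<lambda>x. V' j x (axis j 1)) 0"
        by (rule integral_directional_derivative_zero[OF V'(1) V'(2) cK V0])
    qed
    then show ?thesis by (simp add: divg_def[abs_def])
  qed
  have pos: "sM c x > 0" if "x \<in> ?I" for x using M.image_det_pos[OF c that] by simp
  show ?thesis
  proof (rule M.chart_integral[OF c, of "\<lambda>x. divg x / sM c x"])
    have "continuous_on ?I (sM c)" by (rule Ck_1_continuous[OF M.Ck_1_dens[OF c]])
    moreover have "continuous_on ?I divg"
      unfolding divg_def[abs_def] by (intro continuous_on_sum continuous_on_subset[OF V'(2)]) simp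
    ultimately show "continuous_on ?I (\<lambda>x. divg x / sM c x)" using pos by (intro continuous_on_divide) force+
  next
    fix q assume q: "q \<in> fst c"
    show "integrand \<xi> q = divg (snd c q) / sM c (snd c q)"
    proof (cases "q \<in> chart_domain c c'")
      case True
      have at: "c \<in> charts_at M q" "c' \<in> charts_at N (f q)" using True c c' by (auto simp: chart_domain_def M.charts_at_iff N.charts_at_iff)
      have "(flux c c' \<xi> has_derivative (\<lambda>h. \<chi> j. V' j (snd c q) h)) (at (snd c q))"
      proof (rule has_derivative_vecI)
        fix j
        have "((\<lambda>x. flux c c' \<xi> x $ j) has_derivative V' j (snd c q)) (at (snd c q))"
          by (rule has_derivative_transform_within_open[OF V'(1) S]) (use True in \<open>auto simp: V_def\<close>)
        then show "((\<lambda>x. flux c c' \<xi> x $ j) has_derivative (\<lambda>h. (\<chi> j. V' j (snd c q) h) $ j)) (at (snd c q))" by simp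
      qed
      from integrand_eq_flux[OF \<xi> at this] pos[of "snd c q"] q
      show ?thesis by (simp add: divg_def field_simps)
    next
      case False
      then have "q \<in> points M - K" using q K(2) M.chart_subset[OF c] by blast
      then have "integrand \<xi> q = 0"
        by (rule integrand_zero[OF \<xi> M.compact_complement_open[OF K(1)]]) (rule K(3))
      moreover have "snd c q \<notin> ?K"
        using \<open>q \<in> points M - K\<close> q sub inj_on_image_mem_iff[OF M.chart_inj[OF c] q sub] by blast
      ultimately show ?thesis by (simp add: divg0)
    qed
  next
    fix q assume "q \<in> points M - fst c"
    then have "q \<in> points M - K" using sub by blast
    then show "integrand \<xi> q = 0"
      by (rule integrand_zero[OF \<xi> M.compact_complement_open[OF K(1)]]) (rule K(3))
  next
    have "indicator ?I x * (sM c x * (divg x / sM c x)) = divg x" for x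
      using pos[of x] divg0[of x] sub by (cases "x \<in> ?I") auto
    then show "has_bochner_integral lborel (\<lambda>x. indicator ?I x * (sM c x * (divg x / sM c x))) 0"
      using divg_int by simp
  qed
qed

text \<open>The open sets that may occur in the finite cover: a bump function equal to 1 on them has compact support in the
  domain of one pair of charts.\<close>

definition "bump_domain W \<longleftrightarrow> (\<exists>c\<in>atlas M. \<exists>c'\<in>atlas N. \<exists>K \<theta>. compactin (mtop M) K \<and> K \<subseteq> chart_domain c c' \<and>
  (\<forall>q\<in>W. \<theta> q = (1::real)) \<and> (\<forall>q\<in>points M - K. \<theta> q = 0) \<and>
  (\<forall>c\<in>atlas M. Ck_on (Suc 0) (snd c ` fst c) (\<lambda>x. \<theta> (chart_inv c x))))"

lemma bump_domain_exists:
  assumes p: "p \<in> points M" shows "\<exists>W. openin (mtop M) W \<and> p \<in> W \<and> bump_domain W"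
proof -
  obtain c where c: "c \<in> charts_at M p" using M.chart_at_exists[OF p] by blast
  obtain c' where c': "c' \<in> charts_at N (f p)" using N.chart_at_exists[OF map_points[OF p]] by blast
  note a = point[OF c c']
  have "p \<in> chart_domain c c'" "chart_domain c c' \<subseteq> fst c" using a by (auto simp: chart_domain_def)
  from M.bump_exists[OF openin_chart_domain[OF a(1,3)] this a(1)]
  show ?thesis using a unfolding bump_domain_def by metis
qed

text \<open>Each bump splits the section into a part supported in one pair of charts and a part that vanishes on one
  more set of the cover.  This telescoping does the work of a partition of unity without any division.\<close>

lemma integral_zero_cover:
  assumes "finite \<W>" "\<And>W. W \<in> \<W> \<Longrightarrow> bump_domain W"
    "Ck_section 1 M N f (points M) \<xi>" "\<And>q. q \<in> points M - \<Union>\<W> \<Longrightarrow> \<xi> q = 0"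
  shows "has_bochner_integral (riemannian_volume M) (integrand \<xi>) 0"
  using assms
proof (induction \<W> arbitrary: \<xi> rule: finite_induct)
  case empty
  have "integrand \<xi> p = 0" if "p \<in> points M" for p
    by (rule integrand_zero[OF empty(2) openin_topspace that]) (use empty(3) in auto)
  then show ?case
    by (intro has_bochner_integral_cong[THEN iffD2, OF refl _ refl has_bochner_integral_zero])
      (simp add: M.riemannian_volume(1))
next
  case (insert W \<W>)
  obtain c c' K \<theta> where b: "c \<in> atlas M" "c' \<in> atlas N" "compactin (mtop M) K" "K \<subseteq> chart_domain c c'"
    "\<And>q. q \<in> W \<Longrightarrow> \<theta> q = (1::real)" "\<And>q. q \<in> points M - K \<Longrightarrow> \<theta> q = 0"
    "\<And>c. c \<in> atlas M \<Longrightarrow> Ck_on (Suc 0) (snd c ` fst c) (\<lambda>x. \<theta> (chart_inv c x))"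
    using insert.prems(1)[of W] unfolding bump_domain_def by blast
  let ?\<xi> = "\<lambda>q. \<theta> q *\<^sub>R \<xi> q" and ?\<eta> = "\<lambda>q. (1 + (-1) * \<theta> q) *\<^sub>R \<xi> q"
  have s1: "Ck_section 1 M N f (points M) ?\<xi>" by (rule section_scale[OF insert.prems(2) b(7)])
  have s2: "Ck_section 1 M N f (points M) ?\<eta>"
    by (rule section_scale[OF insert.prems(2)]) (intro Ck_1_add Ck_1_mult Ck_1_const b(7))
  have 1: "has_bochner_integral (riemannian_volume M) (integrand ?\<xi>) 0"
    by (rule integral_zero_chart[OF s1 b(1-4)]) (simp add: b(6))
  have 2: "has_bochner_integral (riemannian_volume M) (integrand ?\<eta>) 0"
  proof (rule insert.IH[OF _ s2])
    fix q assume "q \<in> points M - \<Union>\<W>"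
    then show "?\<eta> q = 0" using b(5)[of q] insert.prems(3)[of q] by (cases "q \<in> W") auto
  qed (use insert.prems in blast)
  have "integrand \<xi> p = integrand ?\<xi> p + integrand ?\<eta> p" if "p \<in> points M" for p
    by (rule integrand_add[OF s1 s2 insert.prems(2) _ that]) (simp flip: scaleR_left_distrib)
  then show ?case
    using has_bochner_integral_add[OF 1 2]
    by (subst has_bochner_integral_cong[OF refl _ refl]) (auto simp: M.riemannian_volume(1))
qed

lemma integral_zero:
  assumes \<xi>: "Ck_section 1 M N f (points M) \<xi>" "compactly_supported M \<xi>"
  shows "has_bochner_integral (riemannian_volume M) (integrand \<xi>) 0"
proof -
  obtain K where K: "compactin (mtop M) K" "\<And>q. q \<in> points M - K \<Longrightarrow> \<xi> q = 0"
    using \<xi>(2) by (auto simp: compactly_supported_def)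
  let ?U = "{W. openin (mtop M) W \<and> bump_domain W}"
  have "K \<subseteq> \<Union>?U" using bump_domain_exists compactin_subset_topspace[OF K(1)] by blast
  then obtain \<W> where \<W>: "finite \<W>" "\<W> \<subseteq> ?U" "K \<subseteq> \<Union>\<W>"
    using K(1) unfolding compactin_def by (metis (no_types, lifting) mem_Collect_eq)
  show ?thesis by (rule integral_zero_cover[OF \<W>(1) _ \<xi>(1)]) (use \<W> K(2) in blast)+
qed

end

theorem mainTheorem1:
  fixes M1 :: "('a, 'n::{finite,linorder}) manifold"
    and M2 :: "('b, 'n) manifold"
    and f :: "'a \<Rightarrow> 'b"
  assumes "oriented_riemannian_manifold M1"
    and "oriented_riemannian_manifold M2"
    and "Ck_map 2 M1 M2 f"
  shows "(\<forall>p\<in>points M1. coderivative M1 M2 f (cof_df M1 M2 f) p = 0) \<and>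
    (\<forall>\<xi>. Ck_section 1 M1 M2 f (points M1) \<xi> \<and> compactly_supported M1 \<xi> \<longrightarrow>
      has_bochner_integral (riemannian_volume M1)
        (\<lambda>p. hom_ip (tangent M1 p) (tangent M2 (f p))
          (cof_df M1 M2 f p) (pullback_conn M1 M2 f \<xi> p)) 0)"
proof -
  interpret riemannian_map M1 M2 f
    using assms by unfold_locales (auto simp: oriented_riemannian_manifold_def)
  show ?thesis using coderivative_cof_zero integral_zero by blast
qed

end
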